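(* Let $n,m\ge1$, let $V_1,\ldots,V_{2m}\le\mathbb{R}^n$ be coordinate subspaces with $V_{j+m}=V_j$ for $1\le j\le m$, and assume that the kernels $\ker L_j=V_j^\perp$ satisfy $\bigoplus_{j=1}^m\ker L_j=\mathbb{R}^n$ (direct sum). Let $p_1,\ldots,p_{2m}\in[1,\infty]$. Then there is a finite constant $C$ such that $$\mathcal{M}(f_1,\ldots,f_{2m})\le C\prod_{j=1}^m\|f_j\|_{L^{p_j}(V_j\times\mathbb{R}^n\times\mathbb{R})}\,\|f_{j+m}\|_{L^{p_{j+m}}(\mathbb{R}^n\times V_j\times\mathbb{R})}$$ for all nonnegative, continuous, compactly supported functions $f_1,\ldots,f_{2m}$ if and only if $$\text{(A)}\quad n+1=\sum_{j=1}^{m}\Big(\frac{\dim V_j+1}{p_j}+\frac{n+1}{p_{j+m}}\Big)=\sum_{j=1}^{m}\Big(\frac{n+1}{p_j}+\frac{\dim V_j+1}{p_{j+m}}\Big)$$ and, for every coordinate subspace $V\le\mathbb{R}^n$, $$\text{(B1)}\quad \dim V+1\le\sum_{j=1}^{m}\Big(\frac{\dim L_jV+1}{p_j}+\frac{\dim V+1}{p_{j+m}}\Big),$$ $$\text{(B2)}\quad \dim V+1\le\sum_{j=1}^{m}\Big(\frac{\dim V+1}{p_j}+\frac{\dim L_jV+1}{p_{j+m}}\Big),$$ $$\text{(C)}\quad \sum_{j=1}^m(\dim V-\dim L_jV)\Big(\frac1{p_j}-\frac1{p_{j+m}}\Big)=0.$$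
   Context: A coordinate subspace of $\mathbb{R}^n$ is the span of a (possibly empty) subset of the standard basis vectors. Identify the Heisenberg group $\mathbb{H}^n$ with $\mathbb{R}^n\times\mathbb{R}^n\times\mathbb{R}$, with coordinates $(x,y,t)$ and Lebesgue measure. For $1\le j\le 2m$, $L_j:\mathbb{R}^n\to V_j$ is the orthogonal projection onto $V_j$ (so $L_{j+m}=L_j$), and $\hat L_j=\mathbb{I}_n-L_j$. For $1\le j\le m$ define $$\pi_j(x,y,t)=(L_jx,\,y,\,t+\tfrac12\hat L_jx\cdot\hat L_jy)\in V_j\times\mathbb{R}^n\times\mathbb{R},$$ $$\pi_{j+m}(x,y,t)=(x,\,L_jy,\,t-\tfrac12\hat L_jx\cdot\hat L_jy)\in\mathbb{R}^n\times V_j\times\mathbb{R},$$ and $$\mathcal{M}(f_1,\ldots,f_{2m})=\int_{\mathbb{H}^n}\prod_{j=1}^{2m}f_j\circ\pi_j(x,y,t)\,dx\,dy\,dt,$$ where $f_j$ is defined on the codomain of $\pi_j$. Convention: $1/\infty=0$. All $L^p$ norms are with respect to Lebesgue measure. *)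

theory Defs
  imports "HOL-Analysis.Analysis" "HOL-Probability.Essential_Supremum"
begin

definition coordinate_subspace :: "'a::euclidean_space set \<Rightarrow> bool" where
  "coordinate_subspace W \<longleftrightarrow> (\<exists>B\<subseteq>Basis. W = span B)"

definition orth_proj :: "'a::euclidean_space set \<Rightarrow> 'a \<Rightarrow> 'a" where
  "orth_proj W x = (THE y. y \<in> W \<and> (\<forall>w\<in>W. orthogonal (x - y) w))"

definition proj_kernel :: "'a::euclidean_space set \<Rightarrow> 'a set" where
  "proj_kernel W = {x. orth_proj W x = 0}"

definition is_direct_sum :: "'i set \<Rightarrow> ('i \<Rightarrow> 'a::euclidean_space set) \<Rightarrow> bool" where
  "is_direct_sum J K \<longleftrightarrow> (\<forall>x. \<exists>!u. u \<in> (\<Pi>\<^sub>E j\<in>J. K j) \<and> x = (\<Sum>j\<in>J. u j))"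

text \<open>Lebesgue measure (on Borel sets) of a coordinate subspace \<open>W\<close>, as a measure with space
  \<open>W\<close>: the product of one-dimensional Lebesgue measures over the basis vectors in \<open>W\<close>. For
  \<open>W = UNIV\<close> this is \<open>lborel\<close> (cf. \<open>lborel_eq\<close>); for \<open>W = {0}\<close> it is the unit point mass.
  The definition is meant for coordinate subspaces only.\<close>

definition coord_lborel :: "'a::euclidean_space set \<Rightarrow> 'a measure" where
  "coord_lborel W = distr (\<Pi>\<^sub>M b\<in>Basis \<inter> W. lborel) (restrict_space borel W)
     (\<lambda>\<omega>. \<Sum>b\<in>Basis \<inter> W. \<omega> b *\<^sub>R b)"

text \<open>The exponent ranges over \<open>[1, \<infinity>]\<close>; the norm is \<open>\<infinity>\<close> when the defining integral is.\<close>

definition Lp_norm :: "'b measure \<Rightarrow> ennreal \<Rightarrow> ('b \<Rightarrow> real) \<Rightarrow> ennreal" where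
  "Lp_norm M p f =
    (if p = \<infinity> then esssup M (\<lambda>z. ennreal \<bar>f z\<bar>)
     else let I = (\<integral>\<^sup>+ z. ennreal (\<bar>f z\<bar> powr enn2real p) \<partial>M)
          in if I = \<infinity> then \<infinity> else ennreal (enn2real I powr (1 / enn2real p)))"

text \<open>In \<open>ennreal\<close> one has \<open>1 / \<infinity> = 0\<close>.\<close>

definition recip :: "ennreal \<Rightarrow> real" where
  "recip p = enn2real (1 / p)"

text \<open>The Heisenberg group in the coordinates \<open>(x, y, t)\<close>.\<close>

type_synonym 'a heis = "'a \<times> 'a \<times> real"

text \<open>\<open>V j \<times> \<real>\<^sup>n \<times> \<real>\<close> and \<open>\<real>\<^sup>n \<times> V j \<times> \<real>\<close> are realised as subsets of the
  ambient type \<open>'a heis\<close>, so that one family can collect all of the maps and all of the functions.\<close>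

definition heis_proj1 :: "'a::euclidean_space set \<Rightarrow> 'a heis \<Rightarrow> 'a heis" where
  "heis_proj1 W = (\<lambda>(x, y, t).
     (orth_proj W x, y, t + 1/2 * ((x - orth_proj W x) \<bullet> (y - orth_proj W y))))"

definition heis_proj2 :: "'a::euclidean_space set \<Rightarrow> 'a heis \<Rightarrow> 'a heis" where
  "heis_proj2 W = (\<lambda>(x, y, t).
     (x, orth_proj W y, t - 1/2 * ((x - orth_proj W x) \<bullet> (y - orth_proj W y))))"

definition heis_proj :: "nat \<Rightarrow> (nat \<Rightarrow> 'a::euclidean_space set) \<Rightarrow> nat \<Rightarrow> 'a heis \<Rightarrow> 'a heis" where
  "heis_proj m V j = (if j \<le> m then heis_proj1 (V j) else heis_proj2 (V j))"

definition heis_codomain :: "nat \<Rightarrow> (nat \<Rightarrow> 'a::euclidean_space set) \<Rightarrow> nat \<Rightarrow> 'a heis set" where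
  "heis_codomain m V j = (if j \<le> m then V j \<times> UNIV \<times> UNIV else UNIV \<times> V j \<times> UNIV)"

definition heis_codomain_measure ::
    "nat \<Rightarrow> (nat \<Rightarrow> 'a::euclidean_space set) \<Rightarrow> nat \<Rightarrow> 'a heis measure" where
  "heis_codomain_measure m V j =
     (if j \<le> m then coord_lborel (V j) \<Otimes>\<^sub>M (lborel \<Otimes>\<^sub>M lborel)
      else lborel \<Otimes>\<^sub>M (coord_lborel (V j) \<Otimes>\<^sub>M lborel))"

definition heis_form ::
    "nat \<Rightarrow> (nat \<Rightarrow> 'a::euclidean_space set) \<Rightarrow> (nat \<Rightarrow> 'a heis \<Rightarrow> real) \<Rightarrow> ennreal" where
  "heis_form m V f = (\<integral>\<^sup>+ z. (\<Prod>j=1..2*m. ennreal (f j (heis_proj m V j z))) \<partial>lborel)"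

text \<open>Nonnegative, continuous, compactly supported functions on the space \<open>S\<close>; the support is
  the closure, relative to \<open>S\<close>, of the set where the function does not vanish.\<close>

definition nonneg_Cc :: "'b::topological_space set \<Rightarrow> ('b \<Rightarrow> real) \<Rightarrow> bool" where
  "nonneg_Cc S f \<longleftrightarrow> (\<forall>z\<in>S. 0 \<le> f z) \<and> continuous_on S f \<and>
     compact (S \<inter> closure {z\<in>S. f z \<noteq> 0})"

end

theory Submission
  imports Defs
begin

text \<open>Let \<open>B\<^sub>j\<close> be the set of basis vectors spanning \<open>ker L\<^sub>j\<close>; these sets partition the standard
  basis. Put \<open>a\<^sub>j = 1/p\<^sub>j\<close>, \<open>b\<^sub>j = 1/p\<^sub>j\<^sub>+\<^sub>m\<close> and \<open>\<sigma> = \<Sum>(a\<^sub>j + b\<^sub>j) - 1\<close>. Conditions (A), (B1), (B2), (C)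
  together say that \<open>a\<^sub>j = b\<^sub>j \<ge> \<sigma>\<close> whenever \<open>B\<^sub>j \<noteq> {}\<close>, and that \<open>\<Sum>|B\<^sub>j| a\<^sub>j = (n + 1) \<sigma>\<close>.

  Necessity follows by testing on boxes with side lengths \<open>r^\<alpha>\<close> in \<open>x\<close>, \<open>r^\<beta>\<close> in \<open>y\<close> and \<open>r^\<omega>\<close> in
  \<open>t\<close>, where \<open>\<alpha> + \<beta> \<le> \<omega>\<close> in each coordinate, and letting \<open>r\<close> tend to infinity.

  For sufficiency, write \<open>f\<^sub>j = g\<^sub>j^a\<^sub>j\<close> with \<open>g\<^sub>j\<close> integrable. The admissible exponents are convex
  combinations of Hoelder's case for the \<open>j\<close> with \<open>B\<^sub>j = {}\<close> and of one vertex for each nonempty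
  \<open>B\<^sub>k\<close>, so Hoelder's inequality reduces everything to the vertices. At the vertex \<open>k\<close> one fixes the
  coordinates outside \<open>B\<^sub>k\<close>, uses the bilinear inequality for averages over hyperplanes in the
  remaining Heisenberg group of dimension \<open>d = |B\<^sub>k|\<close>, and closes with a Loomis-Whitney inequality.
  The hyperplane estimate (\<open>L^p\<close> to \<open>L^q\<close> with \<open>p = (d+2)/(d+1)\<close>, \<open>q = d+2\<close>) is proved by induction on
  \<open>d\<close>. For \<open>d = 1\<close>, the third power of the norm is an integral over two points of the plane
  and the ratio in which a third point divides their segment; Hoelder's inequality in the points leaves
  the convergent integral of \<open>|\<lambda>|^(-2/3) |1-\<lambda>|^(-2/3)\<close>.\<close>

section \<open>Real powers of extended nonnegative reals\<close>

text \<open>The obstacle is the shear in \<open>t\<close>, which couples the coordinates of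
  \<open>x\<close> and \<open>y\<close> and defeats a direct coordinate-wise use of Hoelder's
  inequality. It comes apart because the blocks \<open>B j\<close> are disjoint: with the
  coordinates outside \<open>B k\<close> frozen, the shear of a map with \<open>j \<noteq> k\<close>
  is a constant and disappears by translation in \<open>t\<close>. Only the pair of index
  \<open>k\<close> keeps a shear, and its two halves add up to the full product of \<open>x\<close>
  and \<open>y\<close>; this is where averages over hyperplanes enter. The vertices come from
  \<open>v j = a j - \<sigma>\<close>. With d_j the size of \<open>B j\<close>, the scaling identity
  says that the sum of d_j v_j is \<sigma>. If only v_k is nonzero and N blocks are nonempty, the
  definition of \<sigma> reads 2 (N d_k v_k + v_k) = 1 + d_k v_k, hence v_k = 1/D with D = (2N - 1)
  d_k + 2. In dimension one the third power is natural because two points determine a line: the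
  Jacobian of placing the third point on it cancels that of replacing the line by two of its points,
  so no weight remains. In the induction on d the marginal in the new coordinate is factored out,
  and the values 0 and infinity of this marginal need separate care.\<close>

text \<open>The value \<open>a powe 0 = 1\<close>, also at \<open>a = 0\<close> and \<open>a = \<infinity>\<close>, makes a factor with exponent \<open>p\<^sub>j = \<infinity>\<close> disappear from
  the products below.\<close>

definition epow :: "ennreal \<Rightarrow> real \<Rightarrow> ennreal"  (infixr "powe" 80) where
  "a powe c = (if c = 0 then 1 else if a = \<infinity> then \<infinity> else ennreal (enn2real a powr c))"

lemma epow_0 [simp]: "a powe 0 = 1"
  by (simp add: epow_def)

lemma epow_1 [simp]: "a powe 1 = a"
  by (cases a) (auto simp: epow_def)

lemma one_epow [simp]: "1 powe c = 1"
  by (simp add: epow_def)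

lemma zero_epow: "c \<noteq> 0 \<Longrightarrow> 0 powe c = 0"
  by (simp add: epow_def)

lemma top_epow: "c \<noteq> 0 \<Longrightarrow> top powe c = top"
  by (simp add: epow_def)

lemma epow_ennreal: "0 \<le> r \<Longrightarrow> c \<noteq> 0 \<Longrightarrow> ennreal r powe c = ennreal (r powr c)"
  by (simp add: epow_def)

lemma epow_ennreal_pos: "0 < r \<Longrightarrow> ennreal r powe c = ennreal (r powr c)"
  by (simp add: epow_def)

lemma epow_eq_top: "a powe c = top \<longleftrightarrow> c \<noteq> 0 \<and> a = top"
  by (simp add: epow_def)

lemma epow_mono: "0 \<le> c \<Longrightarrow> a \<le> b \<Longrightarrow> a powe c \<le> b powe c"
  by (cases a; cases b) (auto simp: epow_def top_unique intro!: ennreal_leI powr_mono2)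

lemma epow_mult: "0 \<le> c \<Longrightarrow> (a * b) powe c = a powe c * b powe c"
  by (cases a; cases b)
     (auto simp: epow_def powr_mult ennreal_mult enn2real_mult ennreal_mult_top ennreal_top_mult
        ennreal_mult_eq_top_iff ennreal_zero_less_top)

lemma epow_add:
  assumes "0 \<le> c" "0 \<le> d"
  shows "a powe (c + d) = a powe c * a powe d"
  using assms
  by (cases a) (auto simp: epow_def powr_add ennreal_mult ennreal_top_mult)

lemma epow_epow: "(a powe c) powe d = a powe (c * d)"
  by (cases a) (auto simp: epow_def powr_powr)

lemma epow_power: "(a powe c) ^ n = a powe (c * real n)"
proof (cases "c = 0 \<or> n = 0 \<or> a = \<infinity>")
  case False
  then show ?thesis
    by (cases a) (auto simp: epow_def ennreal_power powr_powr [symmetric] powr_realpow')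
next
  case True
  then show ?thesis
    by (cases n) (auto simp: epow_def power_top_ennreal)
qed

lemma epow_of_nat: "a powe (real n) = a ^ n"
  using epow_power[of a 1 n] by simp

lemma epow_prod: "0 \<le> c \<Longrightarrow> (\<Prod>k\<in>K. f k) powe c = (\<Prod>k\<in>K. f k powe c)"
  by (induction K rule: infinite_finite_induct) (auto simp: epow_mult)

lemma epow_sum: "(\<And>k. k \<in> K \<Longrightarrow> 0 \<le> c k) \<Longrightarrow> a powe (\<Sum>k\<in>K. c k) = (\<Prod>k\<in>K. a powe c k)"
  by (induction K rule: infinite_finite_induct) (auto simp: epow_add sum_nonneg)

lemma measurable_epow [measurable (raw)]:
  assumes [measurable]: "f \<in> borel_measurable M"
  shows "(\<lambda>x. f x powe c) \<in> borel_measurable M"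
  unfolding epow_def by measurable

section \<open>Weighted means and Hoelder's inequality for finitely many factors\<close>

lemma weighted_am_gm:
  fixes c a :: "'k \<Rightarrow> real"
  assumes "finite K" "(\<Sum>k\<in>K. c k) = 1" "\<And>k. k \<in> K \<Longrightarrow> 0 \<le> c k" "\<And>k. k \<in> K \<Longrightarrow> 0 < a k"
  shows "(\<Prod>k\<in>K. a k powr c k) \<le> (\<Sum>k\<in>K. c k * a k)"
proof -
  have "(\<Prod>k\<in>K. a k powr c k) = exp (\<Sum>k\<in>K. c k *\<^sub>R ln (a k))"
    using assms by (force simp: exp_sum powr_def intro!: prod.cong)
  \<comment> \<open>Jensen's inequality for \<open>exp\<close> at the points
    \<open>ln (a k)\<close>.\<close>
  also have "\<dots> \<le> (\<Sum>k\<in>K. c k * exp (ln (a k)))"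
    by (rule convex_on_sum[where C=UNIV])
       (use assms in \<open>auto intro!: exp_convex\<close>)
  also have "\<dots> = (\<Sum>k\<in>K. c k * a k)"
    using assms by (intro sum.cong) auto
  finally show ?thesis .
qed

text \<open>Indices of weight 0 are removed first, since their factor is 1 even where
  \<open>a k\<close> is infinite. Among the others a value 0 kills the product, an infinite value
  makes the sum infinite, and otherwise all values are real and positive.\<close>

lemma weighted_am_gm_ennreal:
  assumes "finite K" "(\<Sum>k\<in>K. c k) = 1" "\<And>k. k \<in> K \<Longrightarrow> 0 \<le> c k"
  shows "(\<Prod>k\<in>K. a k powe c k) \<le> (\<Sum>k\<in>K. ennreal (c k) * a k)"
proof -
  define K' where "K' = {k \<in> K. c k \<noteq> 0}"
  have K': "finite K'" "K' \<subseteq> K" "\<And>k. k \<in> K' \<Longrightarrow> 0 < c k"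
    using assms by (auto simp: K'_def order.strict_iff_order)
  have prod_K': "(\<Prod>k\<in>K. a k powe c k) = (\<Prod>k\<in>K'. a k powe c k)"
    by (rule prod.mono_neutral_right) (use assms in \<open>auto simp: K'_def\<close>)
  have sum_K': "(\<Sum>k\<in>K. c k) = (\<Sum>k\<in>K'. c k)"
    by (rule sum.mono_neutral_right) (use assms in \<open>auto simp: K'_def\<close>)
  have sum_le: "(\<Sum>k\<in>K'. ennreal (c k) * a k) \<le> (\<Sum>k\<in>K. ennreal (c k) * a k)"
    by (rule sum_mono2) (use assms K' in auto)
  consider (zero) k where "k \<in> K'" "a k = 0" | (top) k where "k \<in> K'" "a k = \<infinity>"
    | (pos) "\<And>k. k \<in> K' \<Longrightarrow> a k \<noteq> 0 \<and> a k \<noteq> \<infinity>" by blast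
  then show ?thesis
  proof cases
    case zero
    then have "(\<Prod>k\<in>K'. a k powe c k) = 0"
      using K' by (intro prod_zero) (auto intro!: bexI[of _ k] simp: zero_epow K'_def)
    then show ?thesis unfolding prod_K' by (simp only: zero_le)
  next
    case top
    then have "ennreal (c k) * a k = \<infinity>"
      using K'(3)[of k] by (simp add: ennreal_mult_top)
    then have "(\<Sum>k\<in>K'. ennreal (c k) * a k) = \<infinity>"
      using top(1) K'(1) by (subst infinity_ennreal_def, subst ennreal_sum_eq_top) auto
    then show ?thesis using sum_le by (simp add: top_unique)
  next
    case pos
    define r where "r k = enn2real (a k)" for k
    have r: "a k = ennreal (r k)" "0 < r k" if "k \<in> K'" for k
      using pos[OF that] by (cases "a k"; auto simp: r_def)+
    have "(\<Prod>k\<in>K'. a k powe c k) = (\<Prod>k\<in>K'. ennreal (r k powr c k))"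
      by (intro prod.cong) (auto simp: r epow_ennreal_pos)
    also have "\<dots> = ennreal (\<Prod>k\<in>K'. r k powr c k)"
      by (simp add: prod_ennreal)
    also have "\<dots> \<le> ennreal (\<Sum>k\<in>K'. c k * r k)"
      using K' r assms(2) sum_K' by (intro ennreal_leI weighted_am_gm) (auto intro: less_imp_le)
    also have "\<dots> = (\<Sum>k\<in>K'. ennreal (c k * r k))"
      by (rule sum_ennreal[symmetric]) (use K' r in \<open>auto intro!: mult_nonneg_nonneg less_imp_le\<close>)
    also have "\<dots> = (\<Sum>k\<in>K'. ennreal (c k) * a k)"
      by (intro sum.cong) (use K' r in \<open>auto simp: ennreal_mult less_imp_le\<close>)
    finally show ?thesis using sum_le prod_K' by simp
  qed
qed

text \<open>Each factor is divided by its integral and the weighted mean inequality is applied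
  pointwise. An integral 0 makes the product vanish almost everywhere; an infinite one, when none is
  0, makes the right side infinite. Both cases look only at nonzero weights, so a factor of weight 0
  may be any measurable function.\<close>

lemma nn_integral_Holder:
  assumes "finite K" "(\<Sum>k\<in>K. c k) = 1" and c: "\<And>k. k \<in> K \<Longrightarrow> 0 \<le> c k"
    and meas [measurable]: "\<And>k. k \<in> K \<Longrightarrow> f k \<in> borel_measurable M"
  shows "(\<integral>\<^sup>+x. (\<Prod>k\<in>K. f k x powe c k) \<partial>M) \<le> (\<Prod>k\<in>K. (\<integral>\<^sup>+x. f k x \<partial>M) powe c k)"
proof -
  define N where "N k = (\<integral>\<^sup>+x. f k x \<partial>M)" for k
  consider (zero) k where "k \<in> K" "c k \<noteq> 0" "N k = 0"
    | (top) k where "k \<in> K" "c k \<noteq> 0" "N k = \<infinity>" "\<And>k. k \<in> K \<Longrightarrow> c k \<noteq> 0 \<Longrightarrow> N k \<noteq> 0"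
    | (pos) "\<And>k. k \<in> K \<Longrightarrow> c k \<noteq> 0 \<Longrightarrow> N k \<noteq> 0 \<and> N k \<noteq> \<infinity>" by blast
  then show ?thesis
  proof cases
    case zero
    then have "AE x in M. f k x = 0"
      using meas by (auto simp: N_def nn_integral_0_iff_AE)
    then have "AE x in M. (\<Prod>k\<in>K. f k x powe c k) = 0"
    proof eventually_elim
      case (elim x)
      then have "f k x powe c k = 0" using zero by (simp add: zero_epow)
      then show ?case using zero assms(1) by (intro prod_zero) auto
    qed
    then have "(\<integral>\<^sup>+x. (\<Prod>k\<in>K. f k x powe c k) \<partial>M) = (\<integral>\<^sup>+x. 0 \<partial>M)"
      by (rule nn_integral_cong_AE)
    then show ?thesis by simp
  next
    case top
    have "N k powe c k \<noteq> 0" if "k \<in> K" for k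
      using top(4)[OF that] by (cases "N k") (auto simp: epow_def)
    moreover have "N k powe c k = \<infinity>" using top by (simp add: top_epow)
    ultimately have "(\<Prod>k\<in>K. N k powe c k) = \<infinity>"
      using assms(1) \<open>k \<in> K\<close> by (auto simp: ennreal_prod_eq_top)
    then show ?thesis by (simp add: N_def)
  next
    case pos
    define P where "P = (\<Prod>k\<in>K. N k powe c k)"
    have split: "f k x powe c k = N k powe c k * (f k x / N k) powe c k" if "k \<in> K" for k x
    proof (cases "c k = 0")
      case False
      have "N k * (f k x / N k) = f k x"
        using pos[OF that False] by (metis ennreal_mult_divide_eq ennreal_times_divide infinity_ennreal_def mult.commute)
      then show ?thesis using c[OF that] by (metis epow_mult)
    qed auto
    have "(\<integral>\<^sup>+x. (\<Prod>k\<in>K. f k x powe c k) \<partial>M) = (\<integral>\<^sup>+x. P * (\<Prod>k\<in>K. (f k x / N k) powe c k) \<partial>M)"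
      unfolding P_def prod.distrib[symmetric] by (intro nn_integral_cong prod.cong split refl)
    also have "\<dots> \<le> (\<integral>\<^sup>+x. P * (\<Sum>k\<in>K. ennreal (c k) * (f k x / N k)) \<partial>M)"
      using assms by (intro nn_integral_mono mult_left_mono weighted_am_gm_ennreal) auto
    also have "\<dots> = P * (\<Sum>k\<in>K. ennreal (c k) * (N k / N k))"
      by (simp add: nn_integral_cmult nn_integral_sum nn_integral_divide N_def)
    \<comment> \<open>At weight 0 nothing is known about the quotient \<open>N k / N k\<close>, but
      the coefficient 0 removes it.\<close>
    also have "(\<Sum>k\<in>K. ennreal (c k) * (N k / N k)) \<le> (\<Sum>k\<in>K. ennreal (c k))"
    proof (intro sum_mono)
      fix k assume "k \<in> K"
      show "ennreal (c k) * (N k / N k) \<le> ennreal (c k)"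
        using pos[OF \<open>k \<in> K\<close>] by (cases "c k = 0") (auto simp: ennreal_times_divide ennreal_mult_divide_eq)
    qed
    also have "\<dots> = 1"
      using assms by (subst sum_ennreal) auto
    finally show ?thesis by (simp add: P_def N_def mult_left_mono)
  qed
qed

lemma nn_integral_Holder2:
  assumes "0 \<le> c" "0 \<le> d" "c + d = 1"
    and [measurable]: "f \<in> borel_measurable M" "g \<in> borel_measurable M"
  shows "(\<integral>\<^sup>+x. f x powe c * g x powe d \<partial>M) \<le> (\<integral>\<^sup>+x. f x \<partial>M) powe c * (\<integral>\<^sup>+x. g x \<partial>M) powe d"
  using nn_integral_Holder[of "UNIV :: bool set" "\<lambda>b. if b then c else d" "\<lambda>b. if b then f else g" M] assms
  by (auto simp: UNIV_bool mult.commute add.commute)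

lemma nn_integral_swap:
  assumes "sigma_finite_measure M" "sigma_finite_measure N"
    and "(\<lambda>(x, y). f x y) \<in> borel_measurable (M \<Otimes>\<^sub>M N)"
  shows "(\<integral>\<^sup>+x. \<integral>\<^sup>+y. f x y \<partial>N \<partial>M) = (\<integral>\<^sup>+y. \<integral>\<^sup>+x. f x y \<partial>M \<partial>N)"
  using pair_sigma_finite.Fubini'[of M N f] assms by (simp add: pair_sigma_finite_def)

lemmas nn_integral_swap_lborel =
  nn_integral_swap[OF lborel.sigma_finite_measure_axioms lborel.sigma_finite_measure_axioms]

section \<open>The Radon-type inequality in one dimension\<close>

lemma nn_integral_affine:
  fixes f :: "'a::euclidean_space \<Rightarrow> ennreal"
  assumes [measurable]: "f \<in> borel_measurable borel" and "c \<noteq> 0"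
  shows "(\<integral>\<^sup>+z. f (a + c *\<^sub>R z) \<partial>lborel) = ennreal (1 / \<bar>c\<bar> ^ DIM('a)) * (\<integral>\<^sup>+z. f z \<partial>lborel)"
proof -
  have "(\<integral>\<^sup>+z. f z \<partial>lborel) = ennreal (\<bar>c\<bar> ^ DIM('a)) * (\<integral>\<^sup>+z. f (a + c *\<^sub>R z) \<partial>lborel)"
    by (subst lborel_affine[OF assms(2), of a])
       (simp add: nn_integral_density nn_integral_distr nn_integral_cmult)
  then show ?thesis
    using assms(2) by (simp add: mult.assoc[symmetric] ennreal_mult[symmetric])
qed

lemma nn_integral_shift:
  fixes f :: "real \<Rightarrow> ennreal"
  assumes "f \<in> borel_measurable borel"
  shows "(\<integral>\<^sup>+t. f (t + a) \<partial>lborel) = (\<integral>\<^sup>+t. f t \<partial>lborel)"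
  using nn_integral_affine[OF assms, of 1 a] by (simp add: add.commute)

text \<open>The singularities at 0 and 1 have order 2/3 < 1, and the decay at infinity has order 4/3
  > 1. One profile \<open>k\<close> on the half-line, reflected and translated, dominates the kernel
  on either side of 0 and of 1.\<close>

lemma nn_integral_powr_kernel_finite:
  "(\<integral>\<^sup>+l. ennreal (\<bar>l\<bar> powr (-2/3) * \<bar>1 - l\<bar> powr (-2/3)) \<partial>lborel) < \<infinity>"
proof -
  \<comment> \<open>The factor 2 bounds the power belonging to the farther singularity: at distance
    at least 1/2 it is at most \<open>(1/2) powr (-1)\<close>.\<close>
  define k :: "real \<Rightarrow> ennreal" where
    "k r = 2 * (ennreal (r powr (-2/3)) * indicator {0..1} r) + ennreal (r powr (-4/3)) * indicator {1..} r" for r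
  have [measurable]: "k \<in> borel_measurable borel"
    unfolding k_def by measurable
  have "(\<integral>\<^sup>+r. k r \<partial>lborel) < \<infinity>"
  proof -
    have "(\<integral>\<^sup>+r. ennreal (r powr (-2/3)) * indicator {0..1} r \<partial>lborel) = ennreal 3"
      using has_integral_powr_from_0[of "-2/3" 1]
      by (intro nn_integral_has_integral_lebesgue') auto
    moreover have "(\<integral>\<^sup>+r. ennreal (r powr (-4/3)) * indicator {1..} r \<partial>lborel) = ennreal 3"
      using has_integral_powr_to_inf[of "-4/3" 1]
      by (intro nn_integral_has_integral_lebesgue') auto
    ultimately show ?thesis
      by (simp add: k_def nn_integral_add nn_integral_cmult ennreal_mult_less_top)
  qed
  moreover have "(\<integral>\<^sup>+r. k (a + c * r) \<partial>lborel) = (\<integral>\<^sup>+r. k r \<partial>lborel)" if "\<bar>c\<bar> = 1" for a c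
    using nn_integral_affine[of k c a] that by auto
  from this[of 1 0] this[of "-1" 0] this[of "-1" 1] this[of 1 "-1"]
  have "(\<integral>\<^sup>+r. k r + k (-r) + k (1 - r) + k (-1 + r) \<partial>lborel) = (\<integral>\<^sup>+r. k r \<partial>lborel) + (\<integral>\<^sup>+r. k r \<partial>lborel) + (\<integral>\<^sup>+r. k r \<partial>lborel) + (\<integral>\<^sup>+r. k r \<partial>lborel)"
    by (simp add: nn_integral_add)
  moreover have "ennreal (\<bar>l\<bar> powr (-2/3) * \<bar>1 - l\<bar> powr (-2/3)) \<le> k l + k (-l) + k (1 - l) + k (-1 + l)" for l
  proof -
    \<comment> \<open>Here \<open>m\<close> is the distance to the nearer of the points 0 and 1 and
      \<open>n\<close> that to the farther; as the two distances add up to at least 1,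
      \<open>n\<close> is at least 1/2.\<close>
    have key: "ennreal (m powr (-2/3) * n powr (-2/3)) \<le> k m" if "0 \<le> m" "m \<le> n" "1/2 \<le> n" for m n
    proof (cases "m \<le> 1")
      case True
      have "n powr (-2/3) \<le> (1/2) powr (-2/3)"
        using that by (intro powr_mono2') auto
      also have "\<dots> \<le> (1/2) powr (-1)"
        by (intro powr_mono') auto
      finally have "m powr (-2/3) * n powr (-2/3) \<le> m powr (-2/3) * 2"
        by (intro mult_left_mono) (auto simp: powr_minus)
      then have "ennreal (m powr (-2/3) * n powr (-2/3)) \<le> 2 * ennreal (m powr (-2/3))"
        by (metis ennreal_leI ennreal_mult'' ennreal_numeral mult.commute zero_le_numeral)
      also have "\<dots> \<le> k m" using that True by (simp add: k_def)
      finally show ?thesis .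
    next
      case False
      have "m powr (-2/3) * n powr (-2/3) \<le> m powr (-2/3) * m powr (-2/3)"
        using that False by (intro mult_left_mono powr_mono2') auto
      also have "\<dots> = m powr (-4/3)" by (simp add: powr_add[symmetric])
      finally show ?thesis using False by (simp add: k_def ennreal_leI)
    qed
    consider "0 \<le> l" "l \<le> \<bar>1 - l\<bar>" | "l < 0" | "0 \<le> l" "\<bar>1 - l\<bar> < l" "l \<le> 1" | "1 < l"
      by linarith
    then show ?thesis
    proof cases
      case 1
      then have "ennreal (\<bar>l\<bar> powr (-2/3) * \<bar>1 - l\<bar> powr (-2/3)) \<le> k l"
        using key[of l "\<bar>1 - l\<bar>"] by auto
      then show ?thesis by (simp add: add_increasing2 add.assoc)
    next
      case 2
      then have "ennreal (\<bar>l\<bar> powr (-2/3) * \<bar>1 - l\<bar> powr (-2/3)) \<le> k (-l)"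
        using key[of "-l" "\<bar>1 - l\<bar>"] by auto
      then show ?thesis by (simp add: add_increasing add_increasing2 add.assoc)
    next
      case 3
      then have "ennreal (\<bar>l\<bar> powr (-2/3) * \<bar>1 - l\<bar> powr (-2/3)) \<le> k (1 - l)"
        using key[of "1 - l" l] by (auto simp: mult.commute)
      then show ?thesis by (simp add: add_increasing add_increasing2 add.assoc)
    next
      case 4
      then have "ennreal (\<bar>l\<bar> powr (-2/3) * \<bar>1 - l\<bar> powr (-2/3)) \<le> k (-1 + l)"
        using key[of "-1 + l" l] by (auto simp: mult.commute)
      then show ?thesis by (simp add: add_increasing)
    qed
  qed
  then have "(\<integral>\<^sup>+l. ennreal (\<bar>l\<bar> powr (-2/3) * \<bar>1 - l\<bar> powr (-2/3)) \<partial>lborel)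
      \<le> (\<integral>\<^sup>+r. k r + k (-r) + k (1 - r) + k (-1 + r) \<partial>lborel)"
    by (rule nn_integral_mono)
  ultimately show ?thesis
    by (auto elim!: le_less_trans)
qed

text \<open>The base is the Jacobian of a dilation of the plane by \<open>l\<close>, the exponent a
  Hoelder weight.\<close>

lemma epow_inverse_square:
  fixes l :: real
  assumes "l \<noteq> 0"
  shows "ennreal (1 / \<bar>l\<bar>\<^sup>2) powe (1/3) = ennreal (\<bar>l\<bar> powr (-2/3))"
proof -
  have "1 / \<bar>l\<bar>\<^sup>2 = \<bar>l\<bar> powr (-2)"
    using assms by (simp add: powr_minus_divide)
  then show ?thesis
    by (simp only:) (simp add: epow_ennreal powr_powr)
qed

text \<open>The integrand is a product over the three pairs of points, each pair taken to the power
  1/3, so Hoelder with weights 1/3 leaves three double integrals. Each is the square of the integral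
  of \<open>g\<close> times the Jacobian of using the third point as a variable: 1,
  \<open>1 / \<bar>l\<bar>\<^sup>2\<close> or \<open>1 / \<bar>1 - l\<bar>\<^sup>2\<close>.\<close>

lemma trilinear_collinear_bound:
  fixes g :: "real \<times> real \<Rightarrow> ennreal"
  assumes [measurable]: "g \<in> borel_measurable borel" and l: "l \<noteq> 0" "l \<noteq> 1"
  shows "(\<integral>\<^sup>+z. \<integral>\<^sup>+w. g z powe (2/3) * g w powe (2/3) * g (z + l *\<^sub>R (w - z)) powe (2/3) \<partial>lborel \<partial>lborel)
    \<le> ennreal (\<bar>l\<bar> powr (-2/3) * \<bar>1 - l\<bar> powr (-2/3)) * (\<integral>\<^sup>+z. g z \<partial>lborel)\<^sup>2"
proof -
  define N where "N = (\<integral>\<^sup>+z. g z \<partial>lborel)"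
  define u :: "nat \<Rightarrow> (real \<times> real) \<times> (real \<times> real) \<Rightarrow> ennreal" where
    "u i = (\<lambda>(z, w). if i = 0 then g z * g w else if i = 1 then g z * g (z + l *\<^sub>R (w - z))
        else g w * g (z + l *\<^sub>R (w - z)))" for i
  have [measurable]: "u i \<in> borel_measurable (lborel \<Otimes>\<^sub>M lborel)" for i
    unfolding u_def by measurable
  have cube: "(a * b) powe (1/3) * (a * c) powe (1/3) * (b * c) powe (1/3)
      = a powe (2/3) * b powe (2/3) * c powe (2/3)" for a b c
    using epow_add[of "1/3" "1/3" a] epow_add[of "1/3" "1/3" b] epow_add[of "1/3" "1/3" c]
    by (simp add: epow_mult mult_ac)
  have "(\<integral>\<^sup>+z. \<integral>\<^sup>+w. g z powe (2/3) * g w powe (2/3) * g (z + l *\<^sub>R (w - z)) powe (2/3) \<partial>lborel \<partial>lborel)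
    = (\<integral>\<^sup>+p. (\<Prod>i<3. u i p powe (1/3)) \<partial>(lborel \<Otimes>\<^sub>M lborel))"
    by (subst lborel.nn_integral_fst[symmetric], measurable)
       (simp add: u_def eval_nat_numeral lessThan_Suc cube[symmetric, unfolded mult.assoc] mult.assoc,
         simp add: mult_ac)
  also have "\<dots> \<le> (\<Prod>i<3. (\<integral>\<^sup>+p. u i p \<partial>(lborel \<Otimes>\<^sub>M lborel)) powe (1/3))"
    by (rule nn_integral_Holder) auto
  also have "\<dots> = (\<integral>\<^sup>+z. \<integral>\<^sup>+w. g z * g w \<partial>lborel \<partial>lborel) powe (1/3)
      * (\<integral>\<^sup>+z. \<integral>\<^sup>+w. g z * g (z + l *\<^sub>R (w - z)) \<partial>lborel \<partial>lborel) powe (1/3)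
      * (\<integral>\<^sup>+z. \<integral>\<^sup>+w. g w * g (z + l *\<^sub>R (w - z)) \<partial>lborel \<partial>lborel) powe (1/3)"
    by (simp add: lborel.nn_integral_fst[symmetric], simp add: u_def eval_nat_numeral lessThan_Suc mult.assoc, simp add: mult_ac)
  also have "(\<integral>\<^sup>+z. \<integral>\<^sup>+w. g z * g w \<partial>lborel \<partial>lborel) = N * N"
    by (simp add: nn_integral_cmult nn_integral_multc N_def)
  also have "(\<integral>\<^sup>+z. \<integral>\<^sup>+w. g z * g (z + l *\<^sub>R (w - z)) \<partial>lborel \<partial>lborel)
      = (\<integral>\<^sup>+z. g z * (\<integral>\<^sup>+w. g ((1 - l) *\<^sub>R z + l *\<^sub>R w) \<partial>lborel) \<partial>lborel)"
    by (simp add: nn_integral_cmult algebra_simps)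
  also have "\<dots> = ennreal (1 / \<bar>l\<bar>\<^sup>2) * (N * N)"
    using l by (subst nn_integral_affine) (auto simp: nn_integral_multc N_def mult_ac power2_eq_square)
  also have "(\<integral>\<^sup>+z. \<integral>\<^sup>+w. g w * g (z + l *\<^sub>R (w - z)) \<partial>lborel \<partial>lborel)
      = (\<integral>\<^sup>+w. g w * (\<integral>\<^sup>+z. g (l *\<^sub>R w + (1 - l) *\<^sub>R z) \<partial>lborel) \<partial>lborel)"
    by (subst nn_integral_swap_lborel) (simp_all add: nn_integral_cmult algebra_simps)
  also have "\<dots> = ennreal (1 / \<bar>1 - l\<bar>\<^sup>2) * (N * N)"
    using l by (subst nn_integral_affine) (auto simp: nn_integral_multc N_def mult_ac power2_eq_square)
  also have "(N * N) powe (1/3) * (ennreal (1 / \<bar>l\<bar>\<^sup>2) * (N * N)) powe (1/3)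
      * (ennreal (1 / \<bar>1 - l\<bar>\<^sup>2) * (N * N)) powe (1/3)
      = (ennreal (1 / \<bar>l\<bar>\<^sup>2) powe (1/3) * ennreal (1 / \<bar>1 - l\<bar>\<^sup>2) powe (1/3)) * ((N * N) powe (1/3)) ^ 3"
    by (simp add: epow_mult mult_ac power3_eq_cube)
  also have "((N * N) powe (1/3)) ^ 3 = N\<^sup>2"
    by (simp add: epow_power power2_eq_square)
  also have "ennreal (1 / \<bar>l\<bar>\<^sup>2) powe (1/3) = ennreal (\<bar>l\<bar> powr (-2/3))"
    using l by (intro epow_inverse_square) auto
  also have "ennreal (1 / \<bar>1 - l\<bar>\<^sup>2) powe (1/3) = ennreal (\<bar>1 - l\<bar> powr (-2/3))"
    using l by (intro epow_inverse_square) auto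
  finally show ?thesis by (simp add: N_def ennreal_mult)
qed

lemma nn_integral_lborel_pair:
  fixes f :: "real \<Rightarrow> real \<Rightarrow> ennreal"
  assumes "(\<lambda>(x, y). f x y) \<in> borel_measurable (lborel \<Otimes>\<^sub>M lborel)"
  shows "(\<integral>\<^sup>+z. f (fst z) (snd z) \<partial>lborel) = (\<integral>\<^sup>+x. \<integral>\<^sup>+y. f x y \<partial>lborel \<partial>lborel)"
  using lborel.nn_integral_fst[OF assms] by (simp add: lborel_prod case_prod_unfold)

text \<open>The cube is an integral over three points of the line of slope \<open>x\<close> and
  height \<open>s\<close>, with abscissae \<open>a\<close>, \<open>b\<close> and
  \<open>a + l * (b - a)\<close>. Introducing \<open>l\<close> costs a factor
  \<open>\<bar>b - a\<bar>\<close>; passing from \<open>(x, s)\<close> to the ordinates at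
  \<open>a\<close> and \<open>b\<close> gives it back. The degenerate case \<open>b = a\<close> is a
  null set.\<close>

lemma radon_1d_cube:
  fixes f :: "real \<times> real \<Rightarrow> ennreal"
  assumes [measurable]: "f \<in> borel_measurable borel"
  shows "(\<integral>\<^sup>+x. \<integral>\<^sup>+s. (\<integral>\<^sup>+y. f (y, s + x * y) \<partial>lborel) ^ 3 \<partial>lborel \<partial>lborel)
    = (\<integral>\<^sup>+l. \<integral>\<^sup>+z. \<integral>\<^sup>+w. f z * f w * f (z + l *\<^sub>R (w - z)) \<partial>lborel \<partial>lborel \<partial>lborel)"
    (is "?lhs = ?rhs")
proof -
  define F where "F a b l x s = f (a, s + x * a) * f (b, s + x * b) *
    f (a + l * (b - a), s + x * (a + l * (b - a)))" for a b l x s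
  have [measurable]: "(\<lambda>w. F (a w) (b w) (l w) (x w) (s w)) \<in> borel_measurable M"
    if "a \<in> borel_measurable M" "b \<in> borel_measurable M" "l \<in> borel_measurable M"
      "x \<in> borel_measurable M" "s \<in> borel_measurable M" for a b l x s and M :: "'z measure"
    using that unfolding F_def by measurable
  have "(\<integral>\<^sup>+y. f (y, s + x * y) \<partial>lborel) ^ 3
      = (\<integral>\<^sup>+a. \<integral>\<^sup>+b. \<integral>\<^sup>+l. ennreal \<bar>b - a\<bar> * F a b l x s \<partial>lborel \<partial>lborel \<partial>lborel)" for x s
  proof -
    have "(\<integral>\<^sup>+y. f (y, s + x * y) \<partial>lborel) ^ 3 = (\<integral>\<^sup>+a. \<integral>\<^sup>+b. f (a, s + x * a) * f (b, s + x * b)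
      * (\<integral>\<^sup>+y. f (y, s + x * y) \<partial>lborel) \<partial>lborel \<partial>lborel)"
      by (simp add: nn_integral_cmult nn_integral_multc power3_eq_cube)
    also have "\<dots> = (\<integral>\<^sup>+a. \<integral>\<^sup>+b. \<integral>\<^sup>+l. ennreal \<bar>b - a\<bar> * F a b l x s \<partial>lborel \<partial>lborel \<partial>lborel)"
    proof (rule nn_integral_cong, rule nn_integral_cong_AE)
      fix a :: real
      show "AE b in lborel. f (a, s + x * a) * f (b, s + x * b) * (\<integral>\<^sup>+y. f (y, s + x * y) \<partial>lborel)
          = (\<integral>\<^sup>+l. ennreal \<bar>b - a\<bar> * F a b l x s \<partial>lborel)"
        using AE_lborel_singleton[of a]
      proof eventually_elim
        case (elim b)
        then have "(\<integral>\<^sup>+y. f (y, s + x * y) \<partial>lborel)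
            = \<bar>b - a\<bar> * (\<integral>\<^sup>+l. f (a + (b - a) * l, s + x * (a + (b - a) * l)) \<partial>lborel)"
          by (intro nn_integral_real_affine) auto
        then show ?case
          by (simp add: F_def nn_integral_cmult mult_ac)
      qed
    qed
    finally show ?thesis .
  qed
  then have "?lhs = (\<integral>\<^sup>+x. \<integral>\<^sup>+s. \<integral>\<^sup>+a. \<integral>\<^sup>+b. \<integral>\<^sup>+l. ennreal \<bar>b - a\<bar> * F a b l x s \<partial>lborel \<partial>lborel \<partial>lborel \<partial>lborel \<partial>lborel)"
    by simp
  \<comment> \<open>Tonelli, one adjacent exchange at a time, moves the line parameters
    \<open>x\<close> and \<open>s\<close> to the inside.\<close>
  also have "\<dots> = (\<integral>\<^sup>+x. \<integral>\<^sup>+a. \<integral>\<^sup>+s. \<integral>\<^sup>+b. \<integral>\<^sup>+l. ennreal \<bar>b - a\<bar> * F a b l x s \<partial>lborel \<partial>lborel \<partial>lborel \<partial>lborel \<partial>lborel)"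
    by (intro nn_integral_cong nn_integral_swap_lborel) measurable
  also have "\<dots> = (\<integral>\<^sup>+a. \<integral>\<^sup>+x. \<integral>\<^sup>+s. \<integral>\<^sup>+b. \<integral>\<^sup>+l. ennreal \<bar>b - a\<bar> * F a b l x s \<partial>lborel \<partial>lborel \<partial>lborel \<partial>lborel \<partial>lborel)"
    by (intro nn_integral_cong nn_integral_swap_lborel) measurable
  also have "\<dots> = (\<integral>\<^sup>+a. \<integral>\<^sup>+x. \<integral>\<^sup>+b. \<integral>\<^sup>+s. \<integral>\<^sup>+l. ennreal \<bar>b - a\<bar> * F a b l x s \<partial>lborel \<partial>lborel \<partial>lborel \<partial>lborel \<partial>lborel)"
    by (intro nn_integral_cong nn_integral_swap_lborel) measurable
  also have "\<dots> = (\<integral>\<^sup>+a. \<integral>\<^sup>+b. \<integral>\<^sup>+x. \<integral>\<^sup>+s. \<integral>\<^sup>+l. ennreal \<bar>b - a\<bar> * F a b l x s \<partial>lborel \<partial>lborel \<partial>lborel \<partial>lborel \<partial>lborel)"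
    by (intro nn_integral_cong nn_integral_swap_lborel) measurable
  also have "\<dots> = (\<integral>\<^sup>+a. \<integral>\<^sup>+b. \<integral>\<^sup>+x. \<integral>\<^sup>+l. \<integral>\<^sup>+s. ennreal \<bar>b - a\<bar> * F a b l x s \<partial>lborel \<partial>lborel \<partial>lborel \<partial>lborel \<partial>lborel)"
    by (intro nn_integral_cong nn_integral_swap_lborel) measurable
  also have "\<dots> = (\<integral>\<^sup>+a. \<integral>\<^sup>+b. \<integral>\<^sup>+l. \<integral>\<^sup>+x. \<integral>\<^sup>+s. ennreal \<bar>b - a\<bar> * F a b l x s \<partial>lborel \<partial>lborel \<partial>lborel \<partial>lborel \<partial>lborel)"
    by (intro nn_integral_cong nn_integral_swap_lborel) measurable
  also have "\<dots> = (\<integral>\<^sup>+a. \<integral>\<^sup>+b. \<integral>\<^sup>+l. \<integral>\<^sup>+t. \<integral>\<^sup>+r. f (a, t) * f (b, r) *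
      f ((a, t) + l *\<^sub>R ((b, r) - (a, t))) \<partial>lborel \<partial>lborel \<partial>lborel \<partial>lborel \<partial>lborel)"
  proof (rule nn_integral_cong, rule nn_integral_cong_AE)
    fix a :: real
    show "AE b in lborel. (\<integral>\<^sup>+l. \<integral>\<^sup>+x. \<integral>\<^sup>+s. ennreal \<bar>b - a\<bar> * F a b l x s \<partial>lborel \<partial>lborel \<partial>lborel)
      = (\<integral>\<^sup>+l. \<integral>\<^sup>+t. \<integral>\<^sup>+r. f (a, t) * f (b, r) * f ((a, t) + l *\<^sub>R ((b, r) - (a, t))) \<partial>lborel \<partial>lborel \<partial>lborel)"
      using AE_lborel_singleton[of a]
    proof eventually_elim
      case (elim b)
      show ?case
      proof (rule nn_integral_cong)
        fix l :: real
        define \<Phi> where "\<Phi> t r = f (a, t) * f (b, r) * f ((a, t) + l *\<^sub>R ((b, r) - (a, t)))" for t r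
        have [measurable]: "(\<lambda>w. \<Phi> (t w) (r w)) \<in> borel_measurable M"
          if "t \<in> borel_measurable M" "r \<in> borel_measurable M" for t r and M :: "'z measure"
          using that unfolding \<Phi>_def by measurable
        \<comment> \<open>The ordinates are \<open>t = s + x * a\<close> at \<open>a\<close> and
          \<open>r = t + (b - a) * x\<close> at \<open>b\<close>; the third value is then taken at
          the affine combination of \<open>(a, t)\<close> and \<open>(b, r)\<close> with ratio
          \<open>l\<close>.\<close>
        have F_eq: "F a b l x s = \<Phi> (s + x * a) ((s + x * a) + (b - a) * x)" for x s
          by (simp add: F_def \<Phi>_def algebra_simps)
        have "(\<integral>\<^sup>+x. \<integral>\<^sup>+s. ennreal \<bar>b - a\<bar> * F a b l x s \<partial>lborel \<partial>lborel)
            = (\<integral>\<^sup>+x. \<integral>\<^sup>+t. ennreal \<bar>b - a\<bar> * \<Phi> t (t + (b - a) * x) \<partial>lborel \<partial>lborel)"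
          unfolding F_eq
          by (intro nn_integral_cong nn_integral_shift[where f="\<lambda>t. ennreal \<bar>b - a\<bar> * \<Phi> t (t + (b - a) * _)"]) measurable
        also have "\<dots> = (\<integral>\<^sup>+t. \<integral>\<^sup>+x. ennreal \<bar>b - a\<bar> * \<Phi> t (t + (b - a) * x) \<partial>lborel \<partial>lborel)"
          by (intro nn_integral_swap_lborel) measurable
        also have "\<dots> = (\<integral>\<^sup>+t. \<integral>\<^sup>+r. \<Phi> t r \<partial>lborel \<partial>lborel)"
        proof (rule nn_integral_cong)
          fix t
          show "(\<integral>\<^sup>+x. ennreal \<bar>b - a\<bar> * \<Phi> t (t + (b - a) * x) \<partial>lborel) = (\<integral>\<^sup>+r. \<Phi> t r \<partial>lborel)"
            using elim nn_integral_real_affine[of "\<Phi> t" "b - a" t] by (simp add: nn_integral_cmult)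
        qed
        finally show "(\<integral>\<^sup>+x. \<integral>\<^sup>+s. ennreal \<bar>b - a\<bar> * F a b l x s \<partial>lborel \<partial>lborel)
            = (\<integral>\<^sup>+t. \<integral>\<^sup>+r. f (a, t) * f (b, r) * f ((a, t) + l *\<^sub>R ((b, r) - (a, t))) \<partial>lborel \<partial>lborel)"
          by (simp add: \<Phi>_def)
      qed
    qed
  qed
  \<comment> \<open>The ratio \<open>l\<close> moves outside, and abscissae meet their ordinates so
    that the integrals run over points of the plane.\<close>
  also have "\<dots> = (\<integral>\<^sup>+a. \<integral>\<^sup>+l. \<integral>\<^sup>+b. \<integral>\<^sup>+t. \<integral>\<^sup>+r. f (a, t) * f (b, r) *
      f ((a, t) + l *\<^sub>R ((b, r) - (a, t))) \<partial>lborel \<partial>lborel \<partial>lborel \<partial>lborel \<partial>lborel)"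
    by (intro nn_integral_cong nn_integral_swap_lborel) measurable
  also have "\<dots> = (\<integral>\<^sup>+l. \<integral>\<^sup>+a. \<integral>\<^sup>+b. \<integral>\<^sup>+t. \<integral>\<^sup>+r. f (a, t) * f (b, r) *
      f ((a, t) + l *\<^sub>R ((b, r) - (a, t))) \<partial>lborel \<partial>lborel \<partial>lborel \<partial>lborel \<partial>lborel)"
    by (intro nn_integral_cong nn_integral_swap_lborel) measurable
  also have "\<dots> = (\<integral>\<^sup>+l. \<integral>\<^sup>+a. \<integral>\<^sup>+t. \<integral>\<^sup>+b. \<integral>\<^sup>+r. f (a, t) * f (b, r) *
      f ((a, t) + l *\<^sub>R ((b, r) - (a, t))) \<partial>lborel \<partial>lborel \<partial>lborel \<partial>lborel \<partial>lborel)"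
    by (intro nn_integral_cong nn_integral_swap_lborel) measurable
  also have "\<dots> = ?rhs"
  proof (intro nn_integral_cong)
    fix l :: real
    have "(\<integral>\<^sup>+a. \<integral>\<^sup>+t. \<integral>\<^sup>+b. \<integral>\<^sup>+r. f (a, t) * f (b, r) *
      f ((a, t) + l *\<^sub>R ((b, r) - (a, t))) \<partial>lborel \<partial>lborel \<partial>lborel \<partial>lborel)
      = (\<integral>\<^sup>+a. \<integral>\<^sup>+t. \<integral>\<^sup>+w. f (a, t) * f w * f ((a, t) + l *\<^sub>R (w - (a, t))) \<partial>lborel \<partial>lborel \<partial>lborel)"
      by (intro nn_integral_cong, subst nn_integral_lborel_pair[symmetric]) simp_all
    also have "\<dots> = (\<integral>\<^sup>+z. \<integral>\<^sup>+w. f z * f w * f (z + l *\<^sub>R (w - z)) \<partial>lborel \<partial>lborel)"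
      by (subst nn_integral_lborel_pair[symmetric]) simp_all
    finally show "(\<integral>\<^sup>+a. \<integral>\<^sup>+t. \<integral>\<^sup>+b. \<integral>\<^sup>+r. f (a, t) * f (b, r) *
      f ((a, t) + l *\<^sub>R ((b, r) - (a, t))) \<partial>lborel \<partial>lborel \<partial>lborel \<partial>lborel)
      = (\<integral>\<^sup>+z. \<integral>\<^sup>+w. f z * f w * f (z + l *\<^sub>R (w - z)) \<partial>lborel \<partial>lborel)" .
  qed
  finally show ?thesis .
qed

text \<open>The bound \<open>1 \<le> C\<close> matters later: when the mass is infinite the right
  side has to be infinite, so the constant must not vanish. This explains the witness
  \<open>1 + C\<close>.\<close>

lemma radon_1d:
  obtains C :: ennreal where "1 \<le> C" "C < \<infinity>"
    "\<And>g :: real \<times> real \<Rightarrow> ennreal. g \<in> borel_measurable borel \<Longrightarrow>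
      (\<integral>\<^sup>+x. \<integral>\<^sup>+s. (\<integral>\<^sup>+y. g (y, s + x * y) powe (2/3) \<partial>lborel) ^ 3 \<partial>lborel \<partial>lborel)
      \<le> C * (\<integral>\<^sup>+z. g z \<partial>lborel)\<^sup>2"
proof -
  define C where "C = (\<integral>\<^sup>+l. ennreal (\<bar>l\<bar> powr (-2/3) * \<bar>1 - l\<bar> powr (-2/3)) \<partial>lborel)"
  have "(\<integral>\<^sup>+x. \<integral>\<^sup>+s. (\<integral>\<^sup>+y. g (y, s + x * y) powe (2/3) \<partial>lborel) ^ 3 \<partial>lborel \<partial>lborel)
      \<le> (1 + C) * (\<integral>\<^sup>+z. g z \<partial>lborel)\<^sup>2"
    if [measurable]: "g \<in> borel_measurable borel" for g :: "real \<times> real \<Rightarrow> ennreal"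
  proof -
    have "(\<integral>\<^sup>+x. \<integral>\<^sup>+s. (\<integral>\<^sup>+y. g (y, s + x * y) powe (2/3) \<partial>lborel) ^ 3 \<partial>lborel \<partial>lborel)
      = (\<integral>\<^sup>+l. \<integral>\<^sup>+z. \<integral>\<^sup>+w. g z powe (2/3) * g w powe (2/3) * g (z + l *\<^sub>R (w - z)) powe (2/3) \<partial>lborel \<partial>lborel \<partial>lborel)"
      using radon_1d_cube[of "\<lambda>z. g z powe (2/3)"] by simp
    also have "\<dots> \<le> (\<integral>\<^sup>+l. ennreal (\<bar>l\<bar> powr (-2/3) * \<bar>1 - l\<bar> powr (-2/3)) * (\<integral>\<^sup>+z. g z \<partial>lborel)\<^sup>2 \<partial>lborel)"
    proof (rule nn_integral_mono_AE)
      show "AE l in lborel. (\<integral>\<^sup>+z. \<integral>\<^sup>+w. g z powe (2/3) * g w powe (2/3) * g (z + l *\<^sub>R (w - z)) powe (2/3) \<partial>lborel \<partial>lborel)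
          \<le> ennreal (\<bar>l\<bar> powr (-2/3) * \<bar>1 - l\<bar> powr (-2/3)) * (\<integral>\<^sup>+z. g z \<partial>lborel)\<^sup>2"
        using AE_lborel_singleton[of 0] AE_lborel_singleton[of 1]
        by eventually_elim (intro trilinear_collinear_bound that)
    qed
    also have "\<dots> = C * (\<integral>\<^sup>+z. g z \<partial>lborel)\<^sup>2"
      by (simp add: C_def nn_integral_multc)
    also have "\<dots> \<le> (1 + C) * (\<integral>\<^sup>+z. g z \<partial>lborel)\<^sup>2"
      by (intro mult_right_mono) auto
    finally show ?thesis .
  qed
  moreover have "C < \<infinity>"
    unfolding C_def by (rule nn_integral_powr_kernel_finite)
  ultimately show ?thesis
    using that[of "1 + C"] by simp
qed

section \<open>The Radon-type inequality in all dimensions\<close>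

text \<open>Vectors are functions on an index set, so that splitting off a coordinate or a block
  becomes an operation on sets.\<close>

abbreviation lebP :: "'i set \<Rightarrow> ('i \<Rightarrow> real) measure" where
  "lebP B \<equiv> PiM B (\<lambda>_. lborel)"

interpretation lebP: product_sigma_finite "\<lambda>_. lborel :: real measure"
  by standard

lemma sigma_finite_lebP: "finite B \<Longrightarrow> sigma_finite_measure (lebP B)"
  by (rule lebP.sigma_finite)

text \<open>Its instances serve as local measurability rules for curried functions of three
  arguments.\<close>

lemma measurable_compose3:
  assumes "(\<lambda>(x, y, z). f x y z) \<in> measurable (M1 \<Otimes>\<^sub>M M2 \<Otimes>\<^sub>M M3) N"
    and "a \<in> measurable M M1" "b \<in> measurable M M2" "c \<in> measurable M M3"
  shows "(\<lambda>w. f (a w) (b w) (c w)) \<in> measurable M N"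
  using measurable_compose[OF _ assms(1), of "\<lambda>w. (a w, b w, c w)" M] assms(2-4) by simp

definition dotp :: "'i set \<Rightarrow> ('i \<Rightarrow> real) \<Rightarrow> ('i \<Rightarrow> real) \<Rightarrow> real" where
  "dotp B x y = (\<Sum>i\<in>B. x i * y i)"

lemma measurable_dotp:
  assumes [measurable]: "x \<in> measurable M (lebP A)" "y \<in> measurable M (lebP A')"
    and "B \<subseteq> A" "B \<subseteq> A'"
  shows "(\<lambda>w. dotp B (x w) (y w)) \<in> borel_measurable M"
proof -
  have [measurable]: "(\<lambda>w. x w i) \<in> borel_measurable M" "(\<lambda>w. y w i) \<in> borel_measurable M" if "i \<in> B" for i
    using that assms(3,4) measurable_compose[OF assms(1) measurable_component_singleton[of i A "\<lambda>_. lborel"]]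
      measurable_compose[OF assms(2) measurable_component_singleton[of i A' "\<lambda>_. lborel"]] by auto
  show ?thesis
    unfolding dotp_def by measurable
qed

lemma measurable_dotp' [measurable (raw)]:
  assumes "x \<in> measurable M (lebP B)" "y \<in> measurable M (lebP B)"
  shows "(\<lambda>w. dotp B (x w) (y w)) \<in> borel_measurable M"
  by (rule measurable_dotp[OF assms]) auto

text \<open>The Radon transform on non-vertical hyperplanes, parametrised by slope \<open>x\<close>
  and height \<open>s\<close>, with the measure dy in place of surface measure.\<close>

definition radon :: "'i set \<Rightarrow> (('i \<Rightarrow> real) \<Rightarrow> real \<Rightarrow> ennreal) \<Rightarrow> ('i \<Rightarrow> real) \<Rightarrow> real \<Rightarrow> ennreal" where
  "radon B f x s = (\<integral>\<^sup>+y. f y (s + dotp B x y) \<partial>lebP B)"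

text \<open>For a fixed slope the parallel hyperplanes foliate the space. This is the trivial
  endpoint: total mass is preserved for every \<open>x\<close>.\<close>

lemma nn_integral_radon:
  assumes "finite B" and [measurable]: "(\<lambda>(y, s). f y s) \<in> borel_measurable (lebP B \<Otimes>\<^sub>M lborel)"
    and x [measurable]: "x \<in> space (lebP B)"
  shows "(\<integral>\<^sup>+s. radon B f x s \<partial>lborel) = (\<integral>\<^sup>+y. \<integral>\<^sup>+s. f y s \<partial>lborel \<partial>lebP B)"
proof -
  interpret sigma_finite_measure "lebP B" by (rule sigma_finite_lebP[OF assms(1)])
  have "(\<integral>\<^sup>+s. radon B f x s \<partial>lborel) = (\<integral>\<^sup>+y. \<integral>\<^sup>+s. f y (s + dotp B x y) \<partial>lborel \<partial>lebP B)"
    unfolding radon_def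
    by (rule nn_integral_swap) (auto intro: sigma_finite_lebP assms lborel.sigma_finite_measure_axioms)
  also have "\<dots> = (\<integral>\<^sup>+y. \<integral>\<^sup>+s. f y s \<partial>lborel \<partial>lebP B)"
    by (intro nn_integral_cong nn_integral_shift) measurable
  finally show ?thesis .
qed

text \<open>The \<open>L^p\<close> to \<open>L^q\<close> estimate with p = (d+2)/(d+1) and q = d+2,
  written for the function \<open>g\<close> to the power 1/p and raised to the power q; the mass
  then appears with exponent q/p = d+1.\<close>

definition radon_bound :: "'i set \<Rightarrow> ennreal \<Rightarrow> bool" where
  "radon_bound B C \<longleftrightarrow> (\<forall>g. (\<lambda>(y, s). g y s) \<in> borel_measurable (lebP B \<Otimes>\<^sub>M lborel) \<longrightarrow>
     (\<integral>\<^sup>+x. \<integral>\<^sup>+s. radon B (\<lambda>y s. g y s powe ((real (card B) + 1) / (real (card B) + 2))) x s ^ (card B + 2) \<partial>lborel \<partial>lebP B)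
     \<le> C * (\<integral>\<^sup>+y. \<integral>\<^sup>+s. g y s \<partial>lborel \<partial>lebP B) ^ (card B + 1))"

lemma nn_integral_lebP_empty:
  "(\<integral>\<^sup>+x. f x \<partial>lebP {}) = f (\<lambda>_. undefined)"
  by (simp add: PiM_empty nn_integral_count_space_finite)

lemma emeasure_lebP_empty: "emeasure (lebP {}) (space (lebP ({} :: 'i set))) = 1"
  using nn_integral_lebP_empty[of "\<lambda>_ :: 'i \<Rightarrow> real. 1"] by simp

text \<open>For d = 0 the transform is the identity, and the exponents 1/2 and 2 cancel.\<close>

lemma radon_bound_empty: "radon_bound ({} :: 'i set) 1"
  by (simp add: radon_bound_def radon_def nn_integral_lebP_empty emeasure_lebP_empty dotp_def
    epow_add[symmetric])

text \<open>Interpolation between the diagonal estimate and the trivial bound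
  \<open>L\<^sup>1 \<rightarrow> L\<^sup>\<infinity>(L\<^sup>1)\<close>.\<close>

lemma radon_mixed_norm:
  fixes g :: "('i \<Rightarrow> real) \<Rightarrow> real \<Rightarrow> ennreal"
  assumes B: "finite B" and C: "radon_bound B C"
    and meas [measurable]: "(\<lambda>(y, s). g y s) \<in> borel_measurable (lebP B \<Otimes>\<^sub>M lborel)"
    and g: "(\<integral>\<^sup>+y. \<integral>\<^sup>+s. g y s \<partial>lborel \<partial>lebP B) \<le> 1"
    and q: "q = real (card B) + 3"
  shows "(\<integral>\<^sup>+x. (\<integral>\<^sup>+s. radon B (\<lambda>y s. g y s powe (1 - 1/q)) x s powe (q/2) \<partial>lborel)\<^sup>2 \<partial>lebP B) \<le> C"
proof -
  interpret sigma_finite_measure "lebP B" by (rule sigma_finite_lebP[OF B])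
  define d where "d = card B"
  define e where "e = (real d + 1) / (real d + 2)"
  define b where "b = radon B (\<lambda>y s. g y s powe e)"
  have q3: "q = real d + 3" "0 < q" using q by (auto simp: d_def)
  have [measurable]: "(\<lambda>(x, s). b x s) \<in> borel_measurable (lebP B \<Otimes>\<^sub>M lborel)"
    "(\<lambda>(x, s). radon B g x s) \<in> borel_measurable (lebP B \<Otimes>\<^sub>M lborel)"
    unfolding b_def radon_def by measurable
  have "(\<integral>\<^sup>+s. radon B (\<lambda>y s. g y s powe (1 - 1/q)) x s powe (q/2) \<partial>lborel)\<^sup>2
      \<le> (\<integral>\<^sup>+s. b x s ^ (d + 2) \<partial>lborel)" if [measurable]: "x \<in> space (lebP B)" for x
  proof -
    \<comment> \<open>Hoelder in \<open>y\<close> with weights 1/q and 1 - 1/q. It rests on 1/q + e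
      (1 - 1/q) = 1 - 1/q, and the power q/2 turns the weights into 1/2 and (d+2)/2.\<close>
    have "radon B (\<lambda>y s. g y s powe (1 - 1/q)) x s powe (q/2)
        \<le> radon B g x s powe (1/2) * (b x s ^ (d + 2)) powe (1/2)" for s
    proof -
      have e: "1/q + e * (1 - 1/q) = 1 - 1/q"
      proof -
        have "1 - 1/q = (real d + 2) / q" using q3 by (simp add: field_simps)
        then show ?thesis using q3 by (simp add: e_def add_divide_distrib[symmetric])
      qed
      have "radon B (\<lambda>y s. g y s powe (1 - 1/q)) x s
          = (\<integral>\<^sup>+y. g y (s + dotp B x y) powe (1/q) * (g y (s + dotp B x y) powe e) powe (1 - 1/q) \<partial>lebP B)"
      proof -
        have "0 \<le> e * (1 - 1/q)" using q3 by (simp add: e_def)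
        then have "a powe (1/q + e * (1 - 1/q)) = a powe (1/q) * a powe (e * (1 - 1/q))" for a
          using q3 by (intro epow_add) auto
        from this[unfolded e] have "a powe (1/q) * (a powe e) powe (1 - 1/q) = a powe (1 - 1/q)" for a
          unfolding epow_epow by (rule sym)
        then show ?thesis by (simp add: radon_def)
      qed
      also have "\<dots> \<le> radon B g x s powe (1/q) * b x s powe (1 - 1/q)"
        unfolding radon_def b_def using q3 by (intro nn_integral_Holder2) (auto simp: field_simps)
      finally have "radon B (\<lambda>y s. g y s powe (1 - 1/q)) x s powe (q/2)
          \<le> (radon B g x s powe (1/q) * b x s powe (1 - 1/q)) powe (q/2)"
        using q3 by (intro epow_mono) auto
      also have "\<dots> = radon B g x s powe (1/2) * b x s powe ((real (d + 2)) * (1/2))"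
      proof -
        have "(1 - 1/q) * (q/2) = real (d + 2) * (1/2)" "(1/q) * (q/2) = 1/2"
          using q3 by (simp_all add: field_simps)
        then show ?thesis using q3 by (simp add: epow_mult epow_epow)
      qed
      finally show ?thesis by (simp add: epow_epow flip: epow_of_nat)
    qed
    then have "(\<integral>\<^sup>+s. radon B (\<lambda>y s. g y s powe (1 - 1/q)) x s powe (q/2) \<partial>lborel)
        \<le> (\<integral>\<^sup>+s. radon B g x s powe (1/2) * (b x s ^ (d + 2)) powe (1/2) \<partial>lborel)"
      by (intro nn_integral_mono)
    \<comment> \<open>Cauchy-Schwarz in \<open>s\<close>; the first factor is the total mass, at
      most 1 for every slope.\<close>
    also have "\<dots> \<le> (\<integral>\<^sup>+s. radon B g x s \<partial>lborel) powe (1/2) * (\<integral>\<^sup>+s. b x s ^ (d + 2) \<partial>lborel) powe (1/2)"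
      by (intro nn_integral_Holder2) auto
    also have "\<dots> \<le> 1 powe (1/2) * (\<integral>\<^sup>+s. b x s ^ (d + 2) \<partial>lborel) powe (1/2)"
      using g nn_integral_radon[OF B meas that] by (intro mult_right_mono epow_mono) auto
    finally have "(\<integral>\<^sup>+s. radon B (\<lambda>y s. g y s powe (1 - 1/q)) x s powe (q/2) \<partial>lborel)\<^sup>2
       \<le> ((\<integral>\<^sup>+s. b x s ^ (d + 2) \<partial>lborel) powe (1/2))\<^sup>2"
      by (intro power_mono) auto
    then show ?thesis by (simp add: epow_power)
  qed
  then have "(\<integral>\<^sup>+x. (\<integral>\<^sup>+s. radon B (\<lambda>y s. g y s powe (1 - 1/q)) x s powe (q/2) \<partial>lborel)\<^sup>2 \<partial>lebP B)
      \<le> (\<integral>\<^sup>+x. (\<integral>\<^sup>+s. b x s ^ (d + 2) \<partial>lborel) \<partial>lebP B)"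
    by (intro nn_integral_mono)
  also have "\<dots> \<le> C * (\<integral>\<^sup>+y. \<integral>\<^sup>+s. g y s \<partial>lborel \<partial>lebP B) ^ (d + 1)"
    using C meas by (auto simp: radon_bound_def b_def e_def d_def add.commute)
  also have "\<dots> \<le> C * 1 ^ (d + 1)"
    by (intro mult_left_mono power_mono g) auto
  finally show ?thesis by simp
qed

text \<open>One more coordinate is added. The weight \<open>W\<close> carries the marginal in the new coordinate, so
  that only positive powers occur in the interpolation.\<close>

lemma radon_step_weighted:
  fixes W :: "real \<Rightarrow> ennreal" and \<gamma> :: "real \<Rightarrow> ('i \<Rightarrow> real) \<Rightarrow> real \<Rightarrow> ennreal"
  assumes B: "finite B" and C: "radon_bound B C"
    and C1: "\<And>g :: real \<times> real \<Rightarrow> ennreal. g \<in> borel_measurable borel \<Longrightarrow>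
      (\<integral>\<^sup>+x. \<integral>\<^sup>+s. (\<integral>\<^sup>+y. g (y, s + x * y) powe (2/3) \<partial>lborel) ^ 3 \<partial>lborel \<partial>lborel)
      \<le> C1 * (\<integral>\<^sup>+z. g z \<partial>lborel)\<^sup>2"
    and [measurable]: "W \<in> borel_measurable borel"
    and meas [measurable]: "(\<lambda>(u, y, s). \<gamma> u y s) \<in> borel_measurable (lborel \<Otimes>\<^sub>M lebP B \<Otimes>\<^sub>M lborel)"
    and \<gamma>: "\<And>u. (\<integral>\<^sup>+y. \<integral>\<^sup>+s. \<gamma> u y s \<partial>lborel \<partial>lebP B) \<le> 1"
    and q: "q = real (card B) + 3"
  shows "(\<integral>\<^sup>+x. \<integral>\<^sup>+v. \<integral>\<^sup>+s. (\<integral>\<^sup>+u. W u powe (1 - 1/q) *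
        radon B (\<lambda>y s. \<gamma> u y s powe (1 - 1/q)) x (s + v * u) \<partial>lborel) ^ (card B + 3) \<partial>lborel \<partial>lborel \<partial>lebP B)
    \<le> C1 * C * (\<integral>\<^sup>+u. W u \<partial>lborel) ^ (card B + 2)"
proof -
  interpret sigma_finite_measure "lebP B" by (rule sigma_finite_lebP[OF B])
  define d where "d = card B"
  have q3: "q = real d + 3" "0 < q" using q by (auto simp: d_def)
  define N where "N = (\<integral>\<^sup>+u. W u \<partial>lborel)"
  note measurable_compose3[OF meas, measurable (raw)]
  define h where "h x u s = radon B (\<lambda>y s. \<gamma> u y s powe (1 - 1/q)) x s" for x u s
  have h_meas [measurable]: "(\<lambda>(x, u, s). h x u s) \<in> borel_measurable (lebP B \<Otimes>\<^sub>M lborel \<Otimes>\<^sub>M lborel)"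
    unfolding h_def radon_def by measurable
  note measurable_compose3[OF h_meas, measurable (raw)]
  define A where "A x u = (\<integral>\<^sup>+s. h x u s powe (q/2) \<partial>lborel)" for x u
  have [measurable]: "(\<lambda>(x, u). A x u) \<in> borel_measurable (lebP B \<Otimes>\<^sub>M lborel)"
    unfolding A_def by measurable
  have A: "(\<integral>\<^sup>+x. (A x u)\<^sup>2 \<partial>lebP B) \<le> C" for u
    unfolding A_def h_def using \<gamma> q
    by (intro radon_mixed_norm[OF B C]) measurable
  have inner: "(\<integral>\<^sup>+v. \<integral>\<^sup>+s. (\<integral>\<^sup>+u. W u powe (1 - 1/q) * h x u (s + v * u) \<partial>lborel) ^ (d + 3) \<partial>lborel \<partial>lborel)
      \<le> C1 * N ^ (d + 1) * (\<integral>\<^sup>+u. W u * (A x u)\<^sup>2 \<partial>lborel)"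
    if [measurable]: "x \<in> space (lebP B)" for x
  proof -
    \<comment> \<open>The planar estimate is applied in the variables \<open>(u, s)\<close> with
      \<open>x\<close> frozen. The power q/2 is chosen so that integrating \<open>k\<close> in
      \<open>s\<close> yields \<open>W u * A x u\<close>, with \<open>A\<close> the inner integral
      of the mixed norm.\<close>
    define k where "k z = W (fst z) * h x (fst z) (snd z) powe (q/2)" for z
    have [measurable]: "k \<in> borel_measurable borel"
    proof -
      have "k \<in> borel_measurable (lborel \<Otimes>\<^sub>M lborel)" unfolding k_def by measurable
      then show ?thesis by (simp add: lborel_prod)
    qed
    have "(\<integral>\<^sup>+u. W u powe (1 - 1/q) * h x u (s + v * u) \<partial>lborel) ^ (d + 3)
        \<le> N ^ d * (\<integral>\<^sup>+u. k (u, s + v * u) powe (2/3) \<partial>lborel) ^ 3" for v s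
    proof -
      \<comment> \<open>The weight is split as 1 - 1/q = (1 - 3/q) + 2/q, where the second part
        joins \<open>h\<close> to form \<open>k\<close> to the power 2/q. Hoelder with weights 1 -
        3/q and 3/q follows; as q is at least 3, both are nonnegative.\<close>
      have *: "W u powe (1 - 1/q) * h x u (s + v * u) = W u powe (1 - 3/q) * (k (u, s + v * u) powe (2/3)) powe (3/q)" for u
      proof -
        have "(q/2) * (2/q) = 1" "1 - 1/q = (1 - 3/q) + 2/q" and k: "(2/3) * (3/q) = 2/q"
          using q3(2) by (simp_all add: field_simps)
        moreover have "0 \<le> 1 - 3/q" "0 \<le> 2/q" using q3 by simp_all
        ultimately have "W u powe (1 - 1/q) = W u powe (1 - 3/q) * W u powe (2/q)"
          "k (u, s + v * u) powe (2/q) = W u powe (2/q) * h x u (s + v * u)"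
          by (simp_all only: epow_add k_def fst_conv snd_conv epow_mult epow_epow epow_1)
        then show ?thesis by (simp only: epow_epow k mult.assoc)
      qed
      have "(\<integral>\<^sup>+u. W u powe (1 - 1/q) * h x u (s + v * u) \<partial>lborel)
          \<le> N powe (1 - 3/q) * (\<integral>\<^sup>+u. k (u, s + v * u) powe (2/3) \<partial>lborel) powe (3/q)"
        unfolding * N_def using q3 by (intro nn_integral_Holder2) auto
      then have "(\<integral>\<^sup>+u. W u powe (1 - 1/q) * h x u (s + v * u) \<partial>lborel) ^ (d + 3)
          \<le> (N powe (1 - 3/q) * (\<integral>\<^sup>+u. k (u, s + v * u) powe (2/3) \<partial>lborel) powe (3/q)) ^ (d + 3)"
        by (intro power_mono) auto
      also have "\<dots> = N powe real d * (\<integral>\<^sup>+u. k (u, s + v * u) powe (2/3) \<partial>lborel) powe real 3"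
      proof -
        have "(1 - 3/q) * real (d + 3) = real d" "3/q * real (d + 3) = real 3"
          using q3 by (simp_all add: field_simps)
        then show ?thesis by (simp only: power_mult_distrib epow_power)
      qed
      finally show ?thesis by (simp only: epow_of_nat)
    qed
    then have "(\<integral>\<^sup>+v. \<integral>\<^sup>+s. (\<integral>\<^sup>+u. W u powe (1 - 1/q) * h x u (s + v * u) \<partial>lborel) ^ (d + 3) \<partial>lborel \<partial>lborel)
        \<le> (\<integral>\<^sup>+v. \<integral>\<^sup>+s. N ^ d * (\<integral>\<^sup>+u. k (u, s + v * u) powe (2/3) \<partial>lborel) ^ 3 \<partial>lborel \<partial>lborel)"
      by (intro nn_integral_mono)
    also have "\<dots> = N ^ d * (\<integral>\<^sup>+v. \<integral>\<^sup>+s. (\<integral>\<^sup>+u. k (u, s + v * u) powe (2/3) \<partial>lborel) ^ 3 \<partial>lborel \<partial>lborel)"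
      by (simp add: nn_integral_cmult)
    also have "\<dots> \<le> N ^ d * (C1 * (\<integral>\<^sup>+z. k z \<partial>lborel)\<^sup>2)"
      by (intro mult_left_mono C1) auto
    also have "(\<integral>\<^sup>+z. k z \<partial>lborel) = (\<integral>\<^sup>+u. W u * A x u \<partial>lborel)"
      unfolding k_def A_def
      by (subst nn_integral_lborel_pair) (simp_all add: nn_integral_cmult)
    also have "N ^ d * (C1 * (\<integral>\<^sup>+u. W u * A x u \<partial>lborel)\<^sup>2) \<le> N ^ d * (C1 * (N * (\<integral>\<^sup>+u. W u * (A x u)\<^sup>2 \<partial>lborel)))"
    proof (intro mult_left_mono)
      \<comment> \<open>Cauchy-Schwarz with respect to the measure with density \<open>W\<close>.
        The result is linear in \<open>(A x u)\<^sup>2\<close>, so the integral over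
        \<open>x\<close> can be bounded for each \<open>u\<close> separately.\<close>
      have eq: "W u * A x u = W u powe (1/2) * (W u * (A x u)\<^sup>2) powe (1/2)" for u
        using epow_add[of "1/2" "1/2" "W u"] epow_add[of "1/2" "1/2" "A x u"]
        by (simp add: epow_mult power2_eq_square mult_ac)
      have "(\<integral>\<^sup>+u. W u * A x u \<partial>lborel) \<le> N powe (1/2) * (\<integral>\<^sup>+u. W u * (A x u)\<^sup>2 \<partial>lborel) powe (1/2)"
        unfolding eq N_def by (intro nn_integral_Holder2) auto
      then have "(\<integral>\<^sup>+u. W u * A x u \<partial>lborel)\<^sup>2
          \<le> (N powe (1/2) * (\<integral>\<^sup>+u. W u * (A x u)\<^sup>2 \<partial>lborel) powe (1/2))\<^sup>2"
        by (intro power_mono) auto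
      then show "(\<integral>\<^sup>+u. W u * A x u \<partial>lborel)\<^sup>2 \<le> N * (\<integral>\<^sup>+u. W u * (A x u)\<^sup>2 \<partial>lborel)"
        by (simp add: power_mult_distrib epow_power)
    qed auto
    finally show ?thesis
      by (simp add: mult_ac)
  qed
  have "(\<integral>\<^sup>+x. \<integral>\<^sup>+v. \<integral>\<^sup>+s. (\<integral>\<^sup>+u. W u powe (1 - 1/q) * h x u (s + v * u) \<partial>lborel) ^ (d + 3) \<partial>lborel \<partial>lborel \<partial>lebP B)
      \<le> (\<integral>\<^sup>+x. C1 * N ^ (d + 1) * (\<integral>\<^sup>+u. W u * (A x u)\<^sup>2 \<partial>lborel) \<partial>lebP B)"
    by (intro nn_integral_mono inner)
  also have "\<dots> = C1 * N ^ (d + 1) * (\<integral>\<^sup>+x. \<integral>\<^sup>+u. W u * (A x u)\<^sup>2 \<partial>lborel \<partial>lebP B)"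
    by (simp add: nn_integral_cmult)
  also have "\<dots> \<le> C1 * N ^ (d + 1) * (N * C)"
  proof (rule mult_left_mono)
    have "(\<integral>\<^sup>+x. \<integral>\<^sup>+u. W u * (A x u)\<^sup>2 \<partial>lborel \<partial>lebP B) = (\<integral>\<^sup>+u. \<integral>\<^sup>+x. W u * (A x u)\<^sup>2 \<partial>lebP B \<partial>lborel)"
      by (rule nn_integral_swap) (auto intro: sigma_finite_lebP B lborel.sigma_finite_measure_axioms)
    also have "\<dots> = (\<integral>\<^sup>+u. W u * (\<integral>\<^sup>+x. (A x u)\<^sup>2 \<partial>lebP B) \<partial>lborel)"
      by (simp add: nn_integral_cmult)
    also have "\<dots> \<le> (\<integral>\<^sup>+u. W u * C \<partial>lborel)"
      by (intro nn_integral_mono mult_left_mono A) auto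
    also have "\<dots> = N * C"
      by (simp add: nn_integral_multc N_def)
    finally show "(\<integral>\<^sup>+x. \<integral>\<^sup>+u. W u * (A x u)\<^sup>2 \<partial>lborel \<partial>lebP B) \<le> N * C" .
  qed auto
  finally show ?thesis
    by (simp add: h_def N_def d_def mult_ac)
qed

text \<open>The function is disintegrated as \<open>g = W * \<gamma>\<close>, with \<open>W\<close>
  its marginal in the new coordinate and \<open>\<gamma>\<close> of mass at most 1 on each slice;
  then the weighted estimate applies. The work lies in the slices where \<open>W\<close> is 0 or
  infinite.\<close>

lemma radon_bound_insert:
  fixes B :: "'i set"
  assumes B: "finite B" "i \<notin> B" and C: "radon_bound B C"
    and C1: "\<And>g :: real \<times> real \<Rightarrow> ennreal. g \<in> borel_measurable borel \<Longrightarrow>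
      (\<integral>\<^sup>+x. \<integral>\<^sup>+s. (\<integral>\<^sup>+y. g (y, s + x * y) powe (2/3) \<partial>lborel) ^ 3 \<partial>lborel \<partial>lborel)
      \<le> C1 * (\<integral>\<^sup>+z. g z \<partial>lborel)\<^sup>2"
    and "1 \<le> C" "1 \<le> C1"
  shows "radon_bound (insert i B) (C1 * C)"
  unfolding radon_bound_def
proof (intro allI impI)
  fix g :: "('i \<Rightarrow> real) \<Rightarrow> real \<Rightarrow> ennreal"
  assume g [measurable]: "(\<lambda>(y, s). g y s) \<in> borel_measurable (lebP (insert i B) \<Otimes>\<^sub>M lborel)"
  interpret sigma_finite_measure "lebP B" by (rule sigma_finite_lebP[OF B(1)])
  interpret ins: sigma_finite_measure "lebP (insert i B)" by (rule sigma_finite_lebP) (use B in auto)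
  define d where "d = card B"
  define q where "q = real d + 3"
  define e where "e = 1 - 1/q"
  have card: "card (insert i B) = d + 1" using B by (simp add: d_def)
  have e_eq: "(real (d + 1) + 1) / (real (d + 1) + 2) = e" and e_pos: "0 < e"
    by (simp_all add: e_def q_def field_simps)
  define W where "W u = (\<integral>\<^sup>+y. \<integral>\<^sup>+s. g (y(i := u)) s \<partial>lborel \<partial>lebP B)" for u
  have upd [measurable]: "(\<lambda>w. (y w)(i := u w)) \<in> measurable M (lebP (insert i B))"
    if "y \<in> measurable M (lebP B)" "u \<in> borel_measurable M" for y u and M :: "'z measure"
    by (rule measurable_fun_upd[where J=B]) (use that in auto)
  have W_meas [measurable]: "W \<in> borel_measurable borel"
    unfolding W_def by measurable
  have g_sect: "(\<lambda>s. g (y(i := u)) s) \<in> borel_measurable lborel" if [measurable]: "y \<in> space (lebP B)" for y u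
    by measurable
  have g_sect_int: "(\<lambda>y. \<integral>\<^sup>+s. g (y(i := u)) s \<partial>lborel) \<in> borel_measurable (lebP B)" for u
    by measurable
  have N: "(\<integral>\<^sup>+y. \<integral>\<^sup>+s. g y s \<partial>lborel \<partial>lebP (insert i B)) = (\<integral>\<^sup>+u. W u \<partial>lborel)"
    unfolding W_def by (subst lebP.product_nn_integral_insert_rev[OF B]) auto
  define I where "I = (\<integral>\<^sup>+x. \<integral>\<^sup>+s. radon (insert i B) (\<lambda>y s. g y s powe e) x s ^ (d + 3) \<partial>lborel \<partial>lebP (insert i B))"
  have "I \<le> C1 * C * (\<integral>\<^sup>+u. W u \<partial>lborel) ^ (d + 2)"
  proof (cases "(\<integral>\<^sup>+u. W u \<partial>lborel) = \<infinity>")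
    case True
    \<comment> \<open>Here the lower bounds on \<open>C1\<close> and \<open>C\<close> are used: a
      zero constant times infinity would be 0.\<close>
    have "C1 * C * (\<integral>\<^sup>+u. W u \<partial>lborel) ^ (d + 2) = \<infinity>"
      using True assms(5,6) by (auto simp: ennreal_mult_eq_top_iff top_power_ennreal)
    then show ?thesis by simp
  next
    case False
    define \<gamma> where "\<gamma> u y s = (if W u = 0 \<or> W u = \<infinity> then 0 else g (y(i := u)) s / W u)" for u y s
    have \<gamma>_meas [measurable]: "(\<lambda>(u, y, s). \<gamma> u y s) \<in> borel_measurable (lborel \<Otimes>\<^sub>M lebP B \<Otimes>\<^sub>M lborel)"
      unfolding \<gamma>_def by measurable
    note measurable_compose3[OF \<gamma>_meas, measurable (raw)]
    have \<gamma>_int: "(\<integral>\<^sup>+y. \<integral>\<^sup>+s. \<gamma> u y s \<partial>lborel \<partial>lebP B) \<le> 1" for u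
    proof (cases "W u = 0 \<or> W u = \<infinity>")
      case False
      have "(\<integral>\<^sup>+y. \<integral>\<^sup>+s. \<gamma> u y s \<partial>lborel \<partial>lebP B)
          = (\<integral>\<^sup>+y. (\<integral>\<^sup>+s. g (y(i := u)) s \<partial>lborel) / W u \<partial>lebP B)"
        using False by (intro nn_integral_cong) (simp add: \<gamma>_def nn_integral_divide g_sect)
      also have "\<dots> = W u / W u"
        using g_sect_int by (subst nn_integral_divide) (simp_all add: W_def)
      finally have "(\<integral>\<^sup>+y. \<integral>\<^sup>+s. \<gamma> u y s \<partial>lborel \<partial>lebP B) = W u / W u" .
      then show ?thesis using False by (simp add: ennreal_divide_self less_top)
    qed (auto simp: \<gamma>_def)
    \<comment> \<open>An infinite penalty wherever the factorisation fails. Its integral is 0: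
      \<open>W\<close> is infinite only on a null set, and where \<open>W u = 0\<close> the slice of
      \<open>g\<close> vanishes almost everywhere.\<close>
    define z where "z u y s = (if g (y(i := u)) s powe e = W u powe e * \<gamma> u y s powe e then 0 else \<infinity> :: ennreal)" for u y s
    have z_meas [measurable]: "(\<lambda>(u, y, s). z u y s) \<in> borel_measurable (lborel \<Otimes>\<^sub>M lebP B \<Otimes>\<^sub>M lborel)"
      unfolding z_def by measurable
    note measurable_compose3[OF z_meas, measurable (raw)]
    have z_int: "(\<integral>\<^sup>+u. \<integral>\<^sup>+y. \<integral>\<^sup>+s. z u y s \<partial>lborel \<partial>lebP B \<partial>lborel) = 0"
    proof -
      have "AE u in lborel. W u \<noteq> \<infinity>"
        using False by (intro nn_integral_PInf_AE) auto
      then have "AE u in lborel. (\<integral>\<^sup>+y. \<integral>\<^sup>+s. z u y s \<partial>lborel \<partial>lebP B) = 0"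
      proof eventually_elim
        case (elim u)
        show ?case
        proof (cases "W u = 0")
          case True
          have "(\<integral>\<^sup>+y. \<integral>\<^sup>+s. z u y s \<partial>lborel \<partial>lebP B) \<le> (\<integral>\<^sup>+y. \<integral>\<^sup>+s. \<infinity> * g (y(i := u)) s \<partial>lborel \<partial>lebP B)"
            using True e_pos
            by (intro nn_integral_mono) (auto simp: z_def \<gamma>_def zero_epow ennreal_top_mult)
          also have "\<dots> = (\<integral>\<^sup>+y. \<infinity> * (\<integral>\<^sup>+s. g (y(i := u)) s \<partial>lborel) \<partial>lebP B)"
            by (intro nn_integral_cong nn_integral_cmult g_sect)
          also have "\<dots> = \<infinity> * W u"
            unfolding W_def by (intro nn_integral_cmult g_sect_int)
          finally show ?thesis using True by simp
        next
          case False
          have "g (y(i := u)) s = W u * \<gamma> u y s" for y s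
            using False elim by (auto simp: \<gamma>_def ennreal_times_divide ennreal_mult_divide_eq mult.commute[of "W u"])
          then have "z u y s = 0" for y s
            using e_pos by (simp add: z_def epow_mult)
          then show ?thesis by simp
        qed
      qed
      then show ?thesis
        by (subst nn_integral_0_iff_AE) auto
    qed
    define h where "h u x s = radon B (\<lambda>y s. \<gamma> u y s powe e) x s" for u x s
    have "I = (\<integral>\<^sup>+x. \<integral>\<^sup>+v. \<integral>\<^sup>+s. radon (insert i B) (\<lambda>y s. g y s powe e) (x(i := v)) s ^ (d + 3) \<partial>lborel \<partial>lborel \<partial>lebP B)"
      unfolding I_def radon_def by (subst lebP.product_nn_integral_insert[OF B]) auto
    also have "\<dots> \<le> (\<integral>\<^sup>+x. \<integral>\<^sup>+v. \<integral>\<^sup>+s. (\<integral>\<^sup>+u. W u powe e * h u x (s + v * u) \<partial>lborel) ^ (d + 3) \<partial>lborel \<partial>lborel \<partial>lebP B)"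
    proof (rule nn_integral_mono, rule nn_integral_mono, rule nn_integral_mono_AE)
      fix x v assume x [measurable]: "x \<in> space (lebP B)"
      have [measurable]: "(\<lambda>_. x(i := v)) \<in> measurable M (lebP (insert i B))" for M :: "'z measure"
        by measurable
      have dotp_upd: "dotp (insert i B) (x(i := v)) (y(i := u)) = v * u + dotp B x y" for y u
        using B by (auto simp: dotp_def intro!: sum.cong)
      have rad: "radon (insert i B) (\<lambda>y s. g y s powe e) (x(i := v)) s
          = (\<integral>\<^sup>+u. \<integral>\<^sup>+y. g (y(i := u)) ((s + v * u) + dotp B x y) powe e \<partial>lebP B \<partial>lborel)" for s
        unfolding radon_def
        by (subst lebP.product_nn_integral_insert_rev[OF B]) (auto simp: dotp_upd add.assoc)
      \<comment> \<open>The average over hyperplanes sees values on null sets. By foliation a null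
        penalty is null on almost every hyperplane of the given slope, which suffices after
        integration in \<open>s\<close>.\<close>
      have "(\<integral>\<^sup>+s. \<integral>\<^sup>+u. \<integral>\<^sup>+y. z u y ((s + v * u) + dotp B x y) \<partial>lebP B \<partial>lborel \<partial>lborel)
          = (\<integral>\<^sup>+u. \<integral>\<^sup>+s. \<integral>\<^sup>+y. z u y ((s + v * u) + dotp B x y) \<partial>lebP B \<partial>lborel \<partial>lborel)"
        by (rule nn_integral_swap_lborel) measurable
      also have "\<dots> = (\<integral>\<^sup>+u. \<integral>\<^sup>+y. \<integral>\<^sup>+s. z u y ((s + v * u) + dotp B x y) \<partial>lborel \<partial>lebP B \<partial>lborel)"
        by (intro nn_integral_cong nn_integral_swap)
           (auto intro: sigma_finite_lebP B lborel.sigma_finite_measure_axioms)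
      also have "\<dots> = (\<integral>\<^sup>+u. \<integral>\<^sup>+y. \<integral>\<^sup>+s. z u y s \<partial>lborel \<partial>lebP B \<partial>lborel)"
        unfolding add.assoc by (intro nn_integral_cong nn_integral_shift) measurable
      finally have "AE s in lborel. (\<integral>\<^sup>+u. \<integral>\<^sup>+y. z u y ((s + v * u) + dotp B x y) \<partial>lebP B \<partial>lborel) = 0"
        unfolding z_int by (subst (asm) nn_integral_0_iff_AE) auto
      then show "AE s in lborel. radon (insert i B) (\<lambda>y s. g y s powe e) (x(i := v)) s ^ (d + 3)
          \<le> (\<integral>\<^sup>+u. W u powe e * h u x (s + v * u) \<partial>lborel) ^ (d + 3)"
      proof eventually_elim
        case (elim s)
        \<comment> \<open>With the penalty added the comparison holds at every point, and on this
          hyperplane the penalty integrates to 0.\<close>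
        have "radon (insert i B) (\<lambda>y s. g y s powe e) (x(i := v)) s
            \<le> (\<integral>\<^sup>+u. \<integral>\<^sup>+y. W u powe e * \<gamma> u y ((s + v * u) + dotp B x y) powe e
                + z u y ((s + v * u) + dotp B x y) \<partial>lebP B \<partial>lborel)"
          unfolding rad by (intro nn_integral_mono) (auto simp: z_def)
        also have "\<dots> = (\<integral>\<^sup>+u. W u powe e * h u x (s + v * u) \<partial>lborel)"
          using elim by (simp add: nn_integral_add nn_integral_cmult h_def radon_def)
        finally show ?case by (intro power_mono) auto
      qed
    qed
    also have "\<dots> \<le> C1 * C * (\<integral>\<^sup>+u. W u \<partial>lborel) ^ (d + 2)"
      unfolding h_def e_def d_def
      by (rule radon_step_weighted[OF B(1) C C1 W_meas \<gamma>_meas \<gamma>_int]) (simp_all add: q_def d_def)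
    finally show ?thesis .
  qed
  moreover have "d + 1 + 2 = d + 3" "d + 1 + 1 = d + 2" by auto
  ultimately show "(\<integral>\<^sup>+x. \<integral>\<^sup>+s. radon (insert i B) (\<lambda>y s. g y s powe ((real (card (insert i B)) + 1) / (real (card (insert i B)) + 2))) x s
      ^ (card (insert i B) + 2) \<partial>lborel \<partial>lebP (insert i B))
     \<le> C1 * C * (\<integral>\<^sup>+y. \<integral>\<^sup>+s. g y s \<partial>lborel \<partial>lebP (insert i B)) ^ (card (insert i B) + 1)"
    unfolding card e_eq N I_def by (simp only:)
qed

lemma radon_bound_exists:
  assumes "finite B"
  shows "\<exists>C. 1 \<le> C \<and> C < \<infinity> \<and> radon_bound B C"
  using assms
proof (induction B)
  case empty
  then show ?case using radon_bound_empty by (intro exI[of _ 1]) auto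
next
  case (insert i B)
  obtain C1 :: ennreal where C1: "1 \<le> C1" "C1 < \<infinity>"
    "\<And>g :: real \<times> real \<Rightarrow> ennreal. g \<in> borel_measurable borel \<Longrightarrow>
      (\<integral>\<^sup>+x. \<integral>\<^sup>+s. (\<integral>\<^sup>+y. g (y, s + x * y) powe (2/3) \<partial>lborel) ^ 3 \<partial>lborel \<partial>lborel)
      \<le> C1 * (\<integral>\<^sup>+z. g z \<partial>lborel)\<^sup>2"
    using radon_1d by blast
  obtain C where C: "1 \<le> C" "C < \<infinity>" "radon_bound B C"
    using insert.IH by blast
  have "radon_bound (insert i B) (C1 * C)"
    using C1 C insert.hyps by (intro radon_bound_insert) auto
  moreover have "1 \<le> C1 * C" "C1 * C < \<infinity>"
    using C1 C mult_mono[of 1 C1 1 C] by (auto simp: ennreal_mult_less_top)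
  ultimately show ?case by blast
qed

section \<open>Coordinate-wise Hoelder inequalities\<close>

lemma nn_integral_triple:
  assumes "sigma_finite_measure M2" "sigma_finite_measure M3"
    and [measurable]: "(\<lambda>(x, y, t). f x y t) \<in> borel_measurable (M1 \<Otimes>\<^sub>M M2 \<Otimes>\<^sub>M M3)"
  shows "(\<integral>\<^sup>+x. \<integral>\<^sup>+y. \<integral>\<^sup>+t. f x y t \<partial>M3 \<partial>M2 \<partial>M1) = (\<integral>\<^sup>+(x, y, t). f x y t \<partial>(M1 \<Otimes>\<^sub>M M2 \<Otimes>\<^sub>M M3))"
proof -
  interpret M2: sigma_finite_measure M2 by fact
  interpret M3: sigma_finite_measure M3 by fact
  interpret M23: sigma_finite_measure "M2 \<Otimes>\<^sub>M M3"
    by (rule sigma_finite_pair_measure) fact+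
  have "(\<integral>\<^sup>+(x, y, t). f x y t \<partial>(M1 \<Otimes>\<^sub>M M2 \<Otimes>\<^sub>M M3)) = (\<integral>\<^sup>+x. \<integral>\<^sup>+(y, t). f x y t \<partial>(M2 \<Otimes>\<^sub>M M3) \<partial>M1)"
    by (subst M23.nn_integral_fst[symmetric]) auto
  also have "\<dots> = (\<integral>\<^sup>+x. \<integral>\<^sup>+y. \<integral>\<^sup>+t. f x y t \<partial>M3 \<partial>M2 \<partial>M1)"
  proof (rule nn_integral_cong)
    fix x assume "x \<in> space M1"
    then have "(\<lambda>(y, t). f x y t) \<in> borel_measurable (M2 \<Otimes>\<^sub>M M3)"
      using measurable_compose[OF measurable_Pair1'[of x M1 "M2 \<Otimes>\<^sub>M M3"] assms(3)] by (simp add: case_prod_unfold)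
    from M3.nn_integral_fst[OF this]
    show "(\<integral>\<^sup>+(y, t). f x y t \<partial>(M2 \<Otimes>\<^sub>M M3)) = (\<integral>\<^sup>+y. \<integral>\<^sup>+t. f x y t \<partial>M3 \<partial>M2)"
      by simp
  qed
  finally show ?thesis ..
qed

text \<open>Finner's form of the Loomis-Whitney inequality. In the induction a coordinate
  \<open>i\<close> is integrated out by Hoelder among the factors that depend on it, whose weights
  sum to one; the others are constants. The integrated factors live on \<open>S k - {i}\<close>, so
  \<open>S\<close> and \<open>f\<close> must be arbitrary in the induction.\<close>

lemma finner_inequality:
  fixes f :: "'k \<Rightarrow> ('i \<Rightarrow> real) \<Rightarrow> ennreal"
  assumes "finite I" "finite K" "\<And>k. k \<in> K \<Longrightarrow> S k \<subseteq> I" "\<And>k. k \<in> K \<Longrightarrow> 0 \<le> c k"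
    and "\<And>i. i \<in> I \<Longrightarrow> (\<Sum>k\<in>{k\<in>K. i \<in> S k}. c k) = 1"
    and "\<And>k. k \<in> K \<Longrightarrow> f k \<in> borel_measurable (lebP (S k))"
  shows "(\<integral>\<^sup>+x. (\<Prod>k\<in>K. f k (restrict x (S k)) powe c k) \<partial>lebP I) \<le> (\<Prod>k\<in>K. (\<integral>\<^sup>+x. f k x \<partial>lebP (S k)) powe c k)"
  using assms
proof (induction I arbitrary: S f rule: finite_induct)
  case empty
  then have "S k = {}" if "k \<in> K" for k using that by auto
  then show ?case by (simp add: nn_integral_lebP_empty restrict_def emeasure_lebP_empty cong: prod.cong)
next
  case (insert i I)
  define S' where "S' k = S k - {i}" for k
  define f' where "f' k = (if i \<in> S k then (\<lambda>x. \<integral>\<^sup>+v. f k (x(i := v)) \<partial>lborel) else f k)" for k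
  define K1 where "K1 = {k\<in>K. i \<in> S k}"
  have S: "S k \<subseteq> insert i I" "finite (S k)" if "k \<in> K" for k
    using insert.prems(2)[OF that] insert.hyps finite_subset[of "S k" "insert i I"] by auto
  note f_meas = insert.prems(5)
  have upd: "(\<lambda>w. (x w)(i := v w)) \<in> measurable M (lebP (S k))"
    if "x \<in> measurable M (lebP (S' k))" "v \<in> borel_measurable M" "i \<in> S k" for x v k and M :: "'z measure"
    by (rule measurable_fun_upd[where J="S' k"]) (use that in \<open>auto simp: S'_def\<close>)
  have f'_meas: "f' k \<in> borel_measurable (lebP (S' k))" if "k \<in> K" for k
  proof (cases "i \<in> S k")
    case True
    have [measurable]: "f k \<in> borel_measurable (lebP (S k))" by (rule f_meas[OF that])
    note upd[OF _ _ True, measurable (raw)]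
    show ?thesis using True unfolding f'_def by simp
  next
    case False
    then show ?thesis using f_meas[OF that] by (simp add: f'_def S'_def)
  qed
  have f'_int: "(\<integral>\<^sup>+x. f' k x \<partial>lebP (S' k)) = (\<integral>\<^sup>+x. f k x \<partial>lebP (S k))" if "k \<in> K" for k
  proof (cases "i \<in> S k")
    case True
    then have eq: "insert i (S' k) = S k" by (auto simp: S'_def)
    show ?thesis
      using True S(2)[OF that] f_meas[OF that]
        lebP.product_nn_integral_insert[of "S' k" i "f k", unfolded eq]
      by (auto simp: f'_def S'_def)
  qed (simp add: f'_def S'_def)
  have "(\<integral>\<^sup>+x. (\<Prod>k\<in>K. f k (restrict x (S k)) powe c k) \<partial>lebP (insert i I))
      = (\<integral>\<^sup>+x. \<integral>\<^sup>+v. (\<Prod>k\<in>K. f k (restrict (x(i := v)) (S k)) powe c k) \<partial>lborel \<partial>lebP I)"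
  proof (rule lebP.product_nn_integral_insert)
    have [measurable]: "(\<lambda>x. f k (restrict x (S k))) \<in> borel_measurable (lebP (insert i I))" if "k \<in> K" for k
      using measurable_compose[OF measurable_restrict_subset f_meas] S that by blast
    show "(\<lambda>x. \<Prod>k\<in>K. f k (restrict x (S k)) powe c k) \<in> borel_measurable (lebP (insert i I))"
      by measurable
  qed (use insert in auto)
  also have "\<dots> \<le> (\<integral>\<^sup>+x. (\<Prod>k\<in>K. f' k (restrict x (S' k)) powe c k) \<partial>lebP I)"
  proof (rule nn_integral_mono)
    fix x assume x: "x \<in> space (lebP I)"
    have in_K1: "restrict (x(i := v)) (S k) = (restrict x (S' k))(i := v)" if "k \<in> K1" for k v
      using that by (auto simp: K1_def S'_def restrict_def)
    have notin_K1: "restrict (x(i := v)) (S k) = restrict x (S' k)" if "k \<in> K - K1" for k v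
      using that by (auto simp: K1_def S'_def restrict_def)
    have x': "restrict x (S' k) \<in> space (lebP (S' k))" for k
      by (auto simp: space_PiM)
    have K1_meas: "(\<lambda>v. f k ((restrict x (S' k))(i := v))) \<in> borel_measurable lborel" if "k \<in> K1" for k
      using that by (intro measurable_compose[OF upd f_meas]) (auto simp: K1_def x')
    define P where "P = (\<Prod>k\<in>K - K1. f' k (restrict x (S' k)) powe c k)"
    have split: "(\<Prod>k\<in>K. F k) = (\<Prod>k\<in>K - K1. F k) * (\<Prod>k\<in>K1. F k)" for F :: "'k \<Rightarrow> ennreal"
      using insert.prems(1) by (intro prod.subset_diff) (auto simp: K1_def)
    have "(\<integral>\<^sup>+v. (\<Prod>k\<in>K. f k (restrict (x(i := v)) (S k)) powe c k) \<partial>lborel)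
        = (\<integral>\<^sup>+v. P * (\<Prod>k\<in>K1. f k ((restrict x (S' k))(i := v)) powe c k) \<partial>lborel)"
      unfolding split P_def
      by (intro nn_integral_cong arg_cong2[where f="(*)"] prod.cong refl)
         (auto simp: in_K1 notin_K1, auto simp: f'_def K1_def)
    also have "\<dots> = P * (\<integral>\<^sup>+v. (\<Prod>k\<in>K1. f k ((restrict x (S' k))(i := v)) powe c k) \<partial>lborel)"
    proof -
      have [measurable]: "(\<lambda>v. f k ((restrict x (S' k))(i := v))) \<in> borel_measurable borel" if "k \<in> K1" for k
        using K1_meas[OF that] by simp
      show ?thesis by (intro nn_integral_cmult) measurable
    qed
    also have "\<dots> \<le> P * (\<Prod>k\<in>K1. (\<integral>\<^sup>+v. f k ((restrict x (S' k))(i := v)) \<partial>lborel) powe c k)"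
      using insert.prems K1_meas
      by (intro mult_left_mono nn_integral_Holder) (auto simp: K1_def)
    also have "\<dots> = (\<Prod>k\<in>K. f' k (restrict x (S' k)) powe c k)"
      unfolding split P_def by (simp add: f'_def K1_def)
    finally show "(\<integral>\<^sup>+v. (\<Prod>k\<in>K. f k (restrict (x(i := v)) (S k)) powe c k) \<partial>lborel)
        \<le> (\<Prod>k\<in>K. f' k (restrict x (S' k)) powe c k)" .
  qed
  also have "\<dots> \<le> (\<Prod>k\<in>K. (\<integral>\<^sup>+x. f' k x \<partial>lebP (S' k)) powe c k)"
  proof (rule insert.IH)
    fix j assume "j \<in> I"
    then have "{k \<in> K. j \<in> S' k} = {k \<in> K. j \<in> S k}" using insert.hyps by (auto simp: S'_def)
    then show "(\<Sum>k\<in>{k\<in>K. j \<in> S' k}. c k) = 1" using insert.prems(4) \<open>j \<in> I\<close> by simp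
  next
    fix k assume "k \<in> K"
    then show "S' k \<subseteq> I" using S(1)[of k] by (auto simp: S'_def)
  qed (fact insert.prems(1) insert.prems(3) f'_meas)+
  also have "\<dots> = (\<Prod>k\<in>K. (\<integral>\<^sup>+x. f k x \<partial>lebP (S k)) powe c k)"
    by (intro prod.cong) (auto simp: f'_int)
  finally show ?case .
qed

section \<open>Two functions for each index: inequalities for pairs\<close>

lemma prod_mono_ennreal:
  fixes f g :: "'k \<Rightarrow> ennreal"
  assumes "\<And>k. k \<in> K \<Longrightarrow> f k \<le> g k"
  shows "(\<Prod>k\<in>K. f k) \<le> (\<Prod>k\<in>K. g k)"
  using assms by (induction K rule: infinite_finite_induct) (auto intro!: mult_mono)

text \<open>The flags \<open>True\<close> and \<open>False\<close> distinguish the two functions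
  attached to \<open>j\<close>, so that inequalities for one family cover both.\<close>

lemma prod_bool_pairs: "finite J \<Longrightarrow> (\<Prod>p\<in>J \<times> (UNIV :: bool set). F p) = (\<Prod>j\<in>J. F (j, True) * F (j, False))"
  for F :: "'j \<times> bool \<Rightarrow> 'c::comm_monoid_mult"
  using prod.cartesian_product[of "\<lambda>j b. F (j, b)" UNIV J] by (simp add: UNIV_bool mult.commute)

lemma sum_bool_pairs:
  assumes "finite J"
  shows "(\<Sum>p\<in>{p \<in> J \<times> (UNIV :: bool set). Q p}. c (fst p))
    = (\<Sum>j\<in>{j\<in>J. Q (j, True)}. c j) + (\<Sum>j\<in>{j\<in>J. Q (j, False)}. c j :: real)"
proof -
  have "(\<Sum>p\<in>{p \<in> J \<times> (UNIV :: bool set). Q p}. c (fst p))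
      = (\<Sum>p\<in>J \<times> (UNIV :: bool set). if Q p then c (fst p) else 0)"
    using assms by (intro sum.inter_filter) simp
  also have "\<dots> = (\<Sum>j\<in>J. \<Sum>b\<in>(UNIV :: bool set). if Q (j, b) then c j else 0)"
    by (simp add: sum.cartesian_product case_prod_beta)
  also have "\<dots> = (\<Sum>j\<in>J. if Q (j, True) then c j else 0) + (\<Sum>j\<in>J. if Q (j, False) then c j else 0)"
    by (simp add: UNIV_bool sum.distrib add.commute)
  finally show ?thesis
    using assms by (simp add: sum.inter_filter)
qed

text \<open>A coordinate \<open>i\<close> is seen by every \<open>G j\<close> and by those
  \<open>F j\<close> with \<open>i \<notin> B j\<close>; the hypothesis on \<open>u\<close> is
  Finner's weight condition for this configuration.\<close>

lemma finner_pairs: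
  fixes F G :: "'j \<Rightarrow> ('i \<Rightarrow> real) \<Rightarrow> ennreal"
  assumes "finite I" "finite J" "\<And>j. j \<in> J \<Longrightarrow> 0 \<le> u j"
    and sum: "\<And>i. i \<in> I \<Longrightarrow> (\<Sum>j\<in>J. u j) + (\<Sum>j\<in>{j\<in>J. i \<notin> B j}. u j) = 1"
    and "\<And>j. j \<in> J \<Longrightarrow> F j \<in> borel_measurable (lebP (I - B j))"
    and "\<And>j. j \<in> J \<Longrightarrow> G j \<in> borel_measurable (lebP I)"
  shows "(\<integral>\<^sup>+x. (\<Prod>j\<in>J. F j (restrict x (I - B j)) powe u j * G j x powe u j) \<partial>lebP I)
    \<le> (\<Prod>j\<in>J. (\<integral>\<^sup>+x. F j x \<partial>lebP (I - B j)) powe u j * (\<integral>\<^sup>+x. G j x \<partial>lebP I) powe u j)"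
proof -
  define S where "S p = (if snd p then I - B (fst p) else I)" for p :: "'j \<times> bool"
  define f where "f p = (if snd p then F (fst p) else G (fst p))" for p :: "'j \<times> bool"
  have "(\<integral>\<^sup>+x. (\<Prod>p\<in>J \<times> UNIV. f p (restrict x (S p)) powe u (fst p)) \<partial>lebP I)
      \<le> (\<Prod>p\<in>J \<times> UNIV. (\<integral>\<^sup>+x. f p x \<partial>lebP (S p)) powe u (fst p))"
  proof (rule finner_inequality)
    fix i assume "i \<in> I"
    then show "(\<Sum>p\<in>{p \<in> J \<times> UNIV. i \<in> S p}. u (fst p)) = 1"
      using sum[of i] assms(2) by (subst sum_bool_pairs) (auto simp: S_def add.commute)
  qed (use assms in \<open>auto simp: S_def f_def\<close>)
  moreover have "restrict x I = x" if "x \<in> space (lebP I)" for x :: "'i \<Rightarrow> real"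
    using that by (simp add: space_PiM PiE_restrict)
  ultimately show ?thesis
    unfolding prod_bool_pairs[OF assms(2)] S_def f_def fst_conv snd_conv if_True if_False
    by (simp cong: nn_integral_cong)
qed

text \<open>The pair inequality is used twice, first in \<open>y\<close> with \<open>x\<close>
  frozen and then in \<open>x\<close>. The first use leaves a product of the same shape, with the
  roles of \<open>G\<close> and \<open>H\<close> exchanged.\<close>

lemma loomis_whitney_pairs:
  fixes G H :: "'j \<Rightarrow> ('i \<Rightarrow> real) \<Rightarrow> ('i \<Rightarrow> real) \<Rightarrow> ennreal"
  assumes I: "finite I" and J: "finite J" and u: "\<And>j. j \<in> J \<Longrightarrow> 0 \<le> u j"
    and sum: "\<And>i. i \<in> I \<Longrightarrow> (\<Sum>j\<in>J. u j) + (\<Sum>j\<in>{j\<in>J. i \<notin> B j}. u j) = 1"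
    and G: "\<And>j. j \<in> J \<Longrightarrow> (\<lambda>(x, y). G j x y) \<in> borel_measurable (lebP (I - B j) \<Otimes>\<^sub>M lebP I)"
    and H: "\<And>j. j \<in> J \<Longrightarrow> (\<lambda>(x, y). H j x y) \<in> borel_measurable (lebP I \<Otimes>\<^sub>M lebP (I - B j))"
  shows "(\<integral>\<^sup>+x. \<integral>\<^sup>+y. (\<Prod>j\<in>J. G j (restrict x (I - B j)) y powe u j * H j x (restrict y (I - B j)) powe u j) \<partial>lebP I \<partial>lebP I)
    \<le> (\<Prod>j\<in>J. (\<integral>\<^sup>+x. \<integral>\<^sup>+y. G j x y \<partial>lebP I \<partial>lebP (I - B j)) powe u j
             * (\<integral>\<^sup>+x. \<integral>\<^sup>+y. H j x y \<partial>lebP (I - B j) \<partial>lebP I) powe u j)"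
proof -
  have sf: "sigma_finite_measure (lebP I)" "sigma_finite_measure (lebP (I - B j))" for j
    using I by (simp_all add: sigma_finite_lebP)
  have x': "restrict x (I - B j) \<in> space (lebP (I - B j))" for x :: "'i \<Rightarrow> real" and j
    by (auto simp: space_PiM)
  have "(\<integral>\<^sup>+x. \<integral>\<^sup>+y. (\<Prod>j\<in>J. G j (restrict x (I - B j)) y powe u j * H j x (restrict y (I - B j)) powe u j) \<partial>lebP I \<partial>lebP I)
     \<le> (\<integral>\<^sup>+x. (\<Prod>j\<in>J. (\<integral>\<^sup>+y. G j (restrict x (I - B j)) y \<partial>lebP I) powe u j
          * (\<integral>\<^sup>+y. H j x y \<partial>lebP (I - B j)) powe u j) \<partial>lebP I)"
  proof (rule nn_integral_mono)
    fix x assume x: "x \<in> space (lebP I)"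
    have "(\<integral>\<^sup>+y. (\<Prod>j\<in>J. H j x (restrict y (I - B j)) powe u j * G j (restrict x (I - B j)) y powe u j) \<partial>lebP I)
      \<le> (\<Prod>j\<in>J. (\<integral>\<^sup>+y. H j x y \<partial>lebP (I - B j)) powe u j * (\<integral>\<^sup>+y. G j (restrict x (I - B j)) y \<partial>lebP I) powe u j)"
      using measurable_compose[OF measurable_Pair1'[OF x] H] measurable_compose[OF measurable_Pair1'[OF x'] G]
      by (intro finner_pairs[where F="\<lambda>j y. H j x y" and G="\<lambda>j y. G j (restrict x (I - B j)) y" and u=u and B=B]
          I J u sum) simp_all
    then show "(\<integral>\<^sup>+y. (\<Prod>j\<in>J. G j (restrict x (I - B j)) y powe u j * H j x (restrict y (I - B j)) powe u j) \<partial>lebP I)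
      \<le> (\<Prod>j\<in>J. (\<integral>\<^sup>+y. G j (restrict x (I - B j)) y \<partial>lebP I) powe u j * (\<integral>\<^sup>+y. H j x y \<partial>lebP (I - B j)) powe u j)"
      by (simp add: mult.commute)
  qed
  also have "\<dots> \<le> (\<Prod>j\<in>J. (\<integral>\<^sup>+x. \<integral>\<^sup>+y. G j x y \<partial>lebP I \<partial>lebP (I - B j)) powe u j
             * (\<integral>\<^sup>+x. \<integral>\<^sup>+y. H j x y \<partial>lebP (I - B j) \<partial>lebP I) powe u j)"
    using sigma_finite_measure.borel_measurable_nn_integral[OF sf(1) G]
      sigma_finite_measure.borel_measurable_nn_integral[OF sf(2) H]
    by (intro finner_pairs[where F="\<lambda>j x. \<integral>\<^sup>+y. G j x y \<partial>lebP I"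
          and G="\<lambda>j x. \<integral>\<^sup>+y. H j x y \<partial>lebP (I - B j)" and u=u and B=B] I J u sum) simp_all
  finally show ?thesis .
qed

section \<open>The vertex inequality\<close>

text \<open>Translating \<open>t\<close> by half the product of \<open>x\<close> and
  \<open>y\<close> moves the whole shear onto \<open>F\<close>, so the form pairs the Radon
  transform of a power of \<open>F\<close> with a power of \<open>G\<close>. Hoelder with d+2 and
  its conjugate exponent, followed by \<open>radon_bound\<close>, finishes.\<close>

lemma radon_bilinear:
  fixes F G :: "('i \<Rightarrow> real) \<Rightarrow> real \<Rightarrow> ennreal"
  assumes B: "finite B" and C: "radon_bound B C"
    and F [measurable]: "(\<lambda>(y, t). F y t) \<in> borel_measurable (lebP B \<Otimes>\<^sub>M lborel)"
    and G [measurable]: "(\<lambda>(x, t). G x t) \<in> borel_measurable (lebP B \<Otimes>\<^sub>M lborel)"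
    and e: "e = (real (card B) + 1) / (real (card B) + 2)"
  shows "(\<integral>\<^sup>+x. \<integral>\<^sup>+y. \<integral>\<^sup>+t. F y (t + 1/2 * dotp B x y) powe e * G x (t - 1/2 * dotp B x y) powe e \<partial>lborel \<partial>lebP B \<partial>lebP B)
    \<le> C powe (1 / (real (card B) + 2)) * (\<integral>\<^sup>+y. \<integral>\<^sup>+t. F y t \<partial>lborel \<partial>lebP B) powe e * (\<integral>\<^sup>+x. \<integral>\<^sup>+t. G x t \<partial>lborel \<partial>lebP B) powe e"
proof -
  interpret sigma_finite_measure "lebP B" by (rule sigma_finite_lebP[OF B])
  define d where "d = real (card B) + 2"
  have d: "0 < d" "1/d \<le> 1" "e = 1 - 1/d" "e = (card B + 1) * (1/d)" "d = real (card B + 2)"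
    by (auto simp: d_def e field_simps)
  define R where "R x s = radon B (\<lambda>y t. F y t powe e) x s" for x s
  have R_meas [measurable]: "(\<lambda>(x, s). R x s) \<in> borel_measurable (lebP B \<Otimes>\<^sub>M lborel)"
    unfolding R_def radon_def by measurable
  have "(\<integral>\<^sup>+x. \<integral>\<^sup>+y. \<integral>\<^sup>+t. F y (t + 1/2 * dotp B x y) powe e * G x (t - 1/2 * dotp B x y) powe e \<partial>lborel \<partial>lebP B \<partial>lebP B)
      = (\<integral>\<^sup>+x. \<integral>\<^sup>+y. \<integral>\<^sup>+s. F y (s + dotp B x y) powe e * G x s powe e \<partial>lborel \<partial>lebP B \<partial>lebP B)"
  proof (rule nn_integral_cong, rule nn_integral_cong)
    fix x y :: "'i \<Rightarrow> real" assume [measurable]: "x \<in> space (lebP B)" "y \<in> space (lebP B)"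
    have "(\<lambda>s. F y (s + dotp B x y) powe e * G x s powe e) \<in> borel_measurable borel"
      by measurable
    from nn_integral_shift[OF this, of "- 1/2 * dotp B x y"]
    show "(\<integral>\<^sup>+t. F y (t + 1/2 * dotp B x y) powe e * G x (t - 1/2 * dotp B x y) powe e \<partial>lborel)
      = (\<integral>\<^sup>+s. F y (s + dotp B x y) powe e * G x s powe e \<partial>lborel)"
      by (simp add: algebra_simps)
  qed
  also have "\<dots> = (\<integral>\<^sup>+x. \<integral>\<^sup>+s. \<integral>\<^sup>+y. F y (s + dotp B x y) powe e * G x s powe e \<partial>lebP B \<partial>lborel \<partial>lebP B)"
    by (intro nn_integral_cong nn_integral_swap) (auto intro: sigma_finite_lebP B lborel.sigma_finite_measure_axioms)
  also have "\<dots> = (\<integral>\<^sup>+x. \<integral>\<^sup>+s. R x s * G x s powe e \<partial>lborel \<partial>lebP B)"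
  proof (intro nn_integral_cong)
    fix x :: "'i \<Rightarrow> real" and s :: real assume [measurable]: "x \<in> space (lebP B)"
    have "(\<lambda>y. F y (s + dotp B x y) powe e) \<in> borel_measurable (lebP B)"
      by measurable
    then show "(\<integral>\<^sup>+y. F y (s + dotp B x y) powe e * G x s powe e \<partial>lebP B) = R x s * G x s powe e"
      by (simp add: R_def radon_def nn_integral_multc)
  qed
  also have "\<dots> = (\<integral>\<^sup>+p. ((R (fst p) (snd p)) ^ (card B + 2)) powe (1/d) * G (fst p) (snd p) powe e \<partial>(lebP B \<Otimes>\<^sub>M lborel))"
  proof -
    have "(a ^ (card B + 2)) powe (1/d) = a" for a
      using d by (simp add: epow_epow flip: epow_of_nat)
    then show ?thesis by (subst lborel.nn_integral_fst[symmetric]) auto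
  qed
  also have "\<dots> \<le> (\<integral>\<^sup>+p. (R (fst p) (snd p)) ^ (card B + 2) \<partial>(lebP B \<Otimes>\<^sub>M lborel)) powe (1/d)
      * (\<integral>\<^sup>+p. G (fst p) (snd p) \<partial>(lebP B \<Otimes>\<^sub>M lborel)) powe e"
    using d by (intro nn_integral_Holder2) auto
  also have "(\<integral>\<^sup>+p. (R (fst p) (snd p)) ^ (card B + 2) \<partial>(lebP B \<Otimes>\<^sub>M lborel))
      = (\<integral>\<^sup>+x. \<integral>\<^sup>+s. R x s ^ (card B + 2) \<partial>lborel \<partial>lebP B)"
    by (subst lborel.nn_integral_fst[symmetric]) auto
  also have "(\<integral>\<^sup>+p. G (fst p) (snd p) \<partial>(lebP B \<Otimes>\<^sub>M lborel)) = (\<integral>\<^sup>+x. \<integral>\<^sup>+t. G x t \<partial>lborel \<partial>lebP B)"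
    by (subst lborel.nn_integral_fst[symmetric]) auto
  also have "(\<integral>\<^sup>+x. \<integral>\<^sup>+s. R x s ^ (card B + 2) \<partial>lborel \<partial>lebP B) powe (1/d) * (\<integral>\<^sup>+x. \<integral>\<^sup>+t. G x t \<partial>lborel \<partial>lebP B) powe e
      \<le> (C * (\<integral>\<^sup>+y. \<integral>\<^sup>+t. F y t \<partial>lborel \<partial>lebP B) ^ (card B + 1)) powe (1/d) * (\<integral>\<^sup>+x. \<integral>\<^sup>+t. G x t \<partial>lborel \<partial>lebP B) powe e"
    using C F d(1) unfolding radon_bound_def R_def e
    by (intro mult_right_mono epow_mono) auto
  also have "(C * (\<integral>\<^sup>+y. \<integral>\<^sup>+t. F y t \<partial>lborel \<partial>lebP B) ^ (card B + 1)) powe (1/d)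
      = C powe (1/d) * (\<integral>\<^sup>+y. \<integral>\<^sup>+t. F y t \<partial>lborel \<partial>lebP B) powe e"
    using d(1) unfolding d(4) epow_of_nat[symmetric] by (simp add: epow_mult epow_epow)
  finally show ?thesis by (simp add: d_def)
qed

text \<open>Hoelder in \<open>(x, y, t)\<close> among the sheared pair, with weight
  \<open>\<theta>\<close>, and one geometric mean of \<open>P j\<close> and \<open>Q j\<close> for
  each other \<open>j\<close>, with weight \<open>2 * \<sigma>\<close>. The weights sum to one
  because (d+2) + 2 (N-1) d = D. The local \<open>\<sigma>\<close> is the value of the overview's
  \<sigma> at this vertex, and \<open>\<tau>\<close> exceeds it by 1/D.\<close>

lemma vertex_fibre:
  fixes F G :: "('i \<Rightarrow> real) \<Rightarrow> real \<Rightarrow> ennreal" and P Q :: "'j \<Rightarrow> ('i \<Rightarrow> real) \<Rightarrow> ('i \<Rightarrow> real) \<Rightarrow> real \<Rightarrow> ennreal"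
  assumes B: "finite B" and C: "radon_bound B C"
    and F [measurable]: "(\<lambda>(y, t). F y t) \<in> borel_measurable (lebP B \<Otimes>\<^sub>M lborel)"
    and G [measurable]: "(\<lambda>(x, t). G x t) \<in> borel_measurable (lebP B \<Otimes>\<^sub>M lborel)"
    and J: "finite J" "k \<in> J"
    and P: "\<And>j. j \<in> J \<Longrightarrow> (\<lambda>(x, y, t). P j x y t) \<in> borel_measurable (lebP B \<Otimes>\<^sub>M lebP B \<Otimes>\<^sub>M lborel)"
    and Q: "\<And>j. j \<in> J \<Longrightarrow> (\<lambda>(x, y, t). Q j x y t) \<in> borel_measurable (lebP B \<Otimes>\<^sub>M lebP B \<Otimes>\<^sub>M lborel)"
    and D: "D = (2 * real (card J) - 1) * real (card B) + 2"
    and \<tau>: "\<tau> = (real (card B) + 1) / D" and \<sigma>: "\<sigma> = real (card B) / D"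
  shows "(\<integral>\<^sup>+x. \<integral>\<^sup>+y. \<integral>\<^sup>+t. F y (t + 1/2 * dotp B x y) powe \<tau> * G x (t - 1/2 * dotp B x y) powe \<tau>
       * (\<Prod>j\<in>J - {k}. P j x y t powe \<sigma> * Q j x y t powe \<sigma>) \<partial>lborel \<partial>lebP B \<partial>lebP B)
    \<le> C powe (1/D) * (\<integral>\<^sup>+y. \<integral>\<^sup>+t. F y t \<partial>lborel \<partial>lebP B) powe \<tau> * (\<integral>\<^sup>+x. \<integral>\<^sup>+t. G x t \<partial>lborel \<partial>lebP B) powe \<tau>
       * (\<Prod>j\<in>J - {k}. (\<integral>\<^sup>+x. \<integral>\<^sup>+y. \<integral>\<^sup>+t. P j x y t \<partial>lborel \<partial>lebP B \<partial>lebP B) powe \<sigma>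
            * (\<integral>\<^sup>+x. \<integral>\<^sup>+y. \<integral>\<^sup>+t. Q j x y t \<partial>lborel \<partial>lebP B \<partial>lebP B) powe \<sigma>)"
proof -
  interpret sigma_finite_measure "lebP B" by (rule sigma_finite_lebP[OF B])
  define d where "d = real (card B)"
  define N where "N = real (card J)"
  define e where "e = (d + 1) / (d + 2)"
  \<comment> \<open>Chosen so that \<open>e * \<theta> = \<tau>\<close>, with \<open>e\<close> the
    exponent of the bilinear estimate.\<close>
  define \<theta> where "\<theta> = (d + 2) / D"
  have N: "1 \<le> N"
    using J card_gt_0_iff[of J] by (auto simp: N_def)
  have d: "0 \<le> d" by (simp add: d_def)
  have "0 \<le> (2 * N - 1) * d" using N d by simp
  then have D': "0 < D" "D = (2 * N - 1) * d + 2" by (simp_all add: D d_def N_def)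
  have pos: "0 \<le> \<theta>" "0 \<le> \<sigma>" "0 \<le> e" using D' d by (simp_all add: \<theta>_def \<sigma> d_def e_def)
  have e\<theta>: "e * \<theta> = \<tau>" "1 / (d + 2) * \<theta> = 1 / D"
    using D' d by (simp_all add: e_def \<theta>_def \<tau> d_def)
  define M where "M = lebP B \<Otimes>\<^sub>M lebP B \<Otimes>\<^sub>M (lborel :: real measure)"
  define \<Phi> where "\<Phi> p = (case p of (x, y, t) \<Rightarrow> F y (t + 1/2 * dotp B x y) powe e * G x (t - 1/2 * dotp B x y) powe e)" for p
  define f where "f j p = (if j = k then \<Phi> p
      else case p of (x, y, t) \<Rightarrow> P j x y t powe (1/2) * Q j x y t powe (1/2))" for j p
  define w where "w j = (if j = k then \<theta> else 2 * \<sigma>)" for j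
  have triple: "(\<integral>\<^sup>+x. \<integral>\<^sup>+y. \<integral>\<^sup>+t. f x y t \<partial>lborel \<partial>lebP B \<partial>lebP B) = (\<integral>\<^sup>+(x, y, t). f x y t \<partial>M)"
    if "(\<lambda>(x, y, t). f x y t) \<in> borel_measurable M" for f :: "('i \<Rightarrow> real) \<Rightarrow> ('i \<Rightarrow> real) \<Rightarrow> real \<Rightarrow> ennreal"
    using that unfolding M_def
    by (intro nn_integral_triple sigma_finite_lebP B lborel.sigma_finite_measure_axioms)
  have PQ_meas [measurable]: "(\<lambda>(x, y, t). P j x y t) \<in> borel_measurable M" "(\<lambda>(x, y, t). Q j x y t) \<in> borel_measurable M"
    if "j \<in> J" for j
    using P Q that by (auto simp: M_def)
  have [measurable]: "\<Phi> \<in> borel_measurable M"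
    unfolding \<Phi>_def M_def by measurable
  have f_meas [measurable]: "f j \<in> borel_measurable M" if "j \<in> J" for j
    using PQ_meas[OF that] unfolding f_def case_prod_unfold by (cases "j = k") simp_all
  have split: "(\<Prod>j\<in>J. X j) = X k * (\<Prod>j\<in>J - {k}. X j)" for X :: "'j \<Rightarrow> ennreal"
    by (rule prod.remove[OF J])
  have integrand: "F y (t + 1/2 * dotp B x y) powe \<tau> * G x (t - 1/2 * dotp B x y) powe \<tau>
       * (\<Prod>j\<in>J - {k}. P j x y t powe \<sigma> * Q j x y t powe \<sigma>) = (\<Prod>j\<in>J. f j (x, y, t) powe w j)" for x y t
    unfolding split using pos
    by (simp add: f_def w_def \<Phi>_def epow_mult epow_epow e\<theta>)
  have "(\<lambda>p. \<Prod>j\<in>J. f j p powe w j) \<in> borel_measurable M"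
    by measurable
  then have "(\<integral>\<^sup>+x. \<integral>\<^sup>+y. \<integral>\<^sup>+t. F y (t + 1/2 * dotp B x y) powe \<tau> * G x (t - 1/2 * dotp B x y) powe \<tau>
       * (\<Prod>j\<in>J - {k}. P j x y t powe \<sigma> * Q j x y t powe \<sigma>) \<partial>lborel \<partial>lebP B \<partial>lebP B)
    = (\<integral>\<^sup>+p. (\<Prod>j\<in>J. f j p powe w j) \<partial>M)"
    unfolding integrand by (subst triple) (simp_all add: case_prod_unfold)
  also have "\<dots> \<le> (\<Prod>j\<in>J. (\<integral>\<^sup>+p. f j p \<partial>M) powe w j)"
  proof (rule nn_integral_Holder[OF J(1)])
    have "(\<Sum>j\<in>J. w j) = \<theta> + (\<Sum>j\<in>J - {k}. 2 * \<sigma>)"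
      using J by (subst sum.remove[OF J]) (simp_all add: w_def)
    also have "\<dots> = \<theta> + (N - 1) * (2 * \<sigma>)"
      using J N by (simp add: N_def of_nat_diff card_gt_0_iff Suc_le_eq)
    also have "\<dots> = ((d + 2) + (N - 1) * (2 * d)) / D"
      by (simp add: \<theta>_def \<sigma> d_def add_divide_distrib)
    also have "(d + 2) + (N - 1) * (2 * d) = D"
      unfolding D'(2) by (simp add: algebra_simps)
    finally show "(\<Sum>j\<in>J. w j) = 1" using D' by simp
  qed (use pos f_meas in \<open>auto simp: w_def\<close>)
  also have "\<dots> = (\<integral>\<^sup>+p. \<Phi> p \<partial>M) powe \<theta> * (\<Prod>j\<in>J - {k}. (\<integral>\<^sup>+p. f j p \<partial>M) powe (2 * \<sigma>))"
  proof -
    have "f k = \<Phi>" by (auto simp: f_def)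
    then show ?thesis unfolding split by (auto simp: w_def intro!: arg_cong2[where f="(*)"] prod.cong)
  qed
  also have "\<dots> \<le> (C powe (1 / (d + 2)) * (\<integral>\<^sup>+y. \<integral>\<^sup>+t. F y t \<partial>lborel \<partial>lebP B) powe e * (\<integral>\<^sup>+x. \<integral>\<^sup>+t. G x t \<partial>lborel \<partial>lebP B) powe e) powe \<theta>
    * (\<Prod>j\<in>J - {k}. ((\<integral>\<^sup>+x. \<integral>\<^sup>+y. \<integral>\<^sup>+t. P j x y t \<partial>lborel \<partial>lebP B \<partial>lebP B) powe (1/2)
            * (\<integral>\<^sup>+x. \<integral>\<^sup>+y. \<integral>\<^sup>+t. Q j x y t \<partial>lborel \<partial>lebP B \<partial>lebP B) powe (1/2)) powe (2 * \<sigma>))"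
  proof -
    have "(\<integral>\<^sup>+p. \<Phi> p \<partial>M) = (\<integral>\<^sup>+x. \<integral>\<^sup>+y. \<integral>\<^sup>+t. F y (t + 1/2 * dotp B x y) powe e * G x (t - 1/2 * dotp B x y) powe e \<partial>lborel \<partial>lebP B \<partial>lebP B)"
      unfolding \<Phi>_def by (subst triple) (simp_all add: M_def)
    also have "\<dots> \<le> C powe (1 / (d + 2)) * (\<integral>\<^sup>+y. \<integral>\<^sup>+t. F y t \<partial>lborel \<partial>lebP B) powe e * (\<integral>\<^sup>+x. \<integral>\<^sup>+t. G x t \<partial>lborel \<partial>lebP B) powe e"
      unfolding d_def by (rule radon_bilinear[OF B C F G]) (simp add: e_def d_def)
    finally have \<Phi>_le: "(\<integral>\<^sup>+p. \<Phi> p \<partial>M) \<le> C powe (1 / (d + 2)) * (\<integral>\<^sup>+y. \<integral>\<^sup>+t. F y t \<partial>lborel \<partial>lebP B) powe e * (\<integral>\<^sup>+x. \<integral>\<^sup>+t. G x t \<partial>lborel \<partial>lebP B) powe e" .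
    have f_le: "(\<integral>\<^sup>+p. f j p \<partial>M) \<le> (\<integral>\<^sup>+x. \<integral>\<^sup>+y. \<integral>\<^sup>+t. P j x y t \<partial>lborel \<partial>lebP B \<partial>lebP B) powe (1/2)
            * (\<integral>\<^sup>+x. \<integral>\<^sup>+y. \<integral>\<^sup>+t. Q j x y t \<partial>lborel \<partial>lebP B \<partial>lebP B) powe (1/2)"
      if j: "j \<in> J - {k}" for j
    proof -
      have "(\<integral>\<^sup>+p. f j p \<partial>M) = (\<integral>\<^sup>+p. (case p of (x, y, t) \<Rightarrow> P j x y t) powe (1/2) * (case p of (x, y, t) \<Rightarrow> Q j x y t) powe (1/2) \<partial>M)"
        using j by (simp add: f_def case_prod_unfold)
      also have "\<dots> \<le> (\<integral>\<^sup>+(x, y, t). P j x y t \<partial>M) powe (1/2) * (\<integral>\<^sup>+(x, y, t). Q j x y t \<partial>M) powe (1/2)"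
        using j PQ_meas[of j] by (intro nn_integral_Holder2) auto
      also have "(\<integral>\<^sup>+(x, y, t). P j x y t \<partial>M) = (\<integral>\<^sup>+x. \<integral>\<^sup>+y. \<integral>\<^sup>+t. P j x y t \<partial>lborel \<partial>lebP B \<partial>lebP B)"
        using j PQ_meas(1)[of j] by (intro triple[symmetric]) auto
      also have "(\<integral>\<^sup>+(x, y, t). Q j x y t \<partial>M) = (\<integral>\<^sup>+x. \<integral>\<^sup>+y. \<integral>\<^sup>+t. Q j x y t \<partial>lborel \<partial>lebP B \<partial>lebP B)"
        using j PQ_meas(2)[of j] by (intro triple[symmetric]) auto
      finally show ?thesis .
    qed
    show ?thesis
      using pos by (intro mult_mono prod_mono_ennreal epow_mono[OF _ \<Phi>_le] epow_mono[OF _ f_le]) auto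
  qed
  finally show ?thesis
    using pos e\<theta>(2) by (simp add: epow_mult epow_epow e\<theta>(1))
qed

lemma nn_integral_cmult2:
  assumes "sigma_finite_measure N" and f [measurable]: "(\<lambda>(x, y). f x y) \<in> borel_measurable (M \<Otimes>\<^sub>M N)"
  shows "(\<integral>\<^sup>+x. \<integral>\<^sup>+y. c * f x y \<partial>N \<partial>M) = c * (\<integral>\<^sup>+x. \<integral>\<^sup>+y. f x y \<partial>N \<partial>M)"
proof -
  interpret sigma_finite_measure N by fact
  have "(\<integral>\<^sup>+x. \<integral>\<^sup>+y. c * f x y \<partial>N \<partial>M) = (\<integral>\<^sup>+x. c * (\<integral>\<^sup>+y. f x y \<partial>N) \<partial>M)"
    by (intro nn_integral_cong nn_integral_cmult) measurable
  also have "\<dots> = c * (\<integral>\<^sup>+x. \<integral>\<^sup>+y. f x y \<partial>N \<partial>M)"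
    by (rule nn_integral_cmult) measurable
  finally show ?thesis .
qed

section \<open>Splitting off a block of coordinates and pulling back along the projections\<close>

lemma merge_measurable:
  assumes "x \<in> measurable M (lebP A)" "y \<in> measurable M (lebP D)" "E = A \<union> D"
  shows "(\<lambda>w. merge A D (x w, y w)) \<in> measurable M (lebP E)"
  using assms measurable_compose[OF _ measurable_merge, of "\<lambda>w. (x w, y w)" M A "\<lambda>_. lborel" D] by simp

text \<open>For the choice of \<open>A2\<close> and \<open>D2\<close> as the parts in one block, the
  three inner integrals run over the fibre on which the remaining coordinates are frozen.\<close>

lemma nn_integral_fold:
  fixes f :: "('i \<Rightarrow> real) \<Rightarrow> ('i \<Rightarrow> real) \<Rightarrow> real \<Rightarrow> ennreal"
  assumes A: "A = A1 \<union> A2" "A1 \<inter> A2 = {}" "finite A" and D: "D = D1 \<union> D2" "D1 \<inter> D2 = {}" "finite D"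
    and f: "(\<lambda>(x, y, t). f x y t) \<in> borel_measurable (lebP A \<Otimes>\<^sub>M lebP D \<Otimes>\<^sub>M lborel)"
  shows "(\<integral>\<^sup>+x. \<integral>\<^sup>+y. \<integral>\<^sup>+t. f x y t \<partial>lborel \<partial>lebP D \<partial>lebP A)
    = (\<integral>\<^sup>+x1. \<integral>\<^sup>+y1. \<integral>\<^sup>+x2. \<integral>\<^sup>+y2. \<integral>\<^sup>+t. f (merge A1 A2 (x1, x2)) (merge D1 D2 (y1, y2)) t
        \<partial>lborel \<partial>lebP D2 \<partial>lebP A2 \<partial>lebP D1 \<partial>lebP A1)"
proof -
  have fin: "finite A1" "finite A2" "finite D1" "finite D2" using A D by auto
  interpret A: sigma_finite_measure "lebP A" by (rule sigma_finite_lebP) (use A in auto)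
  interpret D: sigma_finite_measure "lebP D" by (rule sigma_finite_lebP) (use D in auto)
  interpret A2: sigma_finite_measure "lebP A2" by (rule sigma_finite_lebP) (use fin in auto)
  interpret D1: sigma_finite_measure "lebP D1" by (rule sigma_finite_lebP) (use fin in auto)
  interpret D2: sigma_finite_measure "lebP D2" by (rule sigma_finite_lebP) (use fin in auto)
  note measurable_compose3[OF f, measurable (raw)]
  note merge_measurable[OF _ _ A(1), measurable (raw)]
  note merge_measurable[OF _ _ D(1), measurable (raw)]
  have "(\<integral>\<^sup>+x. \<integral>\<^sup>+y. \<integral>\<^sup>+t. f x y t \<partial>lborel \<partial>lebP D \<partial>lebP A)
      = (\<integral>\<^sup>+x1. \<integral>\<^sup>+x2. \<integral>\<^sup>+y. \<integral>\<^sup>+t. f (merge A1 A2 (x1, x2)) y t \<partial>lborel \<partial>lebP D \<partial>lebP A2 \<partial>lebP A1)"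
    unfolding A(1)
    by (rule lebP.product_nn_integral_fold) (use fin A(2) in \<open>simp_all add: A(1)[symmetric]\<close>)
  also have "\<dots> = (\<integral>\<^sup>+x1. \<integral>\<^sup>+x2. \<integral>\<^sup>+y1. \<integral>\<^sup>+y2. \<integral>\<^sup>+t. f (merge A1 A2 (x1, x2)) (merge D1 D2 (y1, y2)) t
      \<partial>lborel \<partial>lebP D2 \<partial>lebP D1 \<partial>lebP A2 \<partial>lebP A1)"
  proof (rule nn_integral_cong, rule nn_integral_cong)
    fix x1 x2 :: "'i \<Rightarrow> real" assume [measurable]: "x1 \<in> space (lebP A1)" "x2 \<in> space (lebP A2)"
    have "(\<lambda>y. \<integral>\<^sup>+t. f (merge A1 A2 (x1, x2)) y t \<partial>lborel) \<in> borel_measurable (lebP D)"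
      by measurable
    then show "(\<integral>\<^sup>+y. \<integral>\<^sup>+t. f (merge A1 A2 (x1, x2)) y t \<partial>lborel \<partial>lebP D)
      = (\<integral>\<^sup>+y1. \<integral>\<^sup>+y2. \<integral>\<^sup>+t. f (merge A1 A2 (x1, x2)) (merge D1 D2 (y1, y2)) t \<partial>lborel \<partial>lebP D2 \<partial>lebP D1)"
      unfolding D(1) by (intro lebP.product_nn_integral_fold) (use fin D(2) in simp_all)
  qed
  also have "\<dots> = (\<integral>\<^sup>+x1. \<integral>\<^sup>+y1. \<integral>\<^sup>+x2. \<integral>\<^sup>+y2. \<integral>\<^sup>+t. f (merge A1 A2 (x1, x2)) (merge D1 D2 (y1, y2)) t
        \<partial>lborel \<partial>lebP D2 \<partial>lebP A2 \<partial>lebP D1 \<partial>lebP A1)"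
    by (intro nn_integral_cong nn_integral_swap) (auto intro: sigma_finite_lebP fin)
  finally show ?thesis .
qed

text \<open>\<open>g\<close> lives on the codomain of one of the maps \<open>\<pi>\<^sub>j\<close>, with \<open>B\<close> the set of coordinates that the
  map removes; \<open>pull1\<close> and \<open>pull2\<close> are the compositions with \<open>\<pi>\<^sub>j\<close> and \<open>\<pi>\<^sub>j\<^sub>+\<^sub>m\<close>.\<close>

definition pull1 :: "'i set \<Rightarrow> 'i set \<Rightarrow> (('i \<Rightarrow> real) \<Rightarrow> ('i \<Rightarrow> real) \<Rightarrow> real \<Rightarrow> ennreal)
    \<Rightarrow> ('i \<Rightarrow> real) \<Rightarrow> ('i \<Rightarrow> real) \<Rightarrow> real \<Rightarrow> ennreal" where
  "pull1 I B g x y t = g (restrict x (I - B)) y (t + 1/2 * dotp B x y)"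

definition pull2 :: "'i set \<Rightarrow> 'i set \<Rightarrow> (('i \<Rightarrow> real) \<Rightarrow> ('i \<Rightarrow> real) \<Rightarrow> real \<Rightarrow> ennreal)
    \<Rightarrow> ('i \<Rightarrow> real) \<Rightarrow> ('i \<Rightarrow> real) \<Rightarrow> real \<Rightarrow> ennreal" where
  "pull2 I B h x y t = h x (restrict y (I - B)) (t - 1/2 * dotp B x y)"

definition mass :: "'i set \<Rightarrow> 'i set \<Rightarrow> (('i \<Rightarrow> real) \<Rightarrow> ('i \<Rightarrow> real) \<Rightarrow> real \<Rightarrow> ennreal) \<Rightarrow> ennreal" where
  "mass A D g = (\<integral>\<^sup>+x. \<integral>\<^sup>+y. \<integral>\<^sup>+t. g x y t \<partial>lborel \<partial>lebP D \<partial>lebP A)"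

abbreviation measurable3 :: "'i set \<Rightarrow> 'i set \<Rightarrow> (('i \<Rightarrow> real) \<Rightarrow> ('i \<Rightarrow> real) \<Rightarrow> real \<Rightarrow> ennreal) \<Rightarrow> bool" where
  "measurable3 A D g \<equiv> (\<lambda>(x, y, t). g x y t) \<in> borel_measurable (lebP A \<Otimes>\<^sub>M lebP D \<Otimes>\<^sub>M lborel)"

lemma restrict_measurable:
  assumes "x \<in> measurable M (lebP A)" "D \<subseteq> A"
  shows "(\<lambda>w. restrict (x w) D) \<in> measurable M (lebP D)"
  using measurable_compose[OF assms(1) measurable_restrict_subset[OF assms(2)]] .

lemma measurable_pull1:
  assumes g: "measurable3 (I - B) I g" and "B \<subseteq> I"
  shows "measurable3 I I (pull1 I B g)"
proof -
  note measurable_compose3[OF g, measurable (raw)]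
  have [measurable]: "(\<lambda>w. restrict (x w) (I - B)) \<in> measurable M (lebP (I - B))"
    "(\<lambda>w. dotp B (x w) (y w)) \<in> borel_measurable M"
    if "x \<in> measurable M (lebP I)" "y \<in> measurable M (lebP I)" for x y and M :: "'z measure"
    using that assms(2) by (auto intro: restrict_measurable measurable_dotp)
  show ?thesis unfolding pull1_def by measurable
qed

lemma measurable_pull2:
  assumes h: "measurable3 I (I - B) h" and "B \<subseteq> I"
  shows "measurable3 I I (pull2 I B h)"
proof -
  note measurable_compose3[OF h, measurable (raw)]
  have [measurable]: "(\<lambda>w. restrict (y w) (I - B)) \<in> measurable M (lebP (I - B))"
    "(\<lambda>w. dotp B (x w) (y w)) \<in> borel_measurable M"
    if "x \<in> measurable M (lebP I)" "y \<in> measurable M (lebP I)" for x y and M :: "'z measure"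
    using that assms(2) by (auto intro: restrict_measurable measurable_dotp)
  show ?thesis unfolding pull2_def by measurable
qed

lemma merge_restrict: "merge A D (restrict x A, y) = merge A D (x, y)"
  by (auto simp: merge_def)

lemma merge_empty_right: "x \<in> space (lebP A) \<Longrightarrow> merge A {} (x, y) = x"
  by (auto simp: merge_def space_PiM PiE_def extensional_def)

lemma restrict_merge_split:
  assumes "S = S1 \<union> S2" "S1 \<subseteq> A" "S2 \<subseteq> D" "A \<inter> D = {}"
  shows "restrict (merge A D (x, y)) S = merge S1 S2 (x, y)"
  using assms by (auto simp: merge_def restrict_def fun_eq_iff)

lemma dotp_merge1: "S \<subseteq> A \<Longrightarrow> dotp S (merge A D (x, \<xi>)) (merge A D (y, \<eta>)) = dotp S x y"
  unfolding dotp_def by (intro sum.cong) (auto simp: merge_def)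

lemma dotp_merge2: "A \<inter> D = {} \<Longrightarrow> dotp D (merge A D (x, \<xi>)) (merge A D (y, \<eta>)) = dotp D \<xi> \<eta>"
  unfolding dotp_def by (intro sum.cong) (auto simp: merge_def)

text \<open>This removes the constant shears that frozen coordinates produce.\<close>

lemma mass_shift:
  assumes "finite A" "finite D" "measurable3 A D f"
  shows "mass A D (\<lambda>x y t. f x y (t + c)) = mass A D f"
  unfolding mass_def
proof (rule nn_integral_cong, rule nn_integral_cong)
  note measurable_compose3[OF assms(3), measurable (raw)]
  fix x y assume [measurable]: "x \<in> space (lebP A)" "y \<in> space (lebP D)"
  have "(\<lambda>t. f x y t) \<in> borel_measurable borel" by measurable
  then show "(\<integral>\<^sup>+t. f x y (t + c) \<partial>lborel) = (\<integral>\<^sup>+t. f x y t \<partial>lborel)"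
    by (rule nn_integral_shift)
qed

lemma vertex_inequality:
  fixes I :: "'i set" and J :: "'j set"
  assumes I: "finite I" and J: "finite J" and k: "k \<in> J"
    and BI: "\<And>j. j \<in> J \<Longrightarrow> B j \<subseteq> I"
    and disj: "\<And>i j. i \<in> J \<Longrightarrow> j \<in> J \<Longrightarrow> i \<noteq> j \<Longrightarrow> B i \<inter> B j = {}"
    and cover: "\<And>i. i \<in> I \<Longrightarrow> \<exists>j\<in>J. i \<in> B j"
    and C: "radon_bound (B k) C"
    and D: "D = (2 * real (card J) - 1) * real (card (B k)) + 2"
    and u: "\<And>j. u j = (if j = k then real (card (B k)) + 1 else real (card (B k))) / D"
    and g: "\<And>j. j \<in> J \<Longrightarrow> measurable3 (I - B j) I (g j)"
    and h: "\<And>j. j \<in> J \<Longrightarrow> measurable3 I (I - B j) (h j)"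
  shows "mass I I (\<lambda>x y t. \<Prod>j\<in>J. pull1 I (B j) (g j) x y t powe u j * pull2 I (B j) (h j) x y t powe u j)
    \<le> C powe (1/D) * (\<Prod>j\<in>J. mass (I - B j) I (g j) powe u j * mass I (I - B j) (h j) powe u j)"
proof -
  define Bk where "Bk = B k"
  define I' where "I' = I - Bk"
  \<comment> \<open>The part of block \<open>k\<close> that the map of index \<open>j\<close> keeps:
    all of it for \<open>j \<noteq> k\<close>, nothing for \<open>j = k\<close>. This allows one
    formula for all fibre masses, the integral over \<open>E k\<close> being one over a single
    point.\<close>
  define E where "E j = Bk - B j" for j
  have "Bk \<subseteq> I" using BI[OF k] by (simp add: Bk_def)
  then have Bk: "finite Bk" "finite I'" "I = I' \<union> Bk" "I' \<inter> Bk = {}"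
    using I finite_subset[of Bk I] unfolding I'_def by blast+
  have E_k: "E k = {}" by (simp add: E_def Bk_def)
  have E: "E j = Bk" "B j \<subseteq> I'" if "j \<in> J" "j \<noteq> k" for j
  proof -
    have "Bk \<inter> B j = {}" using disj[OF that(1) k that(2)] by (simp add: Bk_def Int_commute)
    then show "E j = Bk" "B j \<subseteq> I'"
      using BI[OF that(1)] unfolding E_def I'_def by blast+
  qed
  have E_fin: "finite (E j)" for j using Bk(1) by (simp add: E_def)
  have IB: "I - B j = (I' - B j) \<union> E j" "(I' - B j) \<inter> E j = {}" for j
    using \<open>Bk \<subseteq> I\<close> unfolding E_def I'_def by blast+
  interpret I': sigma_finite_measure "lebP I'" by (rule sigma_finite_lebP[OF Bk(2)])
  interpret Bk: sigma_finite_measure "lebP Bk" by (rule sigma_finite_lebP[OF Bk(1)])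
  have sfE: "sigma_finite_measure (lebP (E j))" for j by (rule sigma_finite_lebP[OF E_fin])
  have pull_meas: "measurable3 I I (pull1 I (B j) (g j))" "measurable3 I I (pull2 I (B j) (h j))" if "j \<in> J" for j
    using that by (auto intro!: measurable_pull1 measurable_pull2 g h BI)
  define N where "N = real (card J)"
  define d where "d = real (card Bk)"
  have N: "1 \<le> N" using J k card_gt_0_iff[of J] by (auto simp: N_def)
  have D_pos: "0 < D" "D = (2 * N - 1) * d + 2"
    using N by (simp_all add: D N_def d_def Bk_def add_nonneg_pos)
  have u_pos: "0 \<le> u j" for j using D_pos by (simp add: u)
  have u_k: "u k = (d + 1) / D"
    by (simp add: u d_def Bk_def)
  have u_j: "u j = d / D" if "j \<noteq> k" for j
    using that by (simp add: u d_def Bk_def)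
  define G where "G j x y = (\<integral>\<^sup>+\<xi>. \<integral>\<^sup>+\<eta>. \<integral>\<^sup>+t. g j (merge (I' - B j) (E j) (x, \<xi>)) (merge I' Bk (y, \<eta>)) t \<partial>lborel \<partial>lebP Bk \<partial>lebP (E j))" for j x y
  define H where "H j x y = (\<integral>\<^sup>+\<xi>. \<integral>\<^sup>+\<eta>. \<integral>\<^sup>+t. h j (merge I' Bk (x, \<xi>)) (merge (I' - B j) (E j) (y, \<eta>)) t \<partial>lborel \<partial>lebP (E j) \<partial>lebP Bk)" for j x y
  have G_meas: "(\<lambda>(x, y). G j x y) \<in> borel_measurable (lebP (I' - B j) \<Otimes>\<^sub>M lebP I')"
    and H_meas: "(\<lambda>(x, y). H j x y) \<in> borel_measurable (lebP I' \<Otimes>\<^sub>M lebP (I' - B j))" if "j \<in> J" for j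
  proof -
    interpret E: sigma_finite_measure "lebP (E j)" by (rule sfE)
    note measurable_compose3[OF g[OF that], measurable (raw)]
    note measurable_compose3[OF h[OF that], measurable (raw)]
    note merge_measurable[OF _ _ Bk(3), measurable (raw)]
    note merge_measurable[OF _ _ IB(1)[of j], measurable (raw)]
    show "(\<lambda>(x, y). G j x y) \<in> borel_measurable (lebP (I' - B j) \<Otimes>\<^sub>M lebP I')"
      unfolding G_def by measurable
    show "(\<lambda>(x, y). H j x y) \<in> borel_measurable (lebP I' \<Otimes>\<^sub>M lebP (I' - B j))"
      unfolding H_def by measurable
  qed
  have G_int: "(\<integral>\<^sup>+x. \<integral>\<^sup>+y. G j x y \<partial>lebP I' \<partial>lebP (I' - B j)) = mass (I - B j) I (g j)" if "j \<in> J" for j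
    unfolding G_def mass_def using I g[OF that]
    by (subst nn_integral_fold[OF IB(1,2)[of j] _ Bk(3,4)]) auto
  have H_int: "(\<integral>\<^sup>+x. \<integral>\<^sup>+y. H j x y \<partial>lebP (I' - B j) \<partial>lebP I') = mass I (I - B j) (h j)" if "j \<in> J" for j
    unfolding H_def mass_def using I h[OF that]
    by (subst nn_integral_fold[OF Bk(3,4) _ IB(1,2)[of j]]) auto
  define \<Psi> where "\<Psi> x y t = (\<Prod>j\<in>J. pull1 I (B j) (g j) x y t powe u j * pull2 I (B j) (h j) x y t powe u j)" for x y t
  have \<Psi>_meas: "measurable3 I I \<Psi>"
    using pull_meas unfolding \<Psi>_def case_prod_unfold
    by (intro borel_measurable_prod_ennreal borel_measurable_times_ennreal measurable_epow) auto
  have fibre: "(\<integral>\<^sup>+\<xi>. \<integral>\<^sup>+\<eta>. \<integral>\<^sup>+t. \<Psi> (merge I' Bk (x, \<xi>)) (merge I' Bk (y, \<eta>)) t \<partial>lborel \<partial>lebP Bk \<partial>lebP Bk)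
      \<le> C powe (1/D) * (\<Prod>j\<in>J. G j (restrict x (I' - B j)) y powe u j * H j x (restrict y (I' - B j)) powe u j)"
    if x [measurable]: "x \<in> space (lebP I')" and y [measurable]: "y \<in> space (lebP I')" for x y
  proof -
    define c where "c j = 1/2 * dotp (B j) x y" for j
    define P where "P j \<xi> \<eta> t = g j (merge (I' - B j) (E j) (restrict x (I' - B j), \<xi>)) (merge I' Bk (y, \<eta>)) t" for j \<xi> \<eta> t
    define Q where "Q j \<xi> \<eta> t = h j (merge I' Bk (x, \<xi>)) (merge (I' - B j) (E j) (restrict y (I' - B j), \<eta>)) t" for j \<xi> \<eta> t
    define F where "F \<eta> t = g k x (merge I' Bk (y, \<eta>)) t" for \<eta> t
    define F' where "F' \<xi> t = h k (merge I' Bk (x, \<xi>)) y t" for \<xi> t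
    have Ik: "I' - B k = I'" by (auto simp: I'_def Bk_def)
    have restr: "restrict x I' = x" "restrict y I' = y"
      using x y by (simp_all add: space_PiM PiE_restrict)
    have mass_P: "mass (E j) Bk (P j) = G j (restrict x (I' - B j)) y"
      and mass_Q: "mass Bk (E j) (Q j) = H j x (restrict y (I' - B j))" for j
      by (simp_all add: mass_def P_def Q_def G_def H_def)
    have PQ_meas: "measurable3 (E j) Bk (P j)" "measurable3 Bk (E j) (Q j)" if "j \<in> J" for j
    proof -
      note measurable_compose3[OF g[OF that], measurable (raw)]
      note measurable_compose3[OF h[OF that], measurable (raw)]
      note merge_measurable[OF _ _ Bk(3), measurable (raw)]
      note merge_measurable[OF _ _ IB(1)[of j], measurable (raw)]
      have [measurable]: "restrict x (I' - B j) \<in> space (lebP (I' - B j))" "restrict y (I' - B j) \<in> space (lebP (I' - B j))"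
        by (auto simp: space_PiM)
      show "measurable3 (E j) Bk (P j)" "measurable3 Bk (E j) (Q j)"
        unfolding P_def Q_def by measurable
    qed
    have P_k: "P k \<xi> \<eta> t = F \<eta> t" and Q_k: "Q k \<xi> \<eta> t = F' \<xi> t" for \<xi> \<eta> t
      using x y by (simp_all add: P_def Q_def F_def F'_def E_k Ik restr merge_empty_right)
    have F_meas: "(\<lambda>(\<eta>, t). F \<eta> t) \<in> borel_measurable (lebP Bk \<Otimes>\<^sub>M lborel)"
      and F'_meas: "(\<lambda>(\<xi>, t). F' \<xi> t) \<in> borel_measurable (lebP Bk \<Otimes>\<^sub>M lborel)"
    proof -
      have Ik': "I' = I - B k" by (simp add: I'_def Bk_def)
      note measurable_compose3[OF g[OF k, folded Ik'], measurable (raw)]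
      note measurable_compose3[OF h[OF k, folded Ik'], measurable (raw)]
      note merge_measurable[OF _ _ Bk(3), measurable (raw)]
      show "(\<lambda>(\<eta>, t). F \<eta> t) \<in> borel_measurable (lebP Bk \<Otimes>\<^sub>M lborel)"
        "(\<lambda>(\<xi>, t). F' \<xi> t) \<in> borel_measurable (lebP Bk \<Otimes>\<^sub>M lborel)"
        unfolding F_def F'_def by measurable
    qed
    have pull_k: "pull1 I (B k) (g k) (merge I' Bk (x, \<xi>)) (merge I' Bk (y, \<eta>)) t = F \<eta> (t + 1/2 * dotp Bk \<xi> \<eta>)"
        "pull2 I (B k) (h k) (merge I' Bk (x, \<xi>)) (merge I' Bk (y, \<eta>)) t = F' \<xi> (t - 1/2 * dotp Bk \<xi> \<eta>)" for \<xi> \<eta> t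
    proof -
      have "restrict (merge I' Bk (z, \<zeta>)) (I - Bk) = z" if "z \<in> space (lebP I')" for z \<zeta>
        using restrict_merge_split[of "I - Bk" I' "{}" I' Bk z \<zeta>] that merge_empty_right[of z I' \<zeta>] Bk(4)
        by (auto simp: I'_def)
      then show "pull1 I (B k) (g k) (merge I' Bk (x, \<xi>)) (merge I' Bk (y, \<eta>)) t = F \<eta> (t + 1/2 * dotp Bk \<xi> \<eta>)"
        "pull2 I (B k) (h k) (merge I' Bk (x, \<xi>)) (merge I' Bk (y, \<eta>)) t = F' \<xi> (t - 1/2 * dotp Bk \<xi> \<eta>)"
        using x y dotp_merge2[OF Bk(4)] by (simp_all add: pull1_def pull2_def F_def F'_def flip: Bk_def)
    qed
    have pull_j: "pull1 I (B j) (g j) (merge I' Bk (x, \<xi>)) (merge I' Bk (y, \<eta>)) t = P j \<xi> \<eta> (t + c j)"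
        "pull2 I (B j) (h j) (merge I' Bk (x, \<xi>)) (merge I' Bk (y, \<eta>)) t = Q j \<xi> \<eta> (t + - c j)"
      if "j \<in> J - {k}" for j \<xi> \<eta> t
    proof -
      have "restrict (merge I' Bk (z, \<zeta>)) (I - B j) = merge (I' - B j) (E j) (restrict z (I' - B j), \<zeta>)"
        for z \<zeta> :: "'i \<Rightarrow> real"
        unfolding merge_restrict using Bk(4) by (intro restrict_merge_split IB) (auto simp: E_def)
      then show "pull1 I (B j) (g j) (merge I' Bk (x, \<xi>)) (merge I' Bk (y, \<eta>)) t = P j \<xi> \<eta> (t + c j)"
        "pull2 I (B j) (h j) (merge I' Bk (x, \<xi>)) (merge I' Bk (y, \<eta>)) t = Q j \<xi> \<eta> (t + - c j)"
        using that dotp_merge1[of "B j" I'] E(2)[of j] by (simp_all add: pull1_def pull2_def P_def Q_def c_def)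
    qed
    have "(\<integral>\<^sup>+\<xi>. \<integral>\<^sup>+\<eta>. \<integral>\<^sup>+t. \<Psi> (merge I' Bk (x, \<xi>)) (merge I' Bk (y, \<eta>)) t \<partial>lborel \<partial>lebP Bk \<partial>lebP Bk)
      = (\<integral>\<^sup>+\<xi>. \<integral>\<^sup>+\<eta>. \<integral>\<^sup>+t. F \<eta> (t + 1/2 * dotp Bk \<xi> \<eta>) powe ((d + 1) / D) * F' \<xi> (t - 1/2 * dotp Bk \<xi> \<eta>) powe ((d + 1) / D)
       * (\<Prod>j\<in>J - {k}. P j \<xi> \<eta> (t + c j) powe (d / D) * Q j \<xi> \<eta> (t + - c j) powe (d / D)) \<partial>lborel \<partial>lebP Bk \<partial>lebP Bk)"
      unfolding \<Psi>_def prod.remove[OF J k] pull_k u_k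
      by (intro nn_integral_cong arg_cong2[where f="(*)"] prod.cong refl) (simp_all add: pull_j u_j)
    also have "\<dots> \<le> C powe (1/D) * (\<integral>\<^sup>+\<eta>. \<integral>\<^sup>+t. F \<eta> t \<partial>lborel \<partial>lebP Bk) powe ((d + 1) / D)
       * (\<integral>\<^sup>+\<xi>. \<integral>\<^sup>+t. F' \<xi> t \<partial>lborel \<partial>lebP Bk) powe ((d + 1) / D)
       * (\<Prod>j\<in>J - {k}. (\<integral>\<^sup>+\<xi>. \<integral>\<^sup>+\<eta>. \<integral>\<^sup>+t. P j \<xi> \<eta> (t + c j) \<partial>lborel \<partial>lebP Bk \<partial>lebP Bk) powe (d / D)
           * (\<integral>\<^sup>+\<xi>. \<integral>\<^sup>+\<eta>. \<integral>\<^sup>+t. Q j \<xi> \<eta> (t + - c j) \<partial>lborel \<partial>lebP Bk \<partial>lebP Bk) powe (d / D))"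
    proof -
      \<comment> \<open>The function \<open>P k\<close> depends on no coordinate of block
        \<open>k\<close> in its first argument and lives on \<open>E k\<close>, not on
        \<open>Bk\<close>. The placeholder 0 gives all indices the same domain and never enters the
        product over \<open>J - {k}\<close>.\<close>
      define P' where "P' j \<xi> \<eta> t = (if j = k then 0 else P j \<xi> \<eta> (t + c j))" for j \<xi> \<eta> t
      define Q' where "Q' j \<xi> \<eta> t = (if j = k then 0 else Q j \<xi> \<eta> (t + - c j))" for j \<xi> \<eta> t
      have "measurable3 Bk Bk (P' j) \<and> measurable3 Bk Bk (Q' j)" if "j \<in> J" for j
      proof (cases "j = k")
        case False
        with PQ_meas[OF that] E[OF that] have P: "measurable3 Bk Bk (P j)" and Q: "measurable3 Bk Bk (Q j)" by auto
        note measurable_compose3[OF P, measurable (raw)]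
        note measurable_compose3[OF Q, measurable (raw)]
        show ?thesis
          using False unfolding P'_def Q'_def by simp
      qed (simp_all add: P'_def Q'_def)
      then have P'_meas: "\<And>j. j \<in> J \<Longrightarrow> measurable3 Bk Bk (P' j)" and Q'_meas: "\<And>j. j \<in> J \<Longrightarrow> measurable3 Bk Bk (Q' j)"
        by blast+
      from vertex_fibre[where P=P' and Q=Q', OF Bk(1) C[folded Bk_def] F_meas F'_meas J k P'_meas Q'_meas D[folded Bk_def] refl refl]
      show ?thesis
        by (simp add: P'_def Q'_def d_def cong: prod.cong_simp)
    qed
    also have "(\<integral>\<^sup>+\<eta>. \<integral>\<^sup>+t. F \<eta> t \<partial>lborel \<partial>lebP Bk) = G k (restrict x (I' - B k)) y"
      by (simp add: mass_P[symmetric] mass_def P_k E_k nn_integral_lebP_empty emeasure_lebP_empty)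
    also have "(\<integral>\<^sup>+\<xi>. \<integral>\<^sup>+t. F' \<xi> t \<partial>lborel \<partial>lebP Bk) = H k x (restrict y (I' - B k))"
      by (simp add: mass_Q[symmetric] mass_def Q_k E_k nn_integral_lebP_empty emeasure_lebP_empty)
    also have "(\<Prod>j\<in>J - {k}. (\<integral>\<^sup>+\<xi>. \<integral>\<^sup>+\<eta>. \<integral>\<^sup>+t. P j \<xi> \<eta> (t + c j) \<partial>lborel \<partial>lebP Bk \<partial>lebP Bk) powe (d / D)
           * (\<integral>\<^sup>+\<xi>. \<integral>\<^sup>+\<eta>. \<integral>\<^sup>+t. Q j \<xi> \<eta> (t + - c j) \<partial>lborel \<partial>lebP Bk \<partial>lebP Bk) powe (d / D))
        = (\<Prod>j\<in>J - {k}. G j (restrict x (I' - B j)) y powe u j * H j x (restrict y (I' - B j)) powe u j)"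
    proof (rule prod.cong[OF refl])
      fix j assume j: "j \<in> J - {k}"
      then have P: "measurable3 Bk Bk (P j)" and Q: "measurable3 Bk Bk (Q j)"
        using PQ_meas[of j] E[of j] by auto
      show "(\<integral>\<^sup>+\<xi>. \<integral>\<^sup>+\<eta>. \<integral>\<^sup>+t. P j \<xi> \<eta> (t + c j) \<partial>lborel \<partial>lebP Bk \<partial>lebP Bk) powe (d / D)
           * (\<integral>\<^sup>+\<xi>. \<integral>\<^sup>+\<eta>. \<integral>\<^sup>+t. Q j \<xi> \<eta> (t + - c j) \<partial>lborel \<partial>lebP Bk \<partial>lebP Bk) powe (d / D)
        = G j (restrict x (I' - B j)) y powe u j * H j x (restrict y (I' - B j)) powe u j"
        using mass_shift[OF Bk(1) Bk(1) P, of "c j"] mass_shift[OF Bk(1) Bk(1) Q, of "- c j"]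
          mass_P[of j] mass_Q[of j] E[of j] j u_j[of j] by (simp add: mass_def)
    qed
    finally show ?thesis
      unfolding prod.remove[OF J k] u_k by (simp only: mult_ac)
  qed
  have "mass I I \<Psi> = (\<integral>\<^sup>+x. \<integral>\<^sup>+y. \<integral>\<^sup>+\<xi>. \<integral>\<^sup>+\<eta>. \<integral>\<^sup>+t. \<Psi> (merge I' Bk (x, \<xi>)) (merge I' Bk (y, \<eta>)) t
      \<partial>lborel \<partial>lebP Bk \<partial>lebP Bk \<partial>lebP I' \<partial>lebP I')"
    unfolding mass_def by (rule nn_integral_fold[OF Bk(3,4) I Bk(3,4) I \<Psi>_meas])
  also have "\<dots> \<le> (\<integral>\<^sup>+x. \<integral>\<^sup>+y. C powe (1/D) *
      (\<Prod>j\<in>J. G j (restrict x (I' - B j)) y powe u j * H j x (restrict y (I' - B j)) powe u j) \<partial>lebP I' \<partial>lebP I')"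
    by (intro nn_integral_mono fibre)
  also have "\<dots> = C powe (1/D) * (\<integral>\<^sup>+x. \<integral>\<^sup>+y.
      (\<Prod>j\<in>J. G j (restrict x (I' - B j)) y powe u j * H j x (restrict y (I' - B j)) powe u j) \<partial>lebP I' \<partial>lebP I')"
  proof -
    have "(\<lambda>w. G j (restrict (x w) (I' - B j)) (y w)) \<in> borel_measurable M"
      "(\<lambda>w. H j (x w) (restrict (y w) (I' - B j))) \<in> borel_measurable M"
      if "j \<in> J" "x \<in> measurable M (lebP I')" "y \<in> measurable M (lebP I')" for j x y and M :: "'z measure"
      using measurable_compose[OF measurable_Pair[OF restrict_measurable[OF that(2), of "I' - B j"] that(3)] G_meas[OF that(1)]]
        measurable_compose[OF measurable_Pair[OF that(2) restrict_measurable[OF that(3), of "I' - B j"]] H_meas[OF that(1)]]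
      by auto
    note this [measurable (raw)]
    have "(\<lambda>(x, y). \<Prod>j\<in>J. G j (restrict x (I' - B j)) y powe u j * H j x (restrict y (I' - B j)) powe u j)
        \<in> borel_measurable (lebP I' \<Otimes>\<^sub>M lebP I')"
      by measurable
    then show ?thesis
      by (rule nn_integral_cmult2[OF I'.sigma_finite_measure_axioms])
  qed
  also have "\<dots> \<le> C powe (1/D) * (\<Prod>j\<in>J. (\<integral>\<^sup>+x. \<integral>\<^sup>+y. G j x y \<partial>lebP I' \<partial>lebP (I' - B j)) powe u j
      * (\<integral>\<^sup>+x. \<integral>\<^sup>+y. H j x y \<partial>lebP (I' - B j) \<partial>lebP I') powe u j)"
  proof (intro mult_left_mono loomis_whitney_pairs Bk(2) J u_pos G_meas H_meas)
    \<comment> \<open>A frozen coordinate lies in exactly one block \<open>B j0\<close>, with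
      \<open>j0 \<noteq> k\<close>, so the weights of the functions seeing it add up to (2 (N d + 1)
      - d) / D = 1. The same \<open>D\<close> thus serves the fibre and the base.\<close>
    fix i assume i: "i \<in> I'"
    then obtain j0 where j0: "j0 \<in> J" "i \<in> B j0" "j0 \<noteq> k"
      using cover[of i] by (auto simp: I'_def Bk_def)
    then have "{j \<in> J. i \<notin> B j} = J - {j0}"
      using disj[of _ j0] by blast
    then have "(\<Sum>j\<in>{j\<in>J. i \<notin> B j}. u j) = (\<Sum>j\<in>J. u j) - u j0"
      using j0 J by (simp add: sum_diff1)
    moreover have "(\<Sum>j\<in>J. u j) = (N * d + 1) / D"
    proof -
      have "(\<Sum>j\<in>J. u j) = u k + (\<Sum>j\<in>J - {k}. d / D)"
        unfolding sum.remove[OF J k] by (intro arg_cong2[where f="(+)"] sum.cong) (auto simp: u_j)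
      also have "(\<Sum>j\<in>J - {k}. d / D) = (N - 1) * (d / D)"
        using J k N by (simp add: N_def of_nat_diff card_gt_0_iff Suc_le_eq)
      also have "u k + (N - 1) * (d / D) = (d + 1 + (N - 1) * d) / D"
        by (simp add: u_k add_divide_distrib)
      also have "d + 1 + (N - 1) * d = N * d + 1"
        by (simp add: algebra_simps)
      finally show ?thesis .
    qed
    moreover have "(N * d + 1) / D + ((N * d + 1) / D - d / D) = ((N * d + 1) + (N * d + 1) - d) / D"
      by (simp add: add_divide_distrib diff_divide_distrib)
    moreover have "(N * d + 1) + (N * d + 1) - d = D"
      unfolding D_pos(2) by (simp add: algebra_simps)
    ultimately show "(\<Sum>j\<in>J. u j) + (\<Sum>j\<in>{j\<in>J. i \<notin> B j}. u j) = 1"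
      using D_pos(1) u_j[OF j0(3)] by simp
  qed auto
  also have "\<dots> = C powe (1/D) * (\<Prod>j\<in>J. mass (I - B j) I (g j) powe u j * mass I (I - B j) (h j) powe u j)"
    by (simp add: G_int H_int cong: prod.cong)
  finally show ?thesis unfolding \<Psi>_def .
qed

section \<open>Interpolation between the vertices\<close>

text \<open>The multiplicative form of exchanging two sums: interpolating vertex estimates with
  weights \<open>l\<close> averages their exponents.\<close>

lemma prod_epow_exchange:
  fixes q :: "'j \<Rightarrow> ennreal"
  assumes "\<And>k. k \<in> K \<Longrightarrow> 0 \<le> l k" "\<And>k j. k \<in> K \<Longrightarrow> j \<in> J \<Longrightarrow> 0 \<le> U k j"
  shows "(\<Prod>k\<in>K. (\<Prod>j\<in>J. q j powe U k j) powe l k) = (\<Prod>j\<in>J. q j powe (\<Sum>k\<in>K. U k j * l k))"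
proof -
  have "(\<Prod>k\<in>K. (\<Prod>j\<in>J. q j powe U k j) powe l k) = (\<Prod>k\<in>K. \<Prod>j\<in>J. q j powe (U k j * l k))"
    using assms by (intro prod.cong) (simp_all add: epow_prod epow_epow)
  also have "\<dots> = (\<Prod>j\<in>J. \<Prod>k\<in>K. q j powe (U k j * l k))"
    by (rule prod.swap)
  also have "\<dots> = (\<Prod>j\<in>J. q j powe (\<Sum>k\<in>K. U k j * l k))"
    using assms by (intro prod.cong refl epow_sum[symmetric]) simp_all
  finally show ?thesis .
qed

lemma mass_eq_triple:
  assumes "finite A" "finite D" "measurable3 A D f"
  shows "mass A D f = (\<integral>\<^sup>+(x, y, t). f x y t \<partial>(lebP A \<Otimes>\<^sub>M lebP D \<Otimes>\<^sub>M lborel))"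
  unfolding mass_def using assms
  by (intro nn_integral_triple sigma_finite_lebP lborel.sigma_finite_measure_axioms)

text \<open>With \<open>l k = v k * D k\<close> the average of the vertex exponents
  \<open>U k j\<close> is the sum of all \<open>v k * d k\<close> plus \<open>v j\<close>, that is
  \<open>\<sigma> + v j = a j\<close>. Together with the exponents at empty blocks these weights sum
  to one, so a single use of Hoelder combines the vertex products and the functions at empty blocks,
  which are not projected at all.\<close>

theorem heisenberg_brascamp_lieb:
  fixes I :: "'i set" and J :: "'j set" and a b :: "'j \<Rightarrow> real"
  assumes I: "finite I" and J: "finite J"
    and BI: "\<And>j. j \<in> J \<Longrightarrow> B j \<subseteq> I"
    and disj: "\<And>i j. i \<in> J \<Longrightarrow> j \<in> J \<Longrightarrow> i \<noteq> j \<Longrightarrow> B i \<inter> B j = {}"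
    and cover: "\<And>i. i \<in> I \<Longrightarrow> \<exists>j\<in>J. i \<in> B j"
    and nonneg: "\<And>j. j \<in> J \<Longrightarrow> 0 \<le> a j" "\<And>j. j \<in> J \<Longrightarrow> 0 \<le> b j"
    and \<sigma>: "\<sigma> = (\<Sum>j\<in>J. a j + b j) - 1"
    and ab: "\<And>j. j \<in> J \<Longrightarrow> B j \<noteq> {} \<Longrightarrow> a j = b j"
    and a_ge: "\<And>j. j \<in> J \<Longrightarrow> B j \<noteq> {} \<Longrightarrow> \<sigma> \<le> a j"
    and scaling: "(\<Sum>j\<in>J. real (card (B j)) * a j) = (real (card I) + 1) * \<sigma>"
  shows "\<exists>C<\<infinity>. \<forall>g h. (\<forall>j\<in>J. measurable3 (I - B j) I (g j) \<and> measurable3 I (I - B j) (h j)) \<longrightarrow>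
    mass I I (\<lambda>x y t. \<Prod>j\<in>J. pull1 I (B j) (g j) x y t powe a j * pull2 I (B j) (h j) x y t powe b j)
      \<le> C * (\<Prod>j\<in>J. mass (I - B j) I (g j) powe a j * mass I (I - B j) (h j) powe b j)"
proof -
  define J1 where "J1 = {j\<in>J. B j \<noteq> {}}"
  define N where "N = real (card J1)"
  define d where "d j = real (card (B j))" for j
  define v where "v j = a j - \<sigma>" for j
  define D where "D k = (2 * N - 1) * d k + 2" for k
  define U where "U k j = (if j = k then d k + 1 else d k) / D k" for k j
  define l where "l k = v k * D k" for k
  have J1: "finite J1" "J1 \<subseteq> J" using J by (auto simp: J1_def)
  have fin_B: "finite (B j)" if "j \<in> J" for j
    using BI[OF that] I by (rule finite_subset)
  have D_pos: "0 < D k" if "k \<in> J1" for k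
  proof -
    have "1 \<le> N" using J1(1) that card_gt_0_iff[of J1] by (auto simp: N_def)
    then show ?thesis by (simp add: D_def d_def add_nonneg_pos)
  qed
  have U_nonneg: "0 \<le> U k j" if "k \<in> J1" for k j
    using D_pos[OF that] by (simp add: U_def d_def)
  have v_nonneg: "0 \<le> v k" if "k \<in> J1" for k
    using that a_ge by (simp add: v_def J1_def)
  have l_nonneg: "0 \<le> l k" if "k \<in> J1" for k
    using v_nonneg[OF that] D_pos[OF that] by (simp add: l_def)
  have sum_d: "(\<Sum>j\<in>J1. d j) = real (card I)"
  proof -
    have "I = (\<Union>j\<in>J1. B j)"
      using cover BI by (fastforce simp: J1_def)
    then have "card I = (\<Sum>j\<in>J1. card (B j))"
      using J1 fin_B disj by (simp, subst card_UN_disjoint) (auto simp: J1_def)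
    then show ?thesis by (simp add: d_def)
  qed
  have "(\<Sum>j\<in>J1. d j * a j) = (\<Sum>j\<in>J. d j * a j)"
    using J by (intro sum.mono_neutral_left) (auto simp: J1_def d_def)
  then have "(\<Sum>j\<in>J1. d j * a j) = (real (card I) + 1) * \<sigma>"
    using scaling by (simp add: d_def)
  moreover have "(\<Sum>j\<in>J1. v j * d j) = (\<Sum>j\<in>J1. d j * a j) - \<sigma> * (\<Sum>j\<in>J1. d j)"
    by (simp add: v_def algebra_simps sum_subtractf sum_distrib_left)
  \<comment> \<open>This is where the scaling identity enters: (n+1) \<sigma> - n \<sigma> =
    \<sigma>, since the blocks exhaust the n coordinates.\<close>
  ultimately have sum_vd: "(\<Sum>j\<in>J1. v j * d j) = \<sigma>"
    using sum_d by (simp add: algebra_simps)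
  have sum_Ul: "(\<Sum>k\<in>J1. U k j * l k) = a j" if "j \<in> J1" for j
  proof -
    have "(\<Sum>k\<in>J1. U k j * l k) = (\<Sum>k\<in>J1. v k * d k + (if k = j then v j else 0))"
    proof (rule sum.cong[OF refl])
      fix k assume "k \<in> J1"
      then have "D k \<noteq> 0" using D_pos by fastforce
      then show "U k j * l k = v k * d k + (if k = j then v j else 0)"
        by (simp add: U_def l_def algebra_simps)
    qed
    also have "\<dots> = \<sigma> + v j"
      using J1 that by (simp add: sum.distrib sum_vd)
    finally show ?thesis by (simp add: v_def)
  qed
  have sum_weights: "(\<Sum>j\<in>J - J1. a j + b j) + (\<Sum>k\<in>J1. l k) = 1"
  proof -
    have "(\<Sum>k\<in>J1. l k) = (\<Sum>k\<in>J1. (2 * N - 1) * (v k * d k) + 2 * v k)"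
      by (intro sum.cong) (auto simp: l_def D_def algebra_simps)
    also have "\<dots> = (2 * N - 1) * \<sigma> + 2 * (\<Sum>k\<in>J1. v k)"
      by (simp add: sum.distrib sum_distrib_left[symmetric] sum_vd)
    also have "(\<Sum>k\<in>J1. v k) = (\<Sum>k\<in>J1. a k) - N * \<sigma>"
      by (simp add: v_def sum_subtractf N_def)
    finally have "(\<Sum>k\<in>J1. l k) = 2 * (\<Sum>k\<in>J1. a k) - \<sigma>"
      by (simp add: algebra_simps)
    moreover have "(\<Sum>j\<in>J. a j + b j) = (\<Sum>j\<in>J - J1. a j + b j) + (\<Sum>j\<in>J1. a j + b j)"
      using J J1 by (intro sum.subset_diff) auto
    moreover have "(\<Sum>j\<in>J1. a j + b j) = 2 * (\<Sum>j\<in>J1. a j)"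
      using ab by (simp add: sum_distrib_left J1_def cong: sum.cong_simp)
    ultimately show ?thesis using \<sigma> by simp
  qed
  obtain R where R: "\<And>k. k \<in> J1 \<Longrightarrow> R k < \<infinity> \<and> radon_bound (B k) (R k)"
    using radon_bound_exists[OF fin_B] J1(2) by (metis subsetD)
  define C where "C = (\<Prod>k\<in>J1. (R k powe (1 / D k)) powe l k)"
  have "C < \<infinity>"
    unfolding C_def using R by (auto simp: less_top[symmetric] ennreal_prod_eq_top epow_eq_top)
  moreover have "mass I I (\<lambda>x y t. \<Prod>j\<in>J. pull1 I (B j) (g j) x y t powe a j * pull2 I (B j) (h j) x y t powe b j)
      \<le> C * (\<Prod>j\<in>J. mass (I - B j) I (g j) powe a j * mass I (I - B j) (h j) powe b j)"
    if gh: "\<And>j. j \<in> J \<Longrightarrow> measurable3 (I - B j) I (g j)" "\<And>j. j \<in> J \<Longrightarrow> measurable3 I (I - B j) (h j)" for g h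
  proof -
    define M where "M = lebP I \<Otimes>\<^sub>M lebP I \<Otimes>\<^sub>M (lborel :: real measure)"
    define p1 where "p1 j = (\<lambda>(x, y, t). pull1 I (B j) (g j) x y t)" for j
    define p2 where "p2 j = (\<lambda>(x, y, t). pull2 I (B j) (h j) x y t)" for j
    define V where "V k w = (\<Prod>j\<in>J1. p1 j w powe U k j * p2 j w powe U k j)" for k w
    have p_meas [measurable]: "p1 j \<in> borel_measurable M" "p2 j \<in> borel_measurable M" if "j \<in> J" for j
      unfolding p1_def p2_def M_def
      by (rule measurable_pull1[OF gh(1)[OF that] BI[OF that]], rule measurable_pull2[OF gh(2)[OF that] BI[OF that]])
    have V_meas [measurable]: "V k \<in> borel_measurable M" for k
      unfolding V_def using J1(2) p_meas
      by (intro borel_measurable_prod_ennreal borel_measurable_times_ennreal measurable_epow) auto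
    \<comment> \<open>A nonempty block contributes its whole vertex product under the flag
      \<open>True\<close> and the constant 1 with weight 0 under \<open>False\<close>; an empty
      block contributes its two functions with their own exponents.\<close>
    define f where "f p = (if fst p \<in> J1 then (if snd p then V (fst p) else (\<lambda>_. 1))
        else if snd p then p1 (fst p) else p2 (fst p))" for p :: "'j \<times> bool"
    define c where "c p = (if fst p \<in> J1 then (if snd p then l (fst p) else 0)
        else if snd p then a (fst p) else b (fst p))" for p :: "'j \<times> bool"
    have split: "(\<Prod>j\<in>J. X j) = (\<Prod>j\<in>J - J1. X j) * (\<Prod>j\<in>J1. X j)" for X :: "'j \<Rightarrow> ennreal"
      using J J1 by (intro prod.subset_diff) auto
    have vertex_prod: "(\<Prod>k\<in>J1. (\<Prod>j\<in>J1. q1 j powe U k j * q2 j powe U k j) powe l k)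
        = (\<Prod>j\<in>J1. q1 j powe a j * q2 j powe b j)" for q1 q2 :: "'j \<Rightarrow> ennreal"
    proof -
      have "(\<Prod>k\<in>J1. (\<Prod>j\<in>J1. q1 j powe U k j * q2 j powe U k j) powe l k)
          = (\<Prod>k\<in>J1. (\<Prod>j\<in>J1. (q1 j * q2 j) powe U k j) powe l k)"
        by (intro prod.cong refl arg_cong2[where f="(powe)"]) (simp add: epow_mult U_nonneg)
      also have "\<dots> = (\<Prod>j\<in>J1. (q1 j * q2 j) powe (\<Sum>k\<in>J1. U k j * l k))"
        by (intro prod_epow_exchange l_nonneg U_nonneg)
      also have "\<dots> = (\<Prod>j\<in>J1. q1 j powe a j * q2 j powe b j)"
      proof (intro prod.cong refl)
        fix j assume j: "j \<in> J1"
        then have "0 \<le> a j" "a j = b j" using nonneg ab by (auto simp: J1_def)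
        then show "(q1 j * q2 j) powe (\<Sum>k\<in>J1. U k j * l k) = q1 j powe a j * q2 j powe b j"
          using j by (simp add: sum_Ul epow_mult)
      qed
      finally show ?thesis .
    qed
    have integrand: "(\<Prod>j\<in>J. p1 j w powe a j * p2 j w powe b j) = (\<Prod>p\<in>J \<times> UNIV. f p w powe c p)" for w
      unfolding prod_bool_pairs[OF J] split V_def[symmetric]
      using vertex_prod[of "\<lambda>j. p1 j w" "\<lambda>j. p2 j w"]
      by (simp add: f_def c_def V_def cong: prod.cong_simp)
    have "measurable3 I I (\<lambda>x y t. \<Prod>j\<in>J. pull1 I (B j) (g j) x y t powe a j * pull2 I (B j) (h j) x y t powe b j)"
      using p_meas unfolding p1_def p2_def M_def case_prod_unfold
      by (intro borel_measurable_prod_ennreal borel_measurable_times_ennreal measurable_epow) auto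
    then have "mass I I (\<lambda>x y t. \<Prod>j\<in>J. pull1 I (B j) (g j) x y t powe a j * pull2 I (B j) (h j) x y t powe b j)
        = (\<integral>\<^sup>+w. (\<Prod>j\<in>J. p1 j w powe a j * p2 j w powe b j) \<partial>M)"
      using I by (subst mass_eq_triple) (simp_all add: M_def p1_def p2_def case_prod_unfold)
    also have "\<dots> \<le> (\<Prod>p\<in>J \<times> UNIV. (\<integral>\<^sup>+w. f p w \<partial>M) powe c p)"
      unfolding integrand
    proof (rule nn_integral_Holder)
      have "(\<Sum>p\<in>J \<times> UNIV. c p) = (\<Sum>j\<in>J. c (j, True) + c (j, False))"
        using sum.cartesian_product[of "\<lambda>j b. c (j, b)" UNIV J] by (simp add: UNIV_bool add.commute)
      also have "\<dots> = (\<Sum>j\<in>J - J1. c (j, True) + c (j, False)) + (\<Sum>j\<in>J1. c (j, True) + c (j, False))"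
        using J J1 by (intro sum.subset_diff) auto
      also have "\<dots> = 1"
        using sum_weights by (simp add: c_def cong: sum.cong_simp)
      finally show "(\<Sum>p\<in>J \<times> UNIV. c p) = 1" .
    qed (use J p_meas nonneg l_nonneg in \<open>auto simp: c_def f_def\<close>)
    also have "\<dots> = (\<Prod>j\<in>J - J1. (\<integral>\<^sup>+w. p1 j w \<partial>M) powe a j * (\<integral>\<^sup>+w. p2 j w \<partial>M) powe b j)
        * (\<Prod>k\<in>J1. (\<integral>\<^sup>+w. V k w \<partial>M) powe l k)"
      unfolding prod_bool_pairs[OF J] split by (simp add: f_def c_def cong: prod.cong_simp)
    also have "\<dots> \<le> (\<Prod>j\<in>J - J1. mass (I - B j) I (g j) powe a j * mass I (I - B j) (h j) powe b j)
        * (\<Prod>k\<in>J1. (R k powe (1 / D k) *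
            (\<Prod>j\<in>J1. mass (I - B j) I (g j) powe U k j * mass I (I - B j) (h j) powe U k j)) powe l k)"
    proof (intro mult_mono prod_mono_ennreal)
      fix j assume j: "j \<in> J - J1"
      then have Bj: "B j = {}" and "j \<in> J" by (auto simp: J1_def)
      have "(\<integral>\<^sup>+w. p1 j w \<partial>M) = mass I I (pull1 I (B j) (g j))" "(\<integral>\<^sup>+w. p2 j w \<partial>M) = mass I I (pull2 I (B j) (h j))"
        unfolding p1_def p2_def M_def using gh \<open>j \<in> J\<close> BI
        by (intro mass_eq_triple[symmetric] I measurable_pull1 measurable_pull2; blast)+
      moreover have "restrict x I = x" if "x \<in> space (lebP I)" for x :: "'i \<Rightarrow> real"
        using that by (simp add: space_PiM PiE_restrict)
      then have "mass I I (pull1 I (B j) (g j)) = mass (I - B j) I (g j)" "mass I I (pull2 I (B j) (h j)) = mass I (I - B j) (h j)"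
        unfolding mass_def pull1_def pull2_def Bj Diff_empty by (simp_all add: dotp_def cong: nn_integral_cong)
      ultimately show "(\<integral>\<^sup>+w. p1 j w \<partial>M) powe a j \<le> mass (I - B j) I (g j) powe a j"
        "(\<integral>\<^sup>+w. p2 j w \<partial>M) powe b j \<le> mass I (I - B j) (h j) powe b j"
        by simp_all
    next
      fix k assume k: "k \<in> J1"
      have "(\<integral>\<^sup>+w. V k w \<partial>M) = mass I I (\<lambda>x y t. \<Prod>j\<in>J1. pull1 I (B j) (g j) x y t powe U k j * pull2 I (B j) (h j) x y t powe U k j)"
        using V_meas[of k] I unfolding V_def M_def p1_def p2_def
        by (subst mass_eq_triple) (simp_all add: case_prod_unfold)
      also have "\<dots> \<le> R k powe (1 / D k) *
            (\<Prod>j\<in>J1. mass (I - B j) I (g j) powe U k j * mass I (I - B j) (h j) powe U k j)"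
      proof (rule vertex_inequality[OF I J1(1) k])
        show "\<And>i. i \<in> I \<Longrightarrow> \<exists>j\<in>J1. i \<in> B j" using cover unfolding J1_def by blast
        show "D k = (2 * real (card J1) - 1) * real (card (B k)) + 2" by (simp add: D_def N_def d_def)
      qed (use R[OF k] BI disj gh in \<open>auto simp: J1_def U_def d_def\<close>)
      finally show "(\<integral>\<^sup>+w. V k w \<partial>M) powe l k \<le> (R k powe (1 / D k) *
            (\<Prod>j\<in>J1. mass (I - B j) I (g j) powe U k j * mass I (I - B j) (h j) powe U k j)) powe l k"
        using l_nonneg[OF k] by (rule epow_mono[rotated])
    qed auto
    also have "(\<Prod>k\<in>J1. (R k powe (1 / D k) *
            (\<Prod>j\<in>J1. mass (I - B j) I (g j) powe U k j * mass I (I - B j) (h j) powe U k j)) powe l k)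
        = C * (\<Prod>j\<in>J1. mass (I - B j) I (g j) powe a j * mass I (I - B j) (h j) powe b j)"
    proof -
      have "(\<Prod>k\<in>J1. (R k powe (1 / D k) * X k) powe l k) = C * (\<Prod>k\<in>J1. X k powe l k)" for X
        unfolding C_def prod.distrib[symmetric] by (intro prod.cong refl epow_mult l_nonneg)
      then show ?thesis unfolding vertex_prod[symmetric] .
    qed
    finally show ?thesis
      unfolding split by (simp only: mult_ac)
  qed
  ultimately show ?thesis by blast
qed

section \<open>The exponent conditions\<close>

lemma card_partition_inter:
  assumes "finite J" "finite I"
    and disj: "\<And>i j. i \<in> J \<Longrightarrow> j \<in> J \<Longrightarrow> i \<noteq> j \<Longrightarrow> B i \<inter> B j = {}"
    and cover: "\<And>i. i \<in> I \<Longrightarrow> \<exists>j\<in>J. i \<in> B j"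
    and "S \<subseteq> I"
  shows "real (card S) = (\<Sum>j\<in>J. real (card (S \<inter> B j)))"
proof -
  have "finite S" using assms(2,5) by (rule finite_subset[rotated])
  have "S = (\<Union>j\<in>J. S \<inter> B j)" using cover assms(5) by blast
  then have "card S = card (\<Union>j\<in>J. S \<inter> B j)" by simp
  also have "\<dots> = (\<Sum>j\<in>J. card (S \<inter> B j))"
    using assms(1) \<open>finite S\<close> disj by (intro card_UN_disjoint) blast+
  finally show ?thesis by simp
qed

text \<open>The two kinds of sums equal (|S|+1)(1+\<sigma>) minus the sum of |S \<inter> B_j| a_j,
  or b_j. So (B1) and (B2) bound these sums by (|S|+1) \<sigma>, and (A) is equality at
  \<open>S = I\<close>. Condition (C) at a single basis vector gives \<open>a j = b j\<close>.
  Conversely, adding \<sigma> \<le> a_j over the complement of \<open>S\<close> and subtracting from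
  (A) recovers (B1).\<close>

lemma exponent_conditions_iff:
  fixes a b :: "'j \<Rightarrow> real"
  assumes I: "finite I" and J: "finite J"
    and BI: "\<And>j. j \<in> J \<Longrightarrow> B j \<subseteq> I"
    and disj: "\<And>i j. i \<in> J \<Longrightarrow> j \<in> J \<Longrightarrow> i \<noteq> j \<Longrightarrow> B i \<inter> B j = {}"
    and cover: "\<And>i. i \<in> I \<Longrightarrow> \<exists>j\<in>J. i \<in> B j"
    and \<sigma>: "\<sigma> = (\<Sum>j\<in>J. a j + b j) - 1"
    and n: "n = real (card I)"
  shows "(n + 1 = (\<Sum>j\<in>J. (n - real (card (B j)) + 1) * a j + (n + 1) * b j) \<and>
      n + 1 = (\<Sum>j\<in>J. (n + 1) * a j + (n - real (card (B j)) + 1) * b j) \<and>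
      (\<forall>S\<subseteq>I. real (card S) + 1 \<le> (\<Sum>j\<in>J. (real (card S) - real (card (S \<inter> B j)) + 1) * a j + (real (card S) + 1) * b j) \<and>
          real (card S) + 1 \<le> (\<Sum>j\<in>J. (real (card S) + 1) * a j + (real (card S) - real (card (S \<inter> B j)) + 1) * b j) \<and>
          (\<Sum>j\<in>J. real (card (S \<inter> B j)) * (a j - b j)) = 0))
    \<longleftrightarrow> ((\<forall>j\<in>J. B j \<noteq> {} \<longrightarrow> a j = b j \<and> \<sigma> \<le> a j) \<and> (\<Sum>j\<in>J. real (card (B j)) * a j) = (n + 1) * \<sigma>)"
    (is "?L \<longleftrightarrow> ?R")
proof -
  have fin_B: "finite (B j)" if "j \<in> J" for j
    using BI[OF that] I by (rule finite_subset)
  have sum1: "(\<Sum>j\<in>J. (c - e j + 1) * a j + (c + 1) * b j) = (c + 1) * (1 + \<sigma>) - (\<Sum>j\<in>J. e j * a j)"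
    and sum2: "(\<Sum>j\<in>J. (c + 1) * a j + (c - e j + 1) * b j) = (c + 1) * (1 + \<sigma>) - (\<Sum>j\<in>J. e j * b j)" for c e
  proof -
    have "(\<Sum>j\<in>J. (c - e j + 1) * a j + (c + 1) * b j) = (\<Sum>j\<in>J. (c + 1) * (a j + b j) - e j * a j)"
      "(\<Sum>j\<in>J. (c + 1) * a j + (c - e j + 1) * b j) = (\<Sum>j\<in>J. (c + 1) * (a j + b j) - e j * b j)"
      by (intro sum.cong; simp add: algebra_simps)+
    then show "(\<Sum>j\<in>J. (c - e j + 1) * a j + (c + 1) * b j) = (c + 1) * (1 + \<sigma>) - (\<Sum>j\<in>J. e j * a j)"
      "(\<Sum>j\<in>J. (c + 1) * a j + (c - e j + 1) * b j) = (c + 1) * (1 + \<sigma>) - (\<Sum>j\<in>J. e j * b j)"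
      by (simp_all add: sum_subtractf sum_distrib_left[symmetric] \<sigma>)
  qed
  have I_inter: "I \<inter> B j = B j" if "j \<in> J" for j using BI[OF that] by blast
  show ?thesis
  proof
    assume L: ?L
    have scal: "(\<Sum>j\<in>J. real (card (B j)) * a j) = (n + 1) * \<sigma>"
      using conjunct1[OF L, unfolded sum1] by (simp add: distrib_left)
    have "a j = b j \<and> \<sigma> \<le> a j" if j: "j \<in> J" "B j \<noteq> {}" for j
    proof -
      obtain e where e: "e \<in> B j" using j by blast
      have "e \<in> I" using BI j e by blast
      have B_e: "{e} \<inter> B i = (if i = j then {e} else {})" if "i \<in> J" for i
        using disj[OF that j(1)] e by auto
      have "(\<Sum>i\<in>J. real (card ({e} \<inter> B i)) * (a i - b i)) = 0"
        using L \<open>e \<in> I\<close> by blast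
      also have "(\<Sum>i\<in>J. real (card ({e} \<inter> B i)) * (a i - b i)) = (\<Sum>i\<in>J. if i = j then a j - b j else 0)"
        by (intro sum.cong) (auto simp: B_e)
      also have "\<dots> = a j - b j" using J j by simp
      finally have "a j = b j" by simp
      \<comment> \<open>Leaving out one vector of block \<open>j\<close>: the difference between (A)
        and (B1) at this set is exactly \<open>\<sigma> \<le> a j\<close>.\<close>
      define S where "S = I - {e}"
      have S: "real (card S) = n - 1" "S \<subseteq> I"
        using I \<open>e \<in> I\<close> card_gt_0_iff[of I] by (auto simp: S_def n of_nat_diff Suc_le_eq)
      have card_S: "real (card (S \<inter> B i)) = real (card (B i)) - (if i = j then 1 else 0)" if "i \<in> J" for i
      proof -
        have "S \<inter> B i = B i - ({e} \<inter> B i)" using BI[OF that] by (auto simp: S_def)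
        then have "card (S \<inter> B i) = card (B i) - card ({e} \<inter> B i)"
          using fin_B[OF that] by (simp add: card_Diff_subset)
        then show ?thesis
          using B_e[OF that] e fin_B[OF j(1)] card_gt_0_iff[of "B j"] by (auto simp: of_nat_diff Suc_le_eq)
      qed
      have "real (card S) + 1 \<le> (\<Sum>j\<in>J. (real (card S) - real (card (S \<inter> B j)) + 1) * a j + (real (card S) + 1) * b j)"
        using L S(2) by blast
      also have "\<dots> = n * (1 + \<sigma>) - (\<Sum>i\<in>J. real (card (S \<inter> B i)) * a i)"
        unfolding sum1 S by simp
      also have "(\<Sum>i\<in>J. real (card (S \<inter> B i)) * a i) = (\<Sum>i\<in>J. real (card (B i)) * a i - (if i = j then a j else 0))"
        by (intro sum.cong) (auto simp: card_S algebra_simps)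
      also have "\<dots> = (n + 1) * \<sigma> - a j"
        using J j by (simp add: sum_subtractf scal)
      finally have "\<sigma> \<le> a j" unfolding S by (simp add: algebra_simps)
      with \<open>a j = b j\<close> show ?thesis by simp
    qed
    with scal show ?R by blast
  next
    assume R: ?R
    have card_ab: "real (card (S \<inter> B j)) * a j = real (card (S \<inter> B j)) * b j" if "j \<in> J" for S j
      using R that by (cases "B j = {}") auto
    have B_ab: "real (card (B j)) * a j = real (card (B j)) * b j" if "j \<in> J" for j
      using R that by (cases "B j = {}") auto
    have scal: "(\<Sum>j\<in>J. real (card (B j)) * a j) = (n + 1) * \<sigma>" "(\<Sum>j\<in>J. real (card (B j)) * b j) = (n + 1) * \<sigma>"
    proof -
      have "(\<Sum>j\<in>J. real (card (B j)) * b j) = (\<Sum>j\<in>J. real (card (B j)) * a j)"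
        by (intro sum.cong refl B_ab[symmetric])
      then show "(\<Sum>j\<in>J. real (card (B j)) * a j) = (n + 1) * \<sigma>" "(\<Sum>j\<in>J. real (card (B j)) * b j) = (n + 1) * \<sigma>"
        using R by simp_all
    qed
    have bound: "(\<Sum>j\<in>J. real (card (S \<inter> B j)) * a j) \<le> (real (card S) + 1) * \<sigma>" if S: "S \<subseteq> I" for S
    proof -
      have card_diff: "real (card (S \<inter> B j)) = real (card (B j)) - real (card ((I - S) \<inter> B j))" if "j \<in> J" for j
      proof -
        have "B j = (S \<inter> B j) \<union> ((I - S) \<inter> B j)" using BI[OF that] by blast
        then have "card (B j) = card (S \<inter> B j) + card ((I - S) \<inter> B j)"
          using fin_B[OF that] by (subst card_Un_disjoint[symmetric]) auto
        then show ?thesis by simp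
      qed
      \<comment> \<open>The complement of \<open>S\<close> is counted block by block, so that
        \<open>\<sigma> \<le> a j\<close> is used only for blocks that it meets.\<close>
      have "(n - real (card S)) * \<sigma> = (\<Sum>j\<in>J. real (card ((I - S) \<inter> B j)) * \<sigma>)"
        using card_partition_inter[OF J I disj cover, of "I - S"] S I finite_subset[OF S I]
        by (simp add: n sum_distrib_right[symmetric] card_Diff_subset of_nat_diff card_mono)
      also have "\<dots> \<le> (\<Sum>j\<in>J. real (card ((I - S) \<inter> B j)) * a j)"
      proof (intro sum_mono)
        fix j assume "j \<in> J"
        then show "real (card ((I - S) \<inter> B j)) * \<sigma> \<le> real (card ((I - S) \<inter> B j)) * a j"
          using R by (cases "B j = {}") (auto intro!: mult_left_mono)
      qed
      also have "\<dots> = (n + 1) * \<sigma> - (\<Sum>j\<in>J. real (card (S \<inter> B j)) * a j)"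
        using scal(1) by (simp add: card_diff left_diff_distrib sum_subtractf cong: sum.cong)
      finally show ?thesis by (simp add: algebra_simps)
    qed
    have bound': "(\<Sum>j\<in>J. real (card (S \<inter> B j)) * b j) \<le> (real (card S) + 1) * \<sigma>" if S: "S \<subseteq> I" for S
    proof -
      have "(\<Sum>j\<in>J. real (card (S \<inter> B j)) * b j) = (\<Sum>j\<in>J. real (card (S \<inter> B j)) * a j)"
        by (intro sum.cong refl card_ab[symmetric])
      then show ?thesis using bound[OF S] by simp
    qed
    have diff: "(\<Sum>j\<in>J. real (card (S \<inter> B j)) * (a j - b j)) = 0" for S
      using card_ab by (intro sum.neutral) (auto simp: right_diff_distrib)
    show ?L
      unfolding sum1 sum2 using scal bound bound' diff by (auto simp: distrib_left)
  qed
qed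

text \<open>Three directions in the cone of admissible \<open>(\<alpha>, \<beta>, \<omega>)\<close>
  suffice. Those whose negative is admissible too turn the inequality into an equation.\<close>

lemma exponent_conditions_necessary:
  fixes a b :: "'j \<Rightarrow> real"
  assumes I: "finite I" and J: "finite J"
    and BI: "\<And>j. j \<in> J \<Longrightarrow> B j \<subseteq> I"
    and disj: "\<And>i j. i \<in> J \<Longrightarrow> j \<in> J \<Longrightarrow> i \<noteq> j \<Longrightarrow> B i \<inter> B j = {}"
    and cover: "\<And>i. i \<in> I \<Longrightarrow> \<exists>j\<in>J. i \<in> B j"
    and \<sigma>: "\<sigma> = (\<Sum>j\<in>J. a j + b j) - 1"
    and n: "n = real (card I)"
    and boxes: "\<And>\<alpha> \<beta> \<omega>. (\<And>i. i \<in> I \<Longrightarrow> \<alpha> i + \<beta> i \<le> \<omega>) \<Longrightarrow>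
      (\<Sum>i\<in>I. \<alpha> i) + (\<Sum>i\<in>I. \<beta> i) + \<omega> \<le> (\<Sum>j\<in>J. a j * ((\<Sum>i\<in>I - B j. \<alpha> i) + (\<Sum>i\<in>I. \<beta> i) + \<omega>)
        + b j * ((\<Sum>i\<in>I. \<alpha> i) + (\<Sum>i\<in>I - B j. \<beta> i) + (\<omega>::real)))"
  shows "(\<forall>j\<in>J. B j \<noteq> {} \<longrightarrow> a j = b j \<and> \<sigma> \<le> a j) \<and> (\<Sum>j\<in>J. real (card (B j)) * a j) = (n + 1) * \<sigma>"
proof -
  have fin_B: "finite (B j)" if "j \<in> J" for j
    using BI[OF that] I by (rule finite_subset)
  have main: "a j = b j \<and> \<sigma> \<le> a j" if j: "j \<in> J" "B j \<noteq> {}" for j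
  proof -
    obtain e where e: "e \<in> B j" using j by blast
    have eI: "e \<in> I" using BI j e by blast
    have mem: "e \<in> B i \<longleftrightarrow> i = j" if "i \<in> J" for i
      using disj[OF that j(1)] e by auto
    define \<delta> where "\<delta> s i = (if i = e then s else 0)" for s :: real and i
    have sum_I: "(\<Sum>i\<in>I. \<delta> s i) = s" for s using I eI by (simp add: \<delta>_def)
    have sum_B: "(\<Sum>i\<in>I - B k. \<delta> s i) = s - (if k = j then s else 0)" if "k \<in> J" for s k
      using I eI mem[OF that] by (simp add: \<delta>_def)
    \<comment> \<open>Stretching \<open>x\<close> and shrinking \<open>y\<close> along
      \<open>e\<close> by the same factor keeps the product; both signs of \<open>s\<close> are
      allowed.\<close>
    have "0 \<le> s * (b j - a j)" for s
    proof -
      have "(\<Sum>i\<in>I. \<delta> s i) + (\<Sum>i\<in>I. \<delta> (- s) i) + 0 \<le> (\<Sum>k\<in>J. a k * ((\<Sum>i\<in>I - B k. \<delta> s i) + (\<Sum>i\<in>I. \<delta> (-s) i) + 0)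
        + b k * ((\<Sum>i\<in>I. \<delta> s i) + (\<Sum>i\<in>I - B k. \<delta> (- s) i) + 0))"
        by (rule boxes) (simp add: \<delta>_def)
      also have "\<dots> = (\<Sum>k\<in>J. if k = j then s * (b j - a j) else 0)"
        by (intro sum.cong) (auto simp: sum_I sum_B algebra_simps)
      finally show ?thesis using J j by (simp add: sum_I)
    qed
    from this[of 1] this[of "-1"] have "a j = b j" by simp
    \<comment> \<open>A box thin in the direction \<open>e\<close> of \<open>x\<close> only; the
      opposite sign would violate the constraint, hence only an inequality.\<close>
    have "(\<Sum>i\<in>I. \<delta> (-1) i) + (\<Sum>i\<in>I. 0) + 0 \<le> (\<Sum>k\<in>J. a k * ((\<Sum>i\<in>I - B k. \<delta> (-1) i) + (\<Sum>i\<in>I. 0) + 0)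
        + b k * ((\<Sum>i\<in>I. \<delta> (-1) i) + (\<Sum>i\<in>I - B k. 0) + 0))"
      by (rule boxes) (simp add: \<delta>_def)
    also have "\<dots> = (\<Sum>k\<in>J. (if k = j then a j else 0) - (a k + b k))"
      by (intro sum.cong) (auto simp: sum_I sum_B algebra_simps)
    also have "\<dots> = a j - (1 + \<sigma>)"
      using J j by (simp add: sum_subtractf \<sigma>)
    finally have "\<sigma> \<le> a j" by (simp add: sum_I)
    with \<open>a j = b j\<close> show ?thesis by simp
  qed
  have card_B: "real (card (I - B j)) = n - real (card (B j))" if "j \<in> J" for j
    using I BI[OF that] fin_B[OF that] by (simp add: n card_Diff_subset of_nat_diff card_mono)
  have ab: "real (card (B j)) * b j = real (card (B j)) * a j" if "j \<in> J" for j
    using main[OF that] by (cases "B j = {}") auto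
  \<comment> \<open>The Heisenberg dilations: \<open>\<alpha>\<close> and \<open>\<beta>\<close>
    equal \<open>s\<close>, \<open>\<omega>\<close> equals \<open>2 * s\<close>, for either sign of
    \<open>s\<close>.\<close>
  have "s * (2 * (n + 1)) \<le> s * (2 * (n + 1) * (1 + \<sigma>) - 2 * (\<Sum>j\<in>J. real (card (B j)) * a j))" for s
  proof -
    have "(\<Sum>i\<in>I. s) + (\<Sum>i\<in>I. s) + 2 * s \<le> (\<Sum>j\<in>J. a j * ((\<Sum>i\<in>I - B j. s) + (\<Sum>i\<in>I. s) + 2 * s)
        + b j * ((\<Sum>i\<in>I. s) + (\<Sum>i\<in>I - B j. s) + 2 * s))"
      by (rule boxes) simp
    also have "\<dots> = (\<Sum>j\<in>J. s * (2 * (n + 1)) * (a j + b j) - s * 2 * (real (card (B j)) * a j))"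
    proof (intro sum.cong refl)
      fix j assume j: "j \<in> J"
      have "a j * ((\<Sum>i\<in>I - B j. s) + (\<Sum>i\<in>I. s) + 2 * s) + b j * ((\<Sum>i\<in>I. s) + (\<Sum>i\<in>I - B j. s) + 2 * s)
          = s * (2 * (n + 1)) * (a j + b j) - s * (real (card (B j)) * a j) - s * (real (card (B j)) * b j)"
        by (simp add: card_B[OF j] algebra_simps flip: n)
      then show "a j * ((\<Sum>i\<in>I - B j. s) + (\<Sum>i\<in>I. s) + 2 * s) + b j * ((\<Sum>i\<in>I. s) + (\<Sum>i\<in>I - B j. s) + 2 * s)
          = s * (2 * (n + 1)) * (a j + b j) - s * 2 * (real (card (B j)) * a j)"
        unfolding ab[OF j] by simp
    qed
    also have "\<dots> = s * (2 * (n + 1)) * (1 + \<sigma>) - s * 2 * (\<Sum>j\<in>J. real (card (B j)) * a j)"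
      by (simp only: sum_subtractf sum_distrib_left[symmetric] \<sigma>) simp
    finally show ?thesis by (simp add: n algebra_simps)
  qed
  from this[of 1] this[of "-1"] have "(\<Sum>j\<in>J. real (card (B j)) * a j) = (n + 1) * \<sigma>"
    by (simp add: algebra_simps)
  with main show ?thesis by blast
qed

section \<open>Coordinate subspaces\<close>

definition emb :: "'a::euclidean_space set \<Rightarrow> ('a \<Rightarrow> real) \<Rightarrow> 'a" where
  "emb A \<omega> = (\<Sum>b\<in>A. \<omega> b *\<^sub>R b)"

lemma emb_inner: "A \<subseteq> Basis \<Longrightarrow> b \<in> Basis \<Longrightarrow> emb A \<omega> \<bullet> b = (if b \<in> A then \<omega> b else 0)"
  using finite_subset[OF _ finite_Basis, of A]
  by (simp add: emb_def inner_sum_left inner_Basis sum.delta subset_eq if_distrib cong: if_cong sum.cong_simp)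

lemma emb_restrict: "emb A (restrict \<omega> A) = emb A \<omega>"
  by (simp add: emb_def)

lemma coordinate_subspace_mem:
  assumes "coordinate_subspace W"
  shows "x \<in> W \<longleftrightarrow> (\<forall>b\<in>Basis - W. x \<bullet> b = 0)"
proof -
  obtain B where B: "B \<subseteq> Basis" "W = span B" using assms by (auto simp: coordinate_subspace_def)
  have W: "W = {x. \<forall>i\<in>Basis. i \<notin> B \<longrightarrow> x \<bullet> i = 0}"
    using span_substd_basis[OF B(1)] B(2) by simp
  have "i \<in> W \<longleftrightarrow> i \<in> B" if "i \<in> Basis" for i
    using that by (auto simp: W inner_Basis)
  then show ?thesis unfolding W by blast
qed

lemma coordinate_subspaceI:
  "coordinate_subspace W \<Longrightarrow> (\<And>b. b \<in> Basis \<Longrightarrow> b \<notin> W \<Longrightarrow> x \<bullet> b = 0) \<Longrightarrow> x \<in> W"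
  using coordinate_subspace_mem[of W x] by blast

lemma coordinate_subspaceD:
  "coordinate_subspace W \<Longrightarrow> x \<in> W \<Longrightarrow> b \<in> Basis \<Longrightarrow> b \<notin> W \<Longrightarrow> x \<bullet> b = 0"
  using coordinate_subspace_mem[of W x] by blast

lemma coordinate_subspace_span: "A \<subseteq> Basis \<Longrightarrow> coordinate_subspace (span A)"
  by (auto simp: coordinate_subspace_def)

lemma Basis_inter_span: "A \<subseteq> Basis \<Longrightarrow> Basis \<inter> span A = A"
  by (auto simp: span_substd_basis inner_Basis)

lemma coordinate_subspace_eq_span:
  assumes "coordinate_subspace W"
  shows "W = span (Basis \<inter> W)"
proof -
  obtain B where B: "B \<subseteq> Basis" "W = span B" using assms by (auto simp: coordinate_subspace_def)
  show ?thesis using Basis_inter_span[OF B(1)] by (simp add: B(2))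
qed

lemma coordinate_subspace_UNIV: "coordinate_subspace UNIV"
  unfolding coordinate_subspace_def by (rule exI[of _ Basis]) simp

lemma subspace_coordinate_subspace: "coordinate_subspace W \<Longrightarrow> subspace W"
  unfolding coordinate_subspace_def using subspace_span by blast

lemma emb_mem: "coordinate_subspace W \<Longrightarrow> emb (Basis \<inter> W) \<omega> \<in> W"
  by (rule coordinate_subspaceI) (auto simp: emb_inner)

text \<open>Uniqueness in the definite description holds because the difference of two candidates
  lies in \<open>W\<close> and is orthogonal to \<open>W\<close>, hence to itself.\<close>

lemma orth_proj_eq:
  assumes W: "coordinate_subspace W"
  shows "orth_proj W x = emb (Basis \<inter> W) (\<lambda>b. x \<bullet> b)"
  unfolding orth_proj_def
proof (rule the_equality)
  let ?y = "emb (Basis \<inter> W) (\<lambda>b. x \<bullet> b)"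
  have orth: "(x - ?y) \<bullet> w = 0" if "w \<in> W" for w
    using coordinate_subspaceD[OF W that]
    by (subst euclidean_inner) (auto simp: inner_diff_left emb_inner intro!: sum.neutral)
  then show y: "?y \<in> W \<and> (\<forall>w\<in>W. orthogonal (x - ?y) w)"
    using emb_mem[OF W] by (simp add: orthogonal_def)
  fix z assume z: "z \<in> W \<and> (\<forall>w\<in>W. orthogonal (x - z) w)"
  then have "z - ?y \<in> W" using y subspace_diff[OF subspace_coordinate_subspace[OF W]] by blast
  then have "(x - ?y) \<bullet> (z - ?y) = 0" "(x - z) \<bullet> (z - ?y) = 0"
    using orth z by (auto simp: orthogonal_def)
  then have "(z - ?y) \<bullet> (z - ?y) = 0"
    by (simp add: inner_diff_left)
  then show "z = ?y" by simp
qed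

lemma orth_proj_inner:
  assumes "coordinate_subspace W" "b \<in> Basis"
  shows "orth_proj W x \<bullet> b = (if b \<in> W then x \<bullet> b else 0)"
  using assms by (simp add: orth_proj_eq emb_inner)

lemma orth_proj_mem: "coordinate_subspace W \<Longrightarrow> orth_proj W x \<in> W"
  by (simp add: orth_proj_eq emb_mem)

lemma orth_proj_emb: "coordinate_subspace W \<Longrightarrow> orth_proj W (emb Basis \<omega>) = emb (Basis \<inter> W) \<omega>"
  by (rule euclidean_eqI) (simp add: orth_proj_inner emb_inner)

lemma inner_compl_proj:
  assumes "coordinate_subspace W"
  shows "(x - orth_proj W x) \<bullet> (y - orth_proj W y) = (\<Sum>b\<in>Basis - W. (x \<bullet> b) * (y \<bullet> b))"
proof -
  have "(x - orth_proj W x) \<bullet> (y - orth_proj W y) = (\<Sum>b\<in>Basis. if b \<in> W then 0 else (x \<bullet> b) * (y \<bullet> b))"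
    by (subst euclidean_inner) (auto simp: inner_diff_left orth_proj_inner[OF assms] intro!: sum.cong)
  also have "\<dots> = (\<Sum>b\<in>Basis - W. (x \<bullet> b) * (y \<bullet> b))"
    by (intro sum.mono_neutral_cong_right) auto
  finally show ?thesis .
qed

lemma proj_kernel_eq:
  assumes "coordinate_subspace W"
  shows "proj_kernel W = {x. \<forall>b\<in>Basis \<inter> W. x \<bullet> b = 0}"
  using orth_proj_inner[OF assms]
  by (auto simp: proj_kernel_def euclidean_eq_iff[of "orth_proj W _" 0])

lemma dim_coordinate_subspace: "coordinate_subspace W \<Longrightarrow> dim W = card (Basis \<inter> W)"
  using dim_eq_card_independent[of "Basis \<inter> W"] dim_span[of "Basis \<inter> W"]
    independent_mono[OF independent_Basis, of "Basis \<inter> W"]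
  by (simp flip: coordinate_subspace_eq_span)

text \<open>Between coordinate subspaces the projection just deletes basis vectors, so its image is
  spanned by the common ones.\<close>

lemma dim_orth_proj_image:
  assumes "coordinate_subspace V" "coordinate_subspace W"
  shows "dim (orth_proj V ` W) = card (Basis \<inter> W \<inter> V)"
proof -
  have sub: "Basis \<inter> W \<inter> V \<subseteq> Basis" by blast
  note S = coordinate_subspace_span[OF sub]
  have "orth_proj V ` W = span (Basis \<inter> W \<inter> V)"
  proof (rule set_eqI)
    fix x
    have mem: "x \<in> span (Basis \<inter> W \<inter> V) \<longleftrightarrow> (\<forall>b\<in>Basis - W \<inter> V. x \<bullet> b = 0)" for x
      by (auto simp: span_substd_basis[OF sub])
    show "x \<in> orth_proj V ` W \<longleftrightarrow> x \<in> span (Basis \<inter> W \<inter> V)"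
    proof
      assume "x \<in> orth_proj V ` W"
      then obtain w where w: "w \<in> W" "x = orth_proj V w" by blast
      show "x \<in> span (Basis \<inter> W \<inter> V)"
        unfolding mem w(2)
      proof
        fix b assume b: "b \<in> Basis - W \<inter> V"
        then show "orth_proj V w \<bullet> b = 0"
          using coordinate_subspaceD[OF assms(2) w(1), of b] by (cases "b \<in> V") (simp_all add: orth_proj_inner[OF assms(1)])
      qed
    next
      assume x: "x \<in> span (Basis \<inter> W \<inter> V)"
      then have "x \<in> W" using assms(2) by (intro coordinate_subspaceI) (auto simp: mem)
      moreover have "orth_proj V x = x"
        by (rule euclidean_eqI) (use x assms in \<open>auto simp: orth_proj_inner mem\<close>)
      ultimately show "x \<in> orth_proj V ` W" by force
    qed
  qed
  then show ?thesis
    using dim_coordinate_subspace[OF S] Basis_inter_span[OF sub] by (simp add: Int_ac)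
qed

text \<open>Existence of decompositions puts each basis vector into some kernel, as otherwise all
  summands of \<open>b\<close> would have coordinate 0 along \<open>b\<close>. Uniqueness forbids
  two kernels, since \<open>b\<close> could then be placed in either slot.\<close>

lemma direct_sum_kernels_partition:
  fixes V :: "nat \<Rightarrow> 'a::euclidean_space set"
  assumes V: "\<And>j. j \<in> J \<Longrightarrow> coordinate_subspace (V j)" and J: "finite J"
    and ds: "is_direct_sum J (\<lambda>j. proj_kernel (V j))"
  shows "\<And>i j. i \<in> J \<Longrightarrow> j \<in> J \<Longrightarrow> i \<noteq> j \<Longrightarrow> (Basis - V i) \<inter> (Basis - V j) = {}"
    and "\<And>b. b \<in> Basis \<Longrightarrow> \<exists>j\<in>J. b \<in> Basis - V j"
proof -
  have ker: "x \<in> proj_kernel (V j) \<longleftrightarrow> (\<forall>b\<in>Basis \<inter> V j. x \<bullet> b = 0)" if "j \<in> J" for x j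
    using proj_kernel_eq[OF V[OF that]] by auto
  show "\<exists>j\<in>J. b \<in> Basis - V j" if b: "b \<in> Basis" for b
  proof (rule ccontr)
    assume "\<not> ?thesis"
    then have bV: "b \<in> V j" if "j \<in> J" for j using b that by blast
    obtain u where u: "u \<in> (\<Pi>\<^sub>E j\<in>J. proj_kernel (V j))" "b = (\<Sum>j\<in>J. u j)"
      using ds unfolding is_direct_sum_def by blast
    have "u j \<bullet> b = 0" if "j \<in> J" for j
      using PiE_mem[OF u(1) that] bV[OF that] b by (simp add: ker[OF that])
    then have "b \<bullet> b = 0"
      by (subst u(2)) (simp add: inner_sum_left)
    then show False using b by simp
  qed
  show "(Basis - V i) \<inter> (Basis - V j) = {}" if ij: "i \<in> J" "j \<in> J" "i \<noteq> j" for i j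
  proof (rule ccontr)
    assume "\<not> ?thesis"
    then obtain b where b: "b \<in> Basis" "b \<notin> V i" "b \<notin> V j" by blast
    \<comment> \<open>The vector \<open>b\<close> in slot \<open>k\<close> and 0 in the other slots;
      the value \<open>undefined\<close> off \<open>J\<close> is demanded by the extensional
      product.\<close>
    define u where "u k l = (if l \<in> J then (if l = k then b else 0) else undefined)" for k l
    have mem: "u k \<in> (\<Pi>\<^sub>E j\<in>J. proj_kernel (V j))" if "k = i \<or> k = j" for k
      using that b by (auto simp: u_def ker inner_Basis PiE_iff extensional_def)
    have sum: "b = (\<Sum>l\<in>J. u k l)" if "k = i \<or> k = j" for k
      using that ij J by (auto simp: u_def cong: sum.cong_simp)
    have "\<exists>!v. v \<in> (\<Pi>\<^sub>E j\<in>J. proj_kernel (V j)) \<and> b = (\<Sum>j\<in>J. v j)"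
      using ds unfolding is_direct_sum_def by blast
    then have "u i = u j" using mem[of i] mem[of j] sum[of i] sum[of j] by blast
    then have "u i i = u j i" by simp
    then show False using ij b by (auto simp: u_def)
  qed
qed

section \<open>Lebesgue measure in coordinates\<close>

lemma emb_measurable [measurable]: "emb A \<in> borel_measurable (lebP A)"
  unfolding emb_def by measurable

lemma emb_measurable_restrict:
  "coordinate_subspace W \<Longrightarrow> emb (Basis \<inter> W) \<in> measurable (lebP (Basis \<inter> W)) (restrict_space borel W)"
  by (intro measurable_restrict_space2) (auto simp: emb_mem)

lemma coord_lborel_eq: "coord_lborel W = distr (lebP (Basis \<inter> W)) (restrict_space borel W) (emb (Basis \<inter> W))"
  by (simp add: coord_lborel_def emb_def[abs_def])

lemma sets_coord_lborel: "sets (coord_lborel W) = sets (restrict_space borel W)"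
  by (simp add: coord_lborel_eq)

lemma space_coord_lborel: "space (coord_lborel W) = W"
  by (simp add: coord_lborel_eq space_restrict_space)

lemma coord_lborel_UNIV: "coord_lborel UNIV = lborel"
  by (subst lborel_eq) (auto simp: coord_lborel_def sets_restrict_space intro!: distr_cong)

lemma measurable_ident_coord_lborel: "(\<lambda>x. x) \<in> measurable (coord_lborel W) borel"
  by (simp add: measurable_cong_sets[OF sets_coord_lborel refl] measurable_restrict_space1)

text \<open>An image measure may lose sigma-finiteness, but here the coordinate map
  \<open>?g\<close> inverts \<open>emb\<close>, so the preimages under \<open>?g\<close> of an
  exhausting family keep their finite measure.\<close>

lemma sigma_finite_coord_lborel:
  assumes W: "coordinate_subspace W"
  shows "sigma_finite_measure (coord_lborel W)"
proof -
  let ?B = "Basis \<inter> W"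
  let ?M = "lebP ?B" and ?g = "\<lambda>x. restrict (\<lambda>b. x \<bullet> b) ?B"
  interpret M: sigma_finite_measure ?M by (rule sigma_finite_lebP) simp
  note measurable_ident_coord_lborel [measurable]
  have g: "?g \<in> measurable (coord_lborel W) ?M"
    by measurable
  have g_emb: "?g (emb ?B \<omega>) = \<omega>" if "\<omega> \<in> space ?M" for \<omega>
    using that by (auto simp: emb_inner space_PiM PiE_def extensional_def restrict_def fun_eq_iff)
  obtain A where A: "countable A" "A \<subseteq> sets ?M" "\<Union>A = space ?M" "\<forall>a\<in>A. emeasure ?M a \<noteq> \<infinity>"
    using M.sigma_finite_countable by blast
  show ?thesis
  proof
    show "\<exists>A. countable A \<and> A \<subseteq> sets (coord_lborel W) \<and> \<Union>A = space (coord_lborel W) \<and> (\<forall>a\<in>A. emeasure (coord_lborel W) a \<noteq> \<infinity>)"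
    proof (intro exI[of _ "(\<lambda>a. ?g -` a \<inter> space (coord_lborel W)) ` A"] conjI ballI)
      show "countable ((\<lambda>a. ?g -` a \<inter> space (coord_lborel W)) ` A)"
        using A by simp
      show "(\<lambda>a. ?g -` a \<inter> space (coord_lborel W)) ` A \<subseteq> sets (coord_lborel W)"
        using A(2) measurable_sets[OF g] by blast
      have "?g x \<in> \<Union>A" if "x \<in> space (coord_lborel W)" for x
        using measurable_space[OF g that] A(3) by simp
      then show "\<Union>((\<lambda>a. ?g -` a \<inter> space (coord_lborel W)) ` A) = space (coord_lborel W)"
        by blast
      fix a' assume "a' \<in> (\<lambda>a. ?g -` a \<inter> space (coord_lborel W)) ` A"
      then obtain a where a: "a \<in> A" "a' = ?g -` a \<inter> space (coord_lborel W)" by blast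
      then have "a' \<in> sets (restrict_space borel W)"
        using A(2) measurable_sets[OF g, of a] by (auto simp: sets_coord_lborel)
      then have "emeasure (coord_lborel W) a' = emeasure ?M (emb ?B -` a' \<inter> space ?M)"
        unfolding coord_lborel_eq by (intro emeasure_distr emb_measurable_restrict W)
      also have "emb ?B -` a' \<inter> space ?M = a"
      proof -
        have "a \<subseteq> space ?M" using a A(2) sets.sets_into_space[of a ?M] by blast
        have "emb ?B -` a' \<inter> space ?M = {\<omega>\<in>space ?M. ?g (emb ?B \<omega>) \<in> a}"
          using emb_mem[OF W] by (auto simp: a(2) space_coord_lborel)
        also have "\<dots> = {\<omega>\<in>space ?M. \<omega> \<in> a}"
          by (rule Collect_cong, rule conj_cong[OF refl], simp only: g_emb)
        also have "\<dots> = a" using \<open>a \<subseteq> space ?M\<close> by blast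
        finally show ?thesis .
      qed
      finally show "emeasure (coord_lborel W) a' \<noteq> \<infinity>"
        using A(4) a by simp
    qed
  qed
qed

lemma nn_integral_coord_lborel:
  assumes "coordinate_subspace W" and f: "f \<in> borel_measurable (coord_lborel W)"
  shows "(\<integral>\<^sup>+x. f x \<partial>coord_lborel W) = (\<integral>\<^sup>+\<omega>. f (emb (Basis \<inter> W) \<omega>) \<partial>lebP (Basis \<inter> W))"
  using f unfolding coord_lborel_eq
  by (subst nn_integral_distr) (auto intro: emb_measurable_restrict assms(1))

text \<open>With \<open>UNIV\<close> in one slot this is the measure on a codomain, with
  \<open>UNIV\<close> in both it is Lebesgue measure on the Heisenberg group; one change of
  coordinates treats all three cases.\<close>

definition coord3 :: "'a::euclidean_space set \<Rightarrow> 'a set \<Rightarrow> 'a heis measure" where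
  "coord3 V W = coord_lborel V \<Otimes>\<^sub>M (coord_lborel W \<Otimes>\<^sub>M lborel)"

definition lift3 :: "'a::euclidean_space set \<Rightarrow> 'a set \<Rightarrow> ('a heis \<Rightarrow> ennreal) \<Rightarrow> ('a \<Rightarrow> real) \<Rightarrow> ('a \<Rightarrow> real) \<Rightarrow> real \<Rightarrow> ennreal" where
  "lift3 V W f x y t = f (emb (Basis \<inter> V) x, emb (Basis \<inter> W) y, t)"

lemma measurable_coord3:
  assumes "f \<in> borel_measurable borel"
  shows "f \<in> borel_measurable (coord3 V W)"
proof -
  have [measurable]: "fst \<in> borel_measurable (coord3 V W)" "(\<lambda>z. fst (snd z)) \<in> borel_measurable (coord3 V W)"
    "(\<lambda>z. snd (snd z)) \<in> borel_measurable (coord3 V W)"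
    unfolding coord3_def
    using measurable_compose[OF measurable_fst measurable_ident_coord_lborel, of V]
      measurable_compose[OF measurable_compose[OF measurable_snd measurable_fst] measurable_ident_coord_lborel, of _ W]
    by auto
  have "(\<lambda>z. (fst z, fst (snd z), snd (snd z))) \<in> borel_measurable (coord3 V W)"
    by measurable
  from measurable_compose[OF this assms] show ?thesis by simp
qed

lemma measurable_lift3:
  assumes [measurable]: "f \<in> borel_measurable borel"
  shows "measurable3 (Basis \<inter> V) (Basis \<inter> W) (lift3 V W f)"
  unfolding lift3_def by measurable

lemma nn_integral_coord3:
  assumes VW: "coordinate_subspace V" "coordinate_subspace W" and f [measurable]: "f \<in> borel_measurable borel"
  shows "(\<integral>\<^sup>+z. f z \<partial>coord3 V W) = mass (Basis \<inter> V) (Basis \<inter> W) (lift3 V W f)"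
proof -
  interpret W: sigma_finite_measure "coord_lborel W" by (rule sigma_finite_coord_lborel[OF VW(2)])
  note measurable_ident_coord_lborel [measurable]
  have f3: "(\<lambda>(x, y, t). f (x, y, t)) \<in> borel_measurable (coord_lborel V \<Otimes>\<^sub>M coord_lborel W \<Otimes>\<^sub>M lborel)"
    using measurable_coord3[OF f, of V W] by (simp add: coord3_def)
  have "(\<integral>\<^sup>+z. f z \<partial>coord3 V W) = (\<integral>\<^sup>+x. \<integral>\<^sup>+y. \<integral>\<^sup>+t. f (x, y, t) \<partial>lborel \<partial>coord_lborel W \<partial>coord_lborel V)"
    using nn_integral_triple[OF W.sigma_finite_measure_axioms lborel.sigma_finite_measure_axioms f3]
    by (simp add: coord3_def)
  also have "\<dots> = (\<integral>\<^sup>+x. \<integral>\<^sup>+y. \<integral>\<^sup>+t. f (x, emb (Basis \<inter> W) y, t) \<partial>lborel \<partial>lebP (Basis \<inter> W) \<partial>coord_lborel V)"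
    by (intro nn_integral_cong nn_integral_coord_lborel VW) measurable
  also have "\<dots> = mass (Basis \<inter> V) (Basis \<inter> W) (lift3 V W f)"
  proof -
    interpret W': sigma_finite_measure "lebP (Basis \<inter> W)" by (rule sigma_finite_lebP) simp
    show ?thesis
      unfolding mass_def lift3_def
      by (rule nn_integral_coord_lborel[OF VW(1)]) measurable
  qed
  finally show ?thesis .
qed

section \<open>Sufficiency\<close>

text \<open>Null functions of some coordinates stay null in all of them: the removed coordinates
  contribute infinite measure at worst, and 0 times infinity is 0. The exponent infinity requires
  this.\<close>

lemma nn_integral_restrict_null:
  assumes I: "finite I" "A \<subseteq> I" and G [measurable]: "G \<in> borel_measurable (lebP A)" and null: "(\<integral>\<^sup>+x. G x \<partial>lebP A) = 0"
  shows "(\<integral>\<^sup>+x. G (restrict x A) \<partial>lebP I) = 0"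
proof -
  have fin: "finite A" "finite (I - A)" and eq: "A \<union> (I - A) = I" using I finite_subset[of A I] by auto
  have meas: "(\<lambda>x. G (restrict x A)) \<in> borel_measurable (lebP I)"
    using measurable_compose[OF measurable_restrict_subset[OF I(2)] G] .
  have "(\<integral>\<^sup>+x. G (restrict x A) \<partial>lebP I)
      = (\<integral>\<^sup>+x. \<integral>\<^sup>+y. G (restrict (merge A (I - A) (x, y)) A) \<partial>lebP (I - A) \<partial>lebP A)"
    using lebP.product_nn_integral_fold[of A "I - A" "\<lambda>x. G (restrict x A)", unfolded eq, OF _ fin meas] by simp
  also have "\<dots> = (\<integral>\<^sup>+x. \<integral>\<^sup>+y. G x \<partial>lebP (I - A) \<partial>lebP A)"
  proof (intro nn_integral_cong)
    fix x y :: "'a \<Rightarrow> real" assume x: "x \<in> space (lebP A)"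
    have "restrict (merge A (I - A) (x, y)) A = merge A {} (x, y)"
      by (rule restrict_merge_split) auto
    then show "G (restrict (merge A (I - A) (x, y)) A) = G x"
      using merge_empty_right[OF x] by simp
  qed
  also have "\<dots> = 0"
    using null by (simp add: nn_integral_multc)
  finally show ?thesis .
qed

text \<open>For fixed \<open>x\<close> and \<open>y\<close> the shear is a translation in
  \<open>t\<close>; what remains is a coordinate projection. Hence exceptional null sets pull back
  to null sets.\<close>

lemma mass_pull1_null:
  assumes I: "finite I" "B \<subseteq> I" and g: "measurable3 (I - B) I g" and null: "mass (I - B) I g = 0"
  shows "mass I I (pull1 I B g) = 0"
proof -
  interpret sigma_finite_measure "lebP I" by (rule sigma_finite_lebP[OF I(1)])
  note measurable_compose3[OF g, measurable (raw)]
  have "mass I I (pull1 I B g) = (\<integral>\<^sup>+x. \<integral>\<^sup>+y. \<integral>\<^sup>+t. g (restrict x (I - B)) y t \<partial>lborel \<partial>lebP I \<partial>lebP I)"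
    unfolding mass_def pull1_def
  proof (rule nn_integral_cong, rule nn_integral_cong)
    fix x y assume [measurable]: "x \<in> space (lebP I)" "y \<in> space (lebP I)"
    have [measurable]: "restrict x (I - B) \<in> space (lebP (I - B))" by (auto simp: space_PiM)
    have "(\<lambda>t. g (restrict x (I - B)) y t) \<in> borel_measurable borel" by measurable
    from nn_integral_shift[OF this]
    show "(\<integral>\<^sup>+t. g (restrict x (I - B)) y (t + 1/2 * dotp B x y) \<partial>lborel) = (\<integral>\<^sup>+t. g (restrict x (I - B)) y t \<partial>lborel)" .
  qed
  also have "\<dots> = 0"
    using null I(1) unfolding mass_def
    by (intro nn_integral_restrict_null[where G="\<lambda>x. \<integral>\<^sup>+y. \<integral>\<^sup>+t. g x y t \<partial>lborel \<partial>lebP I"]) auto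
  finally show ?thesis .
qed

text \<open>As for \<open>pull1\<close>, except that \<open>y\<close> has to become the outer
  variable because its coordinates are the ones removed.\<close>

lemma mass_pull2_null:
  assumes I: "finite I" "B \<subseteq> I" and h: "measurable3 I (I - B) h" and null: "mass I (I - B) h = 0"
  shows "mass I I (pull2 I B h) = 0"
proof -
  interpret sigma_finite_measure "lebP I" by (rule sigma_finite_lebP[OF I(1)])
  have sf: "sigma_finite_measure (lebP I)" "sigma_finite_measure (lebP (I - B))"
    by (rule sigma_finite_lebP, use I in simp)+
  note measurable_compose3[OF h, measurable (raw)]
  have [measurable]: "(\<lambda>w. restrict (y w) (I - B)) \<in> measurable M (lebP (I - B))"
    if "y \<in> measurable M (lebP I)" for y and M :: "'z measure"
    using that by (rule restrict_measurable) auto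
  have "mass I I (pull2 I B h) = (\<integral>\<^sup>+x. \<integral>\<^sup>+y. \<integral>\<^sup>+t. h x (restrict y (I - B)) t \<partial>lborel \<partial>lebP I \<partial>lebP I)"
    unfolding mass_def pull2_def
  proof (rule nn_integral_cong, rule nn_integral_cong)
    fix x y assume [measurable]: "x \<in> space (lebP I)" "y \<in> space (lebP I)"
    have [measurable]: "restrict y (I - B) \<in> space (lebP (I - B))" by (auto simp: space_PiM)
    have "(\<lambda>t. h x (restrict y (I - B)) t) \<in> borel_measurable borel" by measurable
    from nn_integral_shift[OF this, of "- (1/2 * dotp B x y)"]
    show "(\<integral>\<^sup>+t. h x (restrict y (I - B)) (t - 1/2 * dotp B x y) \<partial>lborel) = (\<integral>\<^sup>+t. h x (restrict y (I - B)) t \<partial>lborel)"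
      by simp
  qed
  also have "\<dots> = (\<integral>\<^sup>+y. \<integral>\<^sup>+x. \<integral>\<^sup>+t. h x (restrict y (I - B)) t \<partial>lborel \<partial>lebP I \<partial>lebP I)"
    by (rule nn_integral_swap[OF sf(1) sf(1)]) measurable
  also have "\<dots> = 0"
  proof (rule nn_integral_restrict_null[where G="\<lambda>y. \<integral>\<^sup>+x. \<integral>\<^sup>+t. h x y t \<partial>lborel \<partial>lebP I"])
    have "(\<integral>\<^sup>+y. \<integral>\<^sup>+x. \<integral>\<^sup>+t. h x y t \<partial>lborel \<partial>lebP I \<partial>lebP (I - B)) = mass I (I - B) h"
      unfolding mass_def by (rule nn_integral_swap[OF sf(2) sf(1)]) measurable
    then show "(\<integral>\<^sup>+y. \<integral>\<^sup>+x. \<integral>\<^sup>+t. h x y t \<partial>lborel \<partial>lebP I \<partial>lebP (I - B)) = 0"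
      using null by simp
  qed (use I in auto)
  finally show ?thesis .
qed

section \<open>Exponents, norms and the projections in coordinates\<close>

lemma recip_nonneg: "0 \<le> recip p"
  by (simp add: recip_def)

lemma recip_infinity: "recip top = 0"
  by (simp add: recip_def)

lemma recip_finite: "1 \<le> p \<Longrightarrow> p \<noteq> \<infinity> \<Longrightarrow> recip p = 1 / enn2real p \<and> 1 \<le> enn2real p"
  by (cases p) (auto simp: recip_def divide_ennreal ennreal_1[symmetric] simp del: ennreal_1)

lemma Lp_norm_finite:
  assumes "1 \<le> p" "p \<noteq> \<infinity>"
  shows "Lp_norm M p f = (\<integral>\<^sup>+z. ennreal (\<bar>f z\<bar> powr enn2real p) \<partial>M) powe recip p"
  using recip_finite[OF assms] assms by (simp add: Lp_norm_def epow_def Let_def)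

text \<open>A common form for finite and infinite exponents. For finite \<open>p\<close> one takes
  \<open>K = 1\<close>, \<open>n = 0\<close> and for \<open>g\<close> the p-th power of
  \<open>f\<close>. For \<open>p = \<infinity>\<close> the power of \<open>g\<close> is 1,
  \<open>K\<close> is the essential supremum, and \<open>n\<close> is infinite on the null set where
  \<open>f\<close> exceeds it.\<close>

lemma Lp_norm_factor:
  fixes f :: "'b::topological_space \<Rightarrow> real"
  assumes p: "1 \<le> p" and f [measurable]: "f \<in> borel_measurable borel" and f0: "\<And>z. 0 \<le> f z"
    and M: "\<And>g :: 'b \<Rightarrow> ennreal. g \<in> borel_measurable borel \<Longrightarrow> g \<in> borel_measurable M"
  shows "\<exists>g n :: 'b \<Rightarrow> ennreal. \<exists>K. g \<in> borel_measurable borel \<and> n \<in> borel_measurable borel \<and>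
    (\<forall>z. ennreal (f z) \<le> K * g z powe recip p + n z) \<and> (\<integral>\<^sup>+z. n z \<partial>M) = 0 \<and>
    Lp_norm M p f = K * (\<integral>\<^sup>+z. g z \<partial>M) powe recip p"
proof (cases "p = \<infinity>")
  case False
  note r = recip_finite[OF p False]
  have eq: "ennreal (f z) = ennreal (\<bar>f z\<bar> powr enn2real p) powe recip p" for z
    using f0[of z] r by (simp add: epow_ennreal powr_powr)
  show ?thesis
    using eq by (intro exI[of _ "\<lambda>z. ennreal (\<bar>f z\<bar> powr enn2real p)"] exI[of _ "\<lambda>_. 0"] exI[of _ 1])
      (simp add: Lp_norm_finite[OF p False])
next
  case True
  define K where "K = esssup M (\<lambda>z. ennreal (f z))"
  define n where "n z = (if ennreal (f z) \<le> K then 0 else \<infinity> :: ennreal)" for z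
  have n [measurable]: "n \<in> borel_measurable borel"
    unfolding n_def by measurable
  have "AE z in M. ennreal (f z) \<le> K"
    unfolding K_def by (rule esssup_AE)
  then have "AE z in M. n z = 0" by eventually_elim (simp add: n_def)
  then have "(\<integral>\<^sup>+z. n z \<partial>M) = 0"
    using M[OF n] by (subst nn_integral_0_iff_AE) auto
  then show ?thesis
    using True f0 n
    by (intro exI[of _ "\<lambda>_. 0"] exI[of _ n] exI[of _ K])
      (auto simp: recip_infinity Lp_norm_def K_def[symmetric] n_def)
qed

lemma borel_measurable_extend:
  fixes f :: "'a::topological_space \<Rightarrow> real"
  assumes "continuous_on S f" "S \<in> sets borel"
  shows "(\<lambda>z. if z \<in> S then f z else 0) \<in> borel_measurable borel"
  using borel_measurable_continuous_on_if[OF assms(2,1), of "\<lambda>_. 0"] by simp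

lemma heis_proj_measurable:
  assumes "coordinate_subspace W"
  shows "heis_proj1 W \<in> borel_measurable borel" "heis_proj2 W \<in> borel_measurable borel"
proof -
  have op: "orth_proj W = (\<lambda>x. \<Sum>b\<in>Basis \<inter> W. (x \<bullet> b) *\<^sub>R b)"
    using orth_proj_eq[OF assms] by (simp add: emb_def fun_eq_iff)
  show "heis_proj1 W \<in> borel_measurable borel" "heis_proj2 W \<in> borel_measurable borel"
    unfolding heis_proj1_def heis_proj2_def op case_prod_unfold
    by (intro borel_measurable_continuous_onI continuous_intros)+
qed

lemma heis_proj_coords:
  assumes W: "coordinate_subspace W"
  shows "F (heis_proj1 W (emb Basis x, emb Basis y, t)) = pull1 Basis (Basis - W) (lift3 W UNIV F) x y t"
    and "F (heis_proj2 W (emb Basis x, emb Basis y, t)) = pull2 Basis (Basis - W) (lift3 UNIV W F) x y t"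
proof -
  have "Basis - (Basis - W) = Basis \<inter> W" by blast
  moreover have "(\<Sum>b\<in>Basis - W. (emb Basis x \<bullet> b) * (emb Basis y \<bullet> b)) = dotp (Basis - W) x y"
    by (auto simp: dotp_def emb_inner intro!: sum.cong)
  ultimately show "F (heis_proj1 W (emb Basis x, emb Basis y, t)) = pull1 Basis (Basis - W) (lift3 W UNIV F) x y t"
    "F (heis_proj2 W (emb Basis x, emb Basis y, t)) = pull2 Basis (Basis - W) (lift3 UNIV W F) x y t"
    by (simp_all add: heis_proj1_def heis_proj2_def orth_proj_emb[OF W] inner_compl_proj[OF W] pull1_def pull2_def
        lift3_def emb_restrict)
qed

lemma coord3_UNIV: "coord3 UNIV UNIV = (lborel :: 'a::euclidean_space heis measure)"
  by (simp add: coord3_def coord_lborel_UNIV lborel_prod)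

lemma nn_integral_heis:
  fixes F :: "'a::euclidean_space heis \<Rightarrow> ennreal"
  assumes "F \<in> borel_measurable borel"
  shows "(\<integral>\<^sup>+z. F z \<partial>lborel) = mass Basis Basis (\<lambda>x y t. F (emb Basis x, emb Basis y, t))"
  using nn_integral_coord3[OF coordinate_subspace_UNIV coordinate_subspace_UNIV assms]
  by (simp add: coord3_UNIV lift3_def[abs_def])

lemma heis_codomain_measure_eq:
  "heis_codomain_measure m V j = (if j \<le> m then coord3 (V j) UNIV else coord3 UNIV (V j))"
  by (simp add: heis_codomain_measure_def coord3_def coord_lborel_UNIV)

lemma prod_double:
  fixes X :: "nat \<Rightarrow> 'c::comm_monoid_mult"
  shows "(\<Prod>j=1..2*m. X j) = (\<Prod>j=1..m. X j * X (j + m))"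
proof -
  have "(\<Prod>j=1..2*m. X j) = (\<Prod>j=1..m. X j) * (\<Prod>j=m+1..m+m. X j)"
    using prod.ub_add_nat[of 1 m X m] by (simp add: mult_2)
  also have "(\<Prod>j=m+1..m+m. X j) = (\<Prod>j=1..m. X (j + m))"
    using prod.shift_bounds_cl_nat_ivl[of X 1 m m] by (simp add: add.commute)
  finally show ?thesis by (simp add: prod.distrib)
qed

text \<open>A crude expansion of the product: as soon as one \<open>N k\<close> is nonzero the right
  side is infinite, which costs nothing after integrating null functions.\<close>

lemma prod_plus_null_le:
  fixes A N :: "'k \<Rightarrow> ennreal"
  assumes "finite K"
  shows "(\<Prod>k\<in>K. A k + N k) \<le> (\<Prod>k\<in>K. A k) + \<infinity> * (\<Sum>k\<in>K. N k)"
proof (cases "(\<Sum>k\<in>K. N k) = 0")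
  case True
  then show ?thesis using assms by simp
qed (simp add: ennreal_top_mult)

lemma sufficiency:
  fixes V :: "nat \<Rightarrow> 'a::euclidean_space set" and p :: "nat \<Rightarrow> ennreal"
  assumes V: "\<forall>j\<in>{1..2*m}. coordinate_subspace (V j)" and Vm: "\<forall>j\<in>{1..m}. V (j + m) = V j"
    and ds: "is_direct_sum {1..m} (\<lambda>j. proj_kernel (V j))"
    and p: "\<forall>j\<in>{1..2*m}. 1 \<le> p j"
    and \<sigma>: "\<sigma> = (\<Sum>j=1..m. recip (p j) + recip (p (j + m))) - 1"
    and ab: "\<forall>j\<in>{1..m}. Basis - V j \<noteq> {} \<longrightarrow> recip (p j) = recip (p (j + m)) \<and> \<sigma> \<le> recip (p j)"
    and scaling: "(\<Sum>j=1..m. real (card (Basis - V j)) * recip (p j)) = (real (card (Basis :: 'a set)) + 1) * \<sigma>"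
  shows "\<exists>C::ennreal. C < \<infinity> \<and>
        (\<forall>f :: nat \<Rightarrow> 'a heis \<Rightarrow> real.
           (\<forall>j\<in>{1..2*m}. nonneg_Cc (heis_codomain m V j) (f j)) \<longrightarrow>
           heis_form m V f \<le>
             C * (\<Prod>j=1..m. Lp_norm (heis_codomain_measure m V j) (p j) (f j) *
                    Lp_norm (heis_codomain_measure m V (j + m)) (p (j + m)) (f (j + m))))"
proof -
  let ?I = "Basis :: 'a set" and ?J = "{1..m}"
  define B where "B j = ?I - V j" for j
  define a where "a j = recip (p j)" for j
  have V1: "coordinate_subspace (V j)" if "j \<in> ?J" for j using V that by auto
  have IB: "?I - B j = ?I \<inter> V j" for j by (auto simp: B_def)
  note part = direct_sum_kernels_partition[OF V1 finite_atLeastAtMost ds, folded B_def]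
  have "\<exists>C<\<infinity>. \<forall>g h. (\<forall>j\<in>?J. measurable3 (?I - B j) ?I (g j) \<and> measurable3 ?I (?I - B j) (h j)) \<longrightarrow>
    mass ?I ?I (\<lambda>x y t. \<Prod>j\<in>?J. pull1 ?I (B j) (g j) x y t powe a j * pull2 ?I (B j) (h j) x y t powe a (j + m))
      \<le> C * (\<Prod>j\<in>?J. mass (?I - B j) ?I (g j) powe a j * mass ?I (?I - B j) (h j) powe a (j + m))"
    by (rule heisenberg_brascamp_lieb[where \<sigma>=\<sigma>])
      (use part ab scaling \<sigma> in \<open>auto simp: B_def a_def recip_nonneg\<close>)
  then obtain C where C: "C < \<infinity>" and bound: "\<And>g h. (\<And>j. j \<in> ?J \<Longrightarrow> measurable3 (?I - B j) ?I (g j)) \<Longrightarrow>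
      (\<And>j. j \<in> ?J \<Longrightarrow> measurable3 ?I (?I - B j) (h j)) \<Longrightarrow>
    mass ?I ?I (\<lambda>x y t. \<Prod>j\<in>?J. pull1 ?I (B j) (g j) x y t powe a j * pull2 ?I (B j) (h j) x y t powe a (j + m))
      \<le> C * (\<Prod>j\<in>?J. mass (?I - B j) ?I (g j) powe a j * mass ?I (?I - B j) (h j) powe a (j + m))"
    by blast
  have "heis_form m V f \<le>
             C * (\<Prod>j=1..m. Lp_norm (heis_codomain_measure m V j) (p j) (f j) *
                    Lp_norm (heis_codomain_measure m V (j + m)) (p (j + m)) (f (j + m)))"
    if f: "\<forall>j\<in>{1..2*m}. nonneg_Cc (heis_codomain m V j) (f j)" for f
  proof -
    let ?S = "heis_codomain m V" and ?M = "heis_codomain_measure m V"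
    \<comment> \<open>Each \<open>f j\<close> is constrained only on its codomain. The extension by
      0 is Borel on the ambient space because the codomain is closed.\<close>
    define F where "F j z = (if z \<in> ?S j then f j z else 0)" for j z
    have closed_V: "closed (V j)" if "j \<in> {1..2*m}" for j
      using V that by (intro closed_subspace subspace_coordinate_subspace) auto
    have closed_S: "closed (?S j)" if "j \<in> {1..2*m}" for j
      using closed_V[OF that] by (auto simp: heis_codomain_def intro!: closed_Times)
    have F_meas [measurable]: "F j \<in> borel_measurable borel" if "j \<in> {1..2*m}" for j
      unfolding F_def using f closed_S that by (intro borel_measurable_extend) (auto simp: nonneg_Cc_def)
    have F_nonneg: "0 \<le> F j z" if "j \<in> {1..2*m}" for j z
      using f that by (auto simp: F_def nonneg_Cc_def)
    have space_M: "space (?M j) = ?S j" for j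
      by (simp add: heis_codomain_measure_def heis_codomain_def space_pair_measure space_coord_lborel)
    have M_meas: "g \<in> borel_measurable (?M j)" if "g \<in> borel_measurable borel" for g :: "'a heis \<Rightarrow> ennreal" and j
      using measurable_coord3[OF that] by (simp add: heis_codomain_measure_eq)
    have "\<forall>j\<in>{1..2*m}. \<exists>g n :: 'a heis \<Rightarrow> ennreal. \<exists>K. g \<in> borel_measurable borel \<and> n \<in> borel_measurable borel \<and>
      (\<forall>z. ennreal (F j z) \<le> K * g z powe a j + n z) \<and> (\<integral>\<^sup>+z. n z \<partial>?M j) = 0 \<and>
      Lp_norm (?M j) (p j) (F j) = K * (\<integral>\<^sup>+z. g z \<partial>?M j) powe a j"
    proof
      fix j assume j: "j \<in> {1..2*m}"
      show "\<exists>g n :: 'a heis \<Rightarrow> ennreal. \<exists>K. g \<in> borel_measurable borel \<and> n \<in> borel_measurable borel \<and>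
        (\<forall>z. ennreal (F j z) \<le> K * g z powe a j + n z) \<and> (\<integral>\<^sup>+z. n z \<partial>?M j) = 0 \<and>
        Lp_norm (?M j) (p j) (F j) = K * (\<integral>\<^sup>+z. g z \<partial>?M j) powe a j"
        unfolding a_def using p j by (intro Lp_norm_factor F_meas F_nonneg M_meas) auto
    qed
    then obtain g n K where
      g [measurable]: "\<And>j. j \<in> {1..2*m} \<Longrightarrow> g j \<in> borel_measurable (borel :: 'a heis measure)"
      and n [measurable]: "\<And>j. j \<in> {1..2*m} \<Longrightarrow> n j \<in> borel_measurable (borel :: 'a heis measure)"
      and F_le: "\<And>j z. j \<in> {1..2*m} \<Longrightarrow> ennreal (F j z) \<le> K j * g j z powe a j + n j z"
      and n_null: "\<And>j. j \<in> {1..2*m} \<Longrightarrow> (\<integral>\<^sup>+z. n j z \<partial>?M j) = 0"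
      and norm_F: "\<And>j. j \<in> {1..2*m} \<Longrightarrow> Lp_norm (?M j) (p j) (F j) = K j * (\<integral>\<^sup>+z. g j z \<partial>?M j) powe a j"
      by metis
    \<comment> \<open>For the essential supremum, measurability of \<open>f j\<close> on the
      codomain is inherited from \<open>F j\<close>, with which it agrees there.\<close>
    have norm_eq: "Lp_norm (?M j) (p j) (f j) = Lp_norm (?M j) (p j) (F j)" if "j \<in> {1..2*m}" for j
    proof -
      have eq: "ennreal \<bar>F j z\<bar> = ennreal \<bar>f j z\<bar>" if "z \<in> space (?M j)" for z
        using that by (simp add: space_M F_def)
      have "(\<lambda>z. ennreal \<bar>F j z\<bar>) \<in> borel_measurable (?M j)"
        using that by (intro M_meas) measurable
      moreover from this have "(\<lambda>z. ennreal \<bar>f j z\<bar>) \<in> borel_measurable (?M j)"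
        by (subst (asm) measurable_cong[OF eq])
      ultimately have "esssup (?M j) (\<lambda>z. ennreal \<bar>f j z\<bar>) = esssup (?M j) (\<lambda>z. ennreal \<bar>F j z\<bar>)"
        using eq by (intro esssup_AE_cong AE_I2) auto
      moreover have "(\<integral>\<^sup>+z. ennreal (\<bar>f j z\<bar> powr enn2real (p j)) \<partial>?M j) = (\<integral>\<^sup>+z. ennreal (\<bar>F j z\<bar> powr enn2real (p j)) \<partial>?M j)"
        by (rule nn_integral_cong) (simp add: space_M F_def)
      ultimately show ?thesis by (simp add: Lp_norm_def)
    qed
    let ?\<pi> = "heis_proj m V"
    have \<pi>_meas [measurable]: "?\<pi> j \<in> borel_measurable borel" if "j \<in> {1..2*m}" for j
      using heis_proj_measurable[OF bspec[OF V that]] by (simp add: heis_proj_def)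
    have \<pi>_mem: "?\<pi> j z \<in> ?S j" if "j \<in> {1..2*m}" for j z
      using orth_proj_mem[OF bspec[OF V that]]
      by (simp add: heis_proj_def heis_codomain_def heis_proj1_def heis_proj2_def case_prod_unfold)
    have coords: "G (?\<pi> j (emb ?I x, emb ?I y, t)) = pull1 ?I (B j) (lift3 (V j) UNIV G) x y t"
      "G (?\<pi> (j + m) (emb ?I x, emb ?I y, t)) = pull2 ?I (B j) (lift3 UNIV (V j) G) x y t"
      if "j \<in> ?J" for j x y t and G :: "'a heis \<Rightarrow> ennreal"
      using heis_proj_coords[OF V1[OF that], of G x y t] that Vm by (auto simp: heis_proj_def B_def)
    have lift_meas: "measurable3 (?I - B j) ?I (lift3 (V j) UNIV G)" "measurable3 ?I (?I - B j) (lift3 UNIV (V j) G)"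
      if "G \<in> borel_measurable borel" for j and G :: "'a heis \<Rightarrow> ennreal"
      using measurable_lift3[OF that, of "V j" UNIV] measurable_lift3[OF that, of UNIV "V j"] by (simp_all add: IB)
    have lift_mass: "mass (?I - B j) ?I (lift3 (V j) UNIV G) = (\<integral>\<^sup>+z. G z \<partial>?M j)"
      "mass ?I (?I - B j) (lift3 UNIV (V j) G) = (\<integral>\<^sup>+z. G z \<partial>?M (j + m))"
      if "j \<in> ?J" "G \<in> borel_measurable borel" for j and G :: "'a heis \<Rightarrow> ennreal"
      using nn_integral_coord3[OF V1[OF that(1)] coordinate_subspace_UNIV that(2)]
        nn_integral_coord3[OF coordinate_subspace_UNIV V1[OF that(1)] that(2)] that(1) Vm
      by (simp_all add: heis_codomain_measure_eq IB)
    have null: "(\<integral>\<^sup>+z. n j (?\<pi> j z) \<partial>lborel) = 0" if j: "j \<in> {1..2*m}" for j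
    proof (cases "j \<le> m")
      case True
      with j have jJ: "j \<in> ?J" by auto
      have "(\<integral>\<^sup>+z. n j (?\<pi> j z) \<partial>lborel) = mass ?I ?I (pull1 ?I (B j) (lift3 (V j) UNIV (n j)))"
        using j by (subst nn_integral_heis) (auto simp: coords[OF jJ])
      also have "\<dots> = 0"
        using lift_meas(1)[OF n[OF j]] lift_mass(1)[OF jJ n[OF j]] n_null[OF j]
        by (intro mass_pull1_null) (auto simp: B_def)
      finally show ?thesis .
    next
      case False
      then obtain k where k: "j = k + m" "k \<in> ?J"
        using j by (intro that[of "j - m"]) auto
      have "(\<integral>\<^sup>+z. n j (?\<pi> j z) \<partial>lborel) = mass ?I ?I (pull2 ?I (B k) (lift3 UNIV (V k) (n j)))"
        using j by (subst nn_integral_heis) (auto simp: k(1) coords[OF k(2)])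
      also have "\<dots> = 0"
        using lift_meas(2)[OF n[OF j], of k] lift_mass(2)[OF k(2) n[OF j]] n_null[OF j]
        by (intro mass_pull2_null) (auto simp: B_def k(1))
      finally show ?thesis .
    qed
    have J2: "j \<in> {1..2*m}" "j + m \<in> {1..2*m}" if "j \<in> ?J" for j using that by auto
    have "heis_form m V f = (\<integral>\<^sup>+z. (\<Prod>j=1..2*m. ennreal (F j (?\<pi> j z))) \<partial>lborel)"
      unfolding heis_form_def by (intro nn_integral_cong prod.cong) (auto simp: F_def \<pi>_mem)
    also have "\<dots> \<le> (\<integral>\<^sup>+z. (\<Prod>j=1..2*m. K j * g j (?\<pi> j z) powe a j) + \<infinity> * (\<Sum>j=1..2*m. n j (?\<pi> j z)) \<partial>lborel)"
    proof (rule nn_integral_mono)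
      fix z
      have "(\<Prod>j=1..2*m. ennreal (F j (?\<pi> j z))) \<le> (\<Prod>j=1..2*m. K j * g j (?\<pi> j z) powe a j + n j (?\<pi> j z))"
        by (intro prod_mono_ennreal F_le) auto
      also have "\<dots> \<le> (\<Prod>j=1..2*m. K j * g j (?\<pi> j z) powe a j) + \<infinity> * (\<Sum>j=1..2*m. n j (?\<pi> j z))"
        by (rule prod_plus_null_le) simp
      finally show "(\<Prod>j=1..2*m. ennreal (F j (?\<pi> j z))) \<le> (\<Prod>j=1..2*m. K j * g j (?\<pi> j z) powe a j) + \<infinity> * (\<Sum>j=1..2*m. n j (?\<pi> j z))" .
    qed
    also have "\<dots> = (\<integral>\<^sup>+z. (\<Prod>j=1..2*m. K j * g j (?\<pi> j z) powe a j) \<partial>lborel)"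
    proof -
      have "(\<integral>\<^sup>+z. (\<Sum>j=1..2*m. n j (?\<pi> j z)) \<partial>lborel) = (\<Sum>j=1..2*m. \<integral>\<^sup>+z. n j (?\<pi> j z) \<partial>lborel)"
        by (rule nn_integral_sum) measurable
      also have "\<dots> = 0" by (intro sum.neutral ballI null)
      finally have sum_null: "(\<integral>\<^sup>+z. (\<Sum>j=1..2*m. n j (?\<pi> j z)) \<partial>lborel) = 0" .
      have "(\<lambda>z. \<Sum>j=1..2*m. n j (?\<pi> j z)) \<in> borel_measurable lborel"
        "(\<lambda>z. \<Prod>j=1..2*m. K j * g j (?\<pi> j z) powe a j) \<in> borel_measurable lborel"
        by measurable
      then show ?thesis
        by (simp only: nn_integral_add nn_integral_cmult sum_null borel_measurable_times_ennreal
          borel_measurable_const mult_zero_right add_0_right)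
    qed
    also have "\<dots> = (\<Prod>j=1..2*m. K j) * (\<integral>\<^sup>+z. (\<Prod>j=1..2*m. g j (?\<pi> j z) powe a j) \<partial>lborel)"
      unfolding prod.distrib by (rule nn_integral_cmult) measurable
    also have "(\<integral>\<^sup>+z. (\<Prod>j=1..2*m. g j (?\<pi> j z) powe a j) \<partial>lborel) = mass ?I ?I (\<lambda>x y t.
        \<Prod>j\<in>?J. pull1 ?I (B j) (lift3 (V j) UNIV (g j)) x y t powe a j * pull2 ?I (B j) (lift3 UNIV (V j) (g (j + m))) x y t powe a (j + m))"
    proof -
      have meas: "(\<lambda>z. \<Prod>j=1..2*m. g j (?\<pi> j z) powe a j) \<in> borel_measurable borel"
        by measurable
      show ?thesis
        unfolding nn_integral_heis[OF meas] unfolding prod_double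
        by (intro arg_cong[where f="mass _ _"] ext prod.cong refl) (simp add: coords)
    qed
    also have "\<dots> \<le> C * (\<Prod>j\<in>?J. mass (?I - B j) ?I (lift3 (V j) UNIV (g j)) powe a j
        * mass ?I (?I - B j) (lift3 UNIV (V j) (g (j + m))) powe a (j + m))"
      using g J2 by (intro bound lift_meas) auto
    also have "(\<Prod>j\<in>?J. mass (?I - B j) ?I (lift3 (V j) UNIV (g j)) powe a j
        * mass ?I (?I - B j) (lift3 UNIV (V j) (g (j + m))) powe a (j + m))
      = (\<Prod>j\<in>?J. (\<integral>\<^sup>+z. g j z \<partial>?M j) powe a j * (\<integral>\<^sup>+z. g (j + m) z \<partial>?M (j + m)) powe a (j + m))"
      using g J2 by (intro prod.cong refl) (simp add: lift_mass)
    also have "(\<Prod>j=1..2*m. K j) * (C * (\<Prod>j\<in>?J. (\<integral>\<^sup>+z. g j z \<partial>?M j) powe a j * (\<integral>\<^sup>+z. g (j + m) z \<partial>?M (j + m)) powe a (j + m)))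
      = C * (\<Prod>j\<in>?J. Lp_norm (?M j) (p j) (f j) * Lp_norm (?M (j + m)) (p (j + m)) (f (j + m)))"
    proof -
      have "(\<Prod>j\<in>?J. Lp_norm (?M j) (p j) (f j) * Lp_norm (?M (j + m)) (p (j + m)) (f (j + m)))
        = (\<Prod>j\<in>?J. (K j * K (j + m)) * ((\<integral>\<^sup>+z. g j z \<partial>?M j) powe a j * (\<integral>\<^sup>+z. g (j + m) z \<partial>?M (j + m)) powe a (j + m)))"
        using J2 by (intro prod.cong refl) (simp add: norm_eq norm_F mult_ac)
      then show ?thesis unfolding prod_double[of K m] by (simp only: prod.distrib mult_ac)
    qed
    finally show ?thesis by (simp only: mult_left_mono zero_le)
  qed
  with C show ?thesis by blast
qed

section \<open>Necessity\<close>

definition bump :: "real \<Rightarrow> real" where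
  "bump r = max 0 (min 1 (2 - \<bar>r\<bar>))"

lemma bump_bounds: "0 \<le> bump r" "bump r \<le> 1"
  by (auto simp: bump_def)

lemma bump_eq_1: "\<bar>r\<bar> \<le> 1 \<Longrightarrow> bump r = 1"
  by (auto simp: bump_def)

lemma bump_nonzero: "bump r \<noteq> 0 \<Longrightarrow> \<bar>r\<bar> \<le> 2"
  by (auto simp: bump_def max_def min_def split: if_splits)

lemma continuous_on_bump [continuous_intros]: "continuous_on S f \<Longrightarrow> continuous_on S (\<lambda>x. bump (f x))"
  unfolding bump_def by (intro continuous_intros)

text \<open>Defined on the ambient space, so that one function serves as \<open>f j\<close> on all
  the codomains.\<close>

definition test_fun :: "('a::euclidean_space \<Rightarrow> real) \<Rightarrow> ('a \<Rightarrow> real) \<Rightarrow> real \<Rightarrow> 'a heis \<Rightarrow> real" where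
  "test_fun X Y \<tau> z = (\<Prod>b\<in>Basis. bump (fst z \<bullet> b / X b)) * (\<Prod>b\<in>Basis. bump (fst (snd z) \<bullet> b / Y b)) * bump (snd (snd z) / \<tau>)"

definition coord_box :: "('a::euclidean_space \<Rightarrow> real) \<Rightarrow> ('a \<Rightarrow> real) \<Rightarrow> real \<Rightarrow> 'a heis set" where
  "coord_box X Y \<tau> = {z. (\<forall>b\<in>Basis. \<bar>fst z \<bullet> b\<bar> \<le> X b) \<and> (\<forall>b\<in>Basis. \<bar>fst (snd z) \<bullet> b\<bar> \<le> Y b) \<and> \<bar>snd (snd z)\<bar> \<le> \<tau>}"

lemma continuous_on_test_fun: "continuous_on S (test_fun X Y \<tau>)"
  unfolding test_fun_def divide_inverse by (intro continuous_intros)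

lemma test_fun_bounds: "0 \<le> test_fun X Y \<tau> z" "test_fun X Y \<tau> z \<le> 1"
  unfolding test_fun_def
  by (intro mult_nonneg_nonneg prod_nonneg mult_le_one prod_le_1 conjI ballI bump_bounds)+

lemma test_fun_eq_1:
  assumes "z \<in> coord_box X Y \<tau>" "\<And>b. b \<in> Basis \<Longrightarrow> 0 < X b" "\<And>b. b \<in> Basis \<Longrightarrow> 0 < Y b" "0 < \<tau>"
  shows "test_fun X Y \<tau> z = 1"
proof -
  have "(\<Prod>b\<in>Basis. bump (fst z \<bullet> b / X b)) = 1" "(\<Prod>b\<in>Basis. bump (fst (snd z) \<bullet> b / Y b)) = 1"
    using assms by (auto simp: coord_box_def intro!: prod.neutral bump_eq_1)
  then show ?thesis
    using assms by (simp add: test_fun_def coord_box_def bump_eq_1)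
qed

lemma test_fun_nonzero:
  assumes "test_fun X Y \<tau> z \<noteq> 0" "\<And>b. b \<in> Basis \<Longrightarrow> 0 < X b" "\<And>b. b \<in> Basis \<Longrightarrow> 0 < Y b" "0 < \<tau>"
  shows "z \<in> coord_box (\<lambda>b. 2 * X b) (\<lambda>b. 2 * Y b) (2 * \<tau>)"
proof -
  have *: "\<bar>r\<bar> \<le> 2 * s" if "bump (r / s) \<noteq> 0" "0 < s" for r s
    using bump_nonzero[OF that(1)] that(2) by (simp add: abs_divide pos_divide_le_eq)
  show ?thesis
    using assms unfolding coord_box_def test_fun_def by (auto intro!: *)
qed

lemma bounded_box: "bounded (coord_box X Y \<tau> :: 'a::euclidean_space heis set)"
proof -
  let ?K = "(\<Sum>b\<in>Basis. X b) + ((\<Sum>b\<in>Basis. Y b) + \<tau>)"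
  have "norm z \<le> ?K" if z: "z \<in> coord_box X Y \<tau>" for z :: "'a heis"
  proof -
    have "norm z \<le> norm (fst z) + norm (snd z)"
      using norm_Pair_le[of "fst z" "snd z"] by simp
    also have "norm (snd z) \<le> norm (fst (snd z)) + norm (snd (snd z))"
      using norm_Pair_le[of "fst (snd z)" "snd (snd z)"] by simp
    also have "norm (fst z) \<le> (\<Sum>b\<in>Basis. X b)"
      using z by (intro order_trans[OF norm_le_l1] sum_mono) (auto simp: coord_box_def)
    also have "norm (fst (snd z)) \<le> (\<Sum>b\<in>Basis. Y b)"
      using z by (intro order_trans[OF norm_le_l1] sum_mono) (auto simp: coord_box_def)
    finally show ?thesis using z by (simp add: coord_box_def)
  qed
  then show ?thesis unfolding bounded_iff by blast
qed

lemma nonneg_Cc_test_fun: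
  assumes "closed S" "\<And>b. b \<in> Basis \<Longrightarrow> 0 < X b" "\<And>b. b \<in> Basis \<Longrightarrow> 0 < Y b" "0 < \<tau>"
  shows "nonneg_Cc S (test_fun X Y \<tau>)"
proof -
  have "{z\<in>S. test_fun X Y \<tau> z \<noteq> 0} \<subseteq> coord_box (\<lambda>b. 2 * X b) (\<lambda>b. 2 * Y b) (2 * \<tau>)"
    using test_fun_nonzero assms(2-4) by blast
  then have "bounded {z\<in>S. test_fun X Y \<tau> z \<noteq> 0}"
    using bounded_box bounded_subset by blast
  then show ?thesis
    using assms(1) by (auto simp: nonneg_Cc_def test_fun_bounds continuous_on_test_fun intro!: closed_Int_compact)
qed

lemma closed_box: "closed (coord_box X Y \<tau> :: 'a::euclidean_space heis set)"
proof -
  have "coord_box X Y \<tau> = (\<Inter>b\<in>Basis. {z :: 'a heis. \<bar>fst z \<bullet> b\<bar> \<le> X b}) \<inter>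
      (\<Inter>b\<in>Basis. {z. \<bar>fst (snd z) \<bullet> b\<bar> \<le> Y b}) \<inter> {z. \<bar>snd (snd z)\<bar> \<le> \<tau>}"
    by (auto simp: coord_box_def)
  then show ?thesis
    by (auto intro!: closed_Int closed_INT closed_Collect_le continuous_intros)
qed

text \<open>For a basis vector outside the subspace the box condition reads
  \<open>0 \<le> X b\<close>, true by positivity, so only the remaining coordinates contribute to
  the volume.\<close>

lemma nn_integral_box:
  fixes X Y :: "'a::euclidean_space \<Rightarrow> real"
  assumes VW: "coordinate_subspace V" "coordinate_subspace W"
    and pos: "\<And>b. b \<in> Basis \<Longrightarrow> 0 < X b" "\<And>b. b \<in> Basis \<Longrightarrow> 0 < Y b" "0 < \<tau>"
  shows "(\<integral>\<^sup>+z. indicator (coord_box X Y \<tau>) z \<partial>coord3 V W)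
    = ennreal ((\<Prod>b\<in>Basis \<inter> V. 2 * X b) * (\<Prod>b\<in>Basis \<inter> W. 2 * Y b) * (2 * \<tau>))"
proof -
  have PX: "(\<integral>\<^sup>+x. (\<Prod>b\<in>Basis \<inter> A. indicator {- Z b..Z b} (x b)) \<partial>lebP (Basis \<inter> A)) = ennreal (\<Prod>b\<in>Basis \<inter> A. 2 * Z b)"
    if "\<And>b. b \<in> Basis \<Longrightarrow> 0 < Z b" for Z and A :: "'a set"
  proof -
    have "(\<integral>\<^sup>+x. (\<Prod>b\<in>Basis \<inter> A. indicator {- Z b..Z b} (x b)) \<partial>lebP (Basis \<inter> A))
        = (\<Prod>b\<in>Basis \<inter> A. \<integral>\<^sup>+r. indicator {- Z b..Z b} r \<partial>lborel)"
      by (rule lebP.product_nn_integral_prod) auto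
    also have "\<dots> = (\<Prod>b\<in>Basis \<inter> A. ennreal (2 * Z b))"
      using that by (intro prod.cong) (auto simp: less_imp_le)
    also have "\<dots> = ennreal (\<Prod>b\<in>Basis \<inter> A. 2 * Z b)"
      using that by (intro prod_ennreal) (auto simp: less_imp_le)
    finally show ?thesis .
  qed
  have ind: "lift3 V W (indicator (coord_box X Y \<tau>)) x y t
      = (\<Prod>b\<in>Basis \<inter> V. indicator {- X b..X b} (x b)) * ((\<Prod>b\<in>Basis \<inter> W. indicator {- Y b..Y b} (y b)) * indicator {- \<tau>..\<tau>} t)" for x y t
  proof -
    have ind_prod: "(\<Prod>b\<in>Basis \<inter> A. indicator {- Z b..Z b} (x b)) = (if \<forall>b\<in>Basis. \<bar>emb (Basis \<inter> A) x \<bullet> b\<bar> \<le> Z b then 1 else (0::ennreal))"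
      if "\<And>b. b \<in> Basis \<Longrightarrow> 0 < Z b" for Z x and A :: "'a set"
    proof (cases "\<forall>b\<in>Basis. \<bar>emb (Basis \<inter> A) x \<bullet> b\<bar> \<le> Z b")
      case True
      then have "x b \<in> {- Z b..Z b}" if "b \<in> Basis \<inter> A" for b
        using bspec[OF True, of b] that by (auto simp: emb_inner abs_le_iff)
      then show ?thesis using True by simp
    next
      case False
      then obtain b where b: "b \<in> Basis" "\<not> \<bar>emb (Basis \<inter> A) x \<bullet> b\<bar> \<le> Z b" by blast
      then have "b \<in> A" "x b \<notin> {- Z b..Z b}"
        using that[OF b(1)] by (auto simp: emb_inner abs_le_iff split: if_splits)
      then have "(\<Prod>b\<in>Basis \<inter> A. indicator {- Z b..Z b} (x b)) = (0::ennreal)"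
        using b(1) by (intro prod_zero bexI[of _ b]) auto
      then show ?thesis unfolding if_not_P[OF False] .
    qed
    have "(\<Prod>b\<in>Basis \<inter> V. indicator {- X b..X b} (x b)) = (if \<forall>b\<in>Basis. \<bar>emb (Basis \<inter> V) x \<bullet> b\<bar> \<le> X b then 1 else (0::ennreal))"
      "(\<Prod>b\<in>Basis \<inter> W. indicator {- Y b..Y b} (y b)) = (if \<forall>b\<in>Basis. \<bar>emb (Basis \<inter> W) y \<bullet> b\<bar> \<le> Y b then 1 else (0::ennreal))"
      by (rule ind_prod, rule pos, assumption)+
    then show ?thesis
      by (simp add: lift3_def coord_box_def indicator_def abs_le_iff[of t] conj_commute minus_le_iff)
  qed
  have "(\<integral>\<^sup>+z. indicator (coord_box X Y \<tau>) z \<partial>coord3 V W) = mass (Basis \<inter> V) (Basis \<inter> W) (lift3 V W (indicator (coord_box X Y \<tau>)))"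
    using closed_box[of X Y \<tau>] by (intro nn_integral_coord3 VW) auto
  also have "\<dots> = (\<integral>\<^sup>+x. (\<Prod>b\<in>Basis \<inter> V. indicator {- X b..X b} (x b)) \<partial>lebP (Basis \<inter> V))
      * ((\<integral>\<^sup>+y. (\<Prod>b\<in>Basis \<inter> W. indicator {- Y b..Y b} (y b)) \<partial>lebP (Basis \<inter> W)) * ennreal (2 * \<tau>))"
    unfolding mass_def ind using pos(3)
    by (simp add: nn_integral_cmult nn_integral_multc)
  also have "\<dots> = ennreal ((\<Prod>b\<in>Basis \<inter> V. 2 * X b) * (\<Prod>b\<in>Basis \<inter> W. 2 * Y b) * (2 * \<tau>))"
  proof -
    have "(\<integral>\<^sup>+x. (\<Prod>b\<in>Basis \<inter> V. indicator {- X b..X b} (x b)) \<partial>lebP (Basis \<inter> V)) = ennreal (\<Prod>b\<in>Basis \<inter> V. 2 * X b)"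
      "(\<integral>\<^sup>+y. (\<Prod>b\<in>Basis \<inter> W. indicator {- Y b..Y b} (y b)) \<partial>lebP (Basis \<inter> W)) = ennreal (\<Prod>b\<in>Basis \<inter> W. 2 * Y b)"
      by (rule PX, rule pos, assumption)+
    moreover have "0 \<le> (\<Prod>b\<in>Basis \<inter> V. 2 * X b)" "0 \<le> (\<Prod>b\<in>Basis \<inter> W. 2 * Y b)" "0 \<le> 2 * \<tau>"
      using pos by (auto intro!: prod_nonneg simp: less_imp_le)
    ultimately show ?thesis by (simp only: ennreal_mult[symmetric] mult.assoc mult_nonneg_nonneg)
  qed
  finally show ?thesis .
qed

text \<open>The test function lies between 0 and the indicator of the doubled box. At
  \<open>p = \<infinity>\<close> the right side is 1 by the convention on power 0.\<close>

lemma Lp_norm_test_fun_le: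
  fixes X Y :: "'a::euclidean_space \<Rightarrow> real"
  assumes p: "1 \<le> p"
    and pos: "\<And>b. b \<in> Basis \<Longrightarrow> 0 < X b" "\<And>b. b \<in> Basis \<Longrightarrow> 0 < Y b" "0 < \<tau>"
  shows "Lp_norm (coord3 V W) p (test_fun X Y \<tau>)
    \<le> (\<integral>\<^sup>+z. indicator (coord_box (\<lambda>b. 2 * X b) (\<lambda>b. 2 * Y b) (2 * \<tau>)) z \<partial>coord3 V W) powe recip p"
proof (cases "p = \<infinity>")
  case True
  have "test_fun X Y \<tau> \<in> borel_measurable borel"
    by (intro borel_measurable_continuous_onI continuous_on_test_fun)
  then have "(\<lambda>z. ennreal \<bar>test_fun X Y \<tau> z\<bar>) \<in> borel_measurable (coord3 V W)"
    by (intro measurable_coord3) measurable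
  then have "esssup (coord3 V W) (\<lambda>z. ennreal \<bar>test_fun X Y \<tau> z\<bar>) \<le> 1"
    using test_fun_bounds[of X Y \<tau>] by (intro esssup_I AE_I2) auto
  then show ?thesis using True by (simp add: Lp_norm_def recip_infinity)
next
  case False
  note r = recip_finite[OF p False]
  have "ennreal (\<bar>test_fun X Y \<tau> z\<bar> powr enn2real p) \<le> indicator (coord_box (\<lambda>b. 2 * X b) (\<lambda>b. 2 * Y b) (2 * \<tau>)) z" for z
  proof (cases "test_fun X Y \<tau> z = 0")
    case nz: False
    have "\<bar>test_fun X Y \<tau> z\<bar> powr enn2real p \<le> 1"
      using test_fun_bounds[of X Y \<tau> z] r by (intro powr_le1) auto
    then show ?thesis using test_fun_nonzero[OF nz pos] by simp
  qed simp
  then show ?thesis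
    unfolding Lp_norm_finite[OF p False] by (intro epow_mono recip_nonneg nn_integral_mono)
qed

section \<open>Growth rates for boxes of size r to various powers\<close>

lemma prod_const_powr:
  fixes r c :: real
  assumes "0 < r"
  shows "(\<Prod>b\<in>A. c * r powr \<alpha> b) = c ^ card A * r powr (\<Sum>b\<in>A. \<alpha> b)"
  using assms by (cases "finite A") (simp_all add: prod.distrib powr_sum)

lemma powr_growth_le:
  assumes "\<And>r::real. 1 \<le> r \<Longrightarrow> r powr s \<le> K * r powr t"
  shows "s \<le> t"
proof (rule ccontr)
  assume "\<not> s \<le> t"
  then have d: "0 < s - t" by simp
  \<comment> \<open>Solves \<open>r powr (s - t) = \<bar>K\<bar> + 1\<close>, which already
    contradicts the bound.\<close>
  define r where "r = (\<bar>K\<bar> + 1) powr (1 / (s - t))"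
  have r: "1 \<le> r" unfolding r_def using d by (intro ge_one_powr_ge_zero) auto
  have "r powr (s - t) = \<bar>K\<bar> + 1" using d by (simp add: r_def powr_powr)
  then have "r powr s = (\<bar>K\<bar> + 1) * r powr t"
    using r by (simp add: powr_diff field_simps)
  then show False
    using assms[OF r] r by (smt (verit) mult_right_mono powr_gt_zero mult_less_cancel_right)
qed

text \<open>On a box with \<open>X b * Y b \<le> \<tau>\<close> the shear is at most DIM times
  \<open>\<tau>\<close>, and projections only delete coordinates. So all the maps send the box into
  the one of height \<open>(1 + real DIM('a)) * \<tau>\<close>, where the test function is
  1.\<close>

lemma heis_form_test_fun_ge:
  fixes X Y :: "'a::euclidean_space \<Rightarrow> real"
  assumes V: "\<forall>j\<in>{1..2*m}. coordinate_subspace (V j)"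
    and pos: "\<And>b. b \<in> Basis \<Longrightarrow> 0 < X b" "\<And>b. b \<in> Basis \<Longrightarrow> 0 < Y b" "0 < \<tau>"
    and XY: "\<And>b. b \<in> Basis \<Longrightarrow> X b * Y b \<le> \<tau>"
  shows "(\<integral>\<^sup>+z. indicator (coord_box X Y \<tau>) z \<partial>lborel) \<le> heis_form m V (\<lambda>_. test_fun X Y ((1 + real DIM('a)) * \<tau>))"
  unfolding heis_form_def
proof (rule nn_integral_mono)
  fix z :: "'a heis"
  show "indicator (coord_box X Y \<tau>) z \<le> (\<Prod>j=1..2*m. ennreal (test_fun X Y ((1 + real DIM('a)) * \<tau>) (heis_proj m V j z)))"
  proof (cases "z \<in> coord_box X Y \<tau>")
    case True
    obtain x y t where z: "z = (x, y, t)" by (cases z)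
    have x: "\<bar>x \<bullet> b\<bar> \<le> X b" and y: "\<bar>y \<bullet> b\<bar> \<le> Y b" if "b \<in> Basis" for b
      using True that by (auto simp: coord_box_def z)
    have t: "\<bar>t\<bar> \<le> \<tau>" using True by (simp add: coord_box_def z)
    have "test_fun X Y ((1 + real DIM('a)) * \<tau>) (heis_proj m V j z) = 1" if j: "j \<in> {1..2*m}" for j
    proof (rule test_fun_eq_1)
      have Vj: "coordinate_subspace (V j)" using V j by blast
      have "\<bar>\<Sum>b\<in>Basis - V j. (x \<bullet> b) * (y \<bullet> b)\<bar> \<le> (\<Sum>b\<in>Basis - V j. \<tau>)"
      proof (rule order_trans[OF sum_abs sum_mono])
        fix b assume "b \<in> Basis - V j"
        then show "\<bar>(x \<bullet> b) * (y \<bullet> b)\<bar> \<le> \<tau>"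
          using mult_mono[OF x y, of b b] XY[of b] pos(1)[of b] by (auto simp: abs_mult)
      qed
      also have "\<dots> \<le> (\<Sum>b\<in>(Basis::'a set). \<tau>)"
        using pos(3) by (intro sum_mono2) auto
      finally have "\<bar>(x - orth_proj (V j) x) \<bullet> (y - orth_proj (V j) y)\<bar> \<le> real DIM('a) * \<tau>"
        by (simp add: inner_compl_proj[OF Vj])
      moreover have "\<bar>orth_proj (V j) x \<bullet> b\<bar> \<le> X b" "\<bar>orth_proj (V j) y \<bullet> b\<bar> \<le> Y b" if "b \<in> Basis" for b
        using x[OF that] y[OF that] pos(1,2)[OF that] by (simp_all add: orth_proj_inner[OF Vj that])
      ultimately show "heis_proj m V j z \<in> coord_box X Y ((1 + real DIM('a)) * \<tau>)"
        using x y t by (auto simp: heis_proj_def heis_proj1_def heis_proj2_def coord_box_def z distrib_right)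
    qed (use pos in auto)
    then show ?thesis by (simp add: indicator_def)
  qed simp
qed

text \<open>With side lengths that are powers of \<open>r\<close>, both sides of the inequality are
  powers of \<open>r\<close> up to constants, and for large \<open>r\<close> the exponents must
  compare. The constraint on \<open>\<omega>\<close> is what bounds the shear when
  \<open>r \<ge> 1\<close>.\<close>

lemma necessity_boxes:
  fixes V :: "nat \<Rightarrow> 'a::euclidean_space set" and p :: "nat \<Rightarrow> ennreal"
  assumes V: "\<forall>j\<in>{1..2*m}. coordinate_subspace (V j)" and Vm: "\<forall>j\<in>{1..m}. V (j + m) = V j"
    and p: "\<forall>j\<in>{1..2*m}. 1 \<le> p j" and C: "C < \<infinity>"
    and bound: "\<And>f. (\<forall>j\<in>{1..2*m}. nonneg_Cc (heis_codomain m V j) (f j)) \<Longrightarrow>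
           heis_form m V f \<le>
             C * (\<Prod>j=1..m. Lp_norm (heis_codomain_measure m V j) (p j) (f j) *
                    Lp_norm (heis_codomain_measure m V (j + m)) (p (j + m)) (f (j + m)))"
    and \<omega>: "\<And>b. b \<in> Basis \<Longrightarrow> \<alpha> b + \<beta> b \<le> (\<omega>::real)"
  shows "(\<Sum>b\<in>Basis. \<alpha> b) + (\<Sum>b\<in>Basis. \<beta> b) + \<omega> \<le>
    (\<Sum>j=1..m. recip (p j) * ((\<Sum>b\<in>Basis \<inter> V j. \<alpha> b) + (\<Sum>b\<in>Basis. \<beta> b) + \<omega>)
       + recip (p (j + m)) * ((\<Sum>b\<in>Basis. \<alpha> b) + (\<Sum>b\<in>Basis \<inter> V j. \<beta> b) + \<omega>))"
proof -
  let ?B = "Basis :: 'a set"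
  define \<kappa> where "\<kappa> = 1 + real DIM('a)"
  have \<kappa>: "0 < \<kappa>" by (simp add: \<kappa>_def add_pos_nonneg)
  \<comment> \<open>The doubled box has sides \<open>2 * (2 * X b)\<close> and, in \<open>t\<close>,
    \<open>2 * (2 * (\<kappa> * \<tau>))\<close>; hence the factors 4. The same constant serves both
    maps of index \<open>j\<close>, since each removes one copy of the same block.\<close>
  define c where "c j = 4 ^ card (?B \<inter> V j) * 4 ^ card ?B * (4 * \<kappa>)" for j
  define e1 where "e1 j = (\<Sum>b\<in>?B \<inter> V j. \<alpha> b) + (\<Sum>b\<in>?B. \<beta> b) + \<omega>" for j
  define e2 where "e2 j = (\<Sum>b\<in>?B. \<alpha> b) + (\<Sum>b\<in>?B \<inter> V j. \<beta> b) + \<omega>" for j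
  define E where "E = (\<Sum>b\<in>?B. \<alpha> b) + (\<Sum>b\<in>?B. \<beta> b) + \<omega>"
  define E' where "E' = (\<Sum>j=1..m. recip (p j) * e1 j + recip (p (j + m)) * e2 j)"
  define K where "K = enn2real C * (\<Prod>j=1..m. c j powr recip (p j) * c j powr recip (p (j + m)))"
  have c_pos: "0 < c j" for j using \<kappa> by (simp add: c_def)
  have V1: "coordinate_subspace (V j)" if "j \<in> {1..m}" for j using V that by auto
  have closed_S: "closed (heis_codomain m V j)" if "j \<in> {1..2*m}" for j
  proof -
    have "closed (V j)" using V that by (intro closed_subspace subspace_coordinate_subspace) auto
    then show ?thesis by (auto simp: heis_codomain_def intro!: closed_Times)
  qed
  have growth: "r powr E \<le> K * r powr E'" if r: "1 \<le> r" for r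
  proof -
    define X where "X b = r powr \<alpha> b" for b
    define Y where "Y b = r powr \<beta> b" for b
    define \<tau> where "\<tau> = r powr \<omega>"
    have pos: "\<And>b. b \<in> ?B \<Longrightarrow> 0 < X b" "\<And>b. b \<in> ?B \<Longrightarrow> 0 < Y b" "0 < \<tau>" "0 < \<kappa> * \<tau>"
      and pos2: "\<And>b. b \<in> ?B \<Longrightarrow> 0 < 2 * X b" "\<And>b. b \<in> ?B \<Longrightarrow> 0 < 2 * Y b" "0 < 2 * (\<kappa> * \<tau>)"
      using r \<kappa> by (auto simp: X_def Y_def \<tau>_def)
    have XY: "X b * Y b \<le> \<tau>" if "b \<in> ?B" for b
      using r \<omega>[OF that] by (simp add: X_def Y_def \<tau>_def powr_add[symmetric] powr_mono)
    define T where "T = test_fun X Y (\<kappa> * \<tau>)"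
    have norm1: "Lp_norm (heis_codomain_measure m V j) (p j) T \<le> ennreal (c j powr recip (p j) * r powr (recip (p j) * e1 j))"
      and norm2: "Lp_norm (heis_codomain_measure m V (j + m)) (p (j + m)) T
        \<le> ennreal (c j powr recip (p (j + m)) * r powr (recip (p (j + m)) * e2 j))" if j: "j \<in> {1..m}" for j
    proof -
      have vol: "ennreal (c j * r powr e) powe s = ennreal (c j powr s * r powr (s * e))" for e s
        using c_pos[of j] r by (simp add: epow_ennreal_pos powr_mult powr_powr mult.commute[of e])
      have "1 \<le> p j" "1 \<le> p (j + m)" using p j by auto
      then have "Lp_norm (heis_codomain_measure m V j) (p j) T
          \<le> (\<integral>\<^sup>+z. indicator (coord_box (\<lambda>b. 2 * X b) (\<lambda>b. 2 * Y b) (2 * (\<kappa> * \<tau>))) z \<partial>coord3 (V j) UNIV) powe recip (p j)"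
        "Lp_norm (heis_codomain_measure m V (j + m)) (p (j + m)) T
          \<le> (\<integral>\<^sup>+z. indicator (coord_box (\<lambda>b. 2 * X b) (\<lambda>b. 2 * Y b) (2 * (\<kappa> * \<tau>))) z \<partial>coord3 UNIV (V j)) powe recip (p (j + m))"
        using j Vm Lp_norm_test_fun_le[OF _ pos(1,2,4)] by (auto simp: T_def heis_codomain_measure_eq)
      moreover have vol': "(\<Prod>b\<in>A. 2 * (2 * X b)) = 4 ^ card A * r powr (\<Sum>b\<in>A. \<alpha> b)"
        "(\<Prod>b\<in>A. 2 * (2 * Y b)) = 4 ^ card A * r powr (\<Sum>b\<in>A. \<beta> b)" for A
        using prod_const_powr[of r 4 \<alpha> A] prod_const_powr[of r 4 \<beta> A] r
        by (simp_all add: X_def Y_def mult.assoc[symmetric])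
      moreover have "(\<integral>\<^sup>+z. indicator (coord_box (\<lambda>b. 2 * X b) (\<lambda>b. 2 * Y b) (2 * (\<kappa> * \<tau>))) z \<partial>coord3 (V j) UNIV) = ennreal (c j * r powr e1 j)"
        "(\<integral>\<^sup>+z. indicator (coord_box (\<lambda>b. 2 * X b) (\<lambda>b. 2 * Y b) (2 * (\<kappa> * \<tau>))) z \<partial>coord3 UNIV (V j)) = ennreal (c j * r powr e2 j)"
      proof -
        show "(\<integral>\<^sup>+z. indicator (coord_box (\<lambda>b. 2 * X b) (\<lambda>b. 2 * Y b) (2 * (\<kappa> * \<tau>))) z \<partial>coord3 (V j) UNIV) = ennreal (c j * r powr e1 j)"
          using nn_integral_box[OF V1[OF j] coordinate_subspace_UNIV, of "\<lambda>b. 2 * X b" "\<lambda>b. 2 * Y b" "2 * (\<kappa> * \<tau>)"] pos2 vol'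
          by (simp add: \<tau>_def c_def e1_def powr_add mult_ac)
        show "(\<integral>\<^sup>+z. indicator (coord_box (\<lambda>b. 2 * X b) (\<lambda>b. 2 * Y b) (2 * (\<kappa> * \<tau>))) z \<partial>coord3 UNIV (V j)) = ennreal (c j * r powr e2 j)"
          using nn_integral_box[OF coordinate_subspace_UNIV V1[OF j], of "\<lambda>b. 2 * X b" "\<lambda>b. 2 * Y b" "2 * (\<kappa> * \<tau>)"] pos2 vol'
          by (simp add: \<tau>_def c_def e2_def powr_add mult_ac)
      qed
      ultimately show "Lp_norm (heis_codomain_measure m V j) (p j) T \<le> ennreal (c j powr recip (p j) * r powr (recip (p j) * e1 j))"
        "Lp_norm (heis_codomain_measure m V (j + m)) (p (j + m)) T
        \<le> ennreal (c j powr recip (p (j + m)) * r powr (recip (p (j + m)) * e2 j))"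
        by (simp_all add: vol)
    qed
    have "ennreal (r powr E) \<le> ennreal (2 ^ card ?B * 2 ^ card ?B * 2 * r powr E)"
    proof (intro ennreal_leI)
      have "(1::real) \<le> 2 ^ card ?B * 2 ^ card ?B * 2"
        using mult_mono[of 1 "2 ^ card ?B :: real" 1 "2 ^ card ?B"] by simp
      from mult_right_mono[OF this, of "r powr E"]
      show "r powr E \<le> 2 ^ card ?B * 2 ^ card ?B * 2 * r powr E" by simp
    qed
    also have "\<dots> = (\<integral>\<^sup>+z. indicator (coord_box X Y \<tau>) z \<partial>lborel)"
      using nn_integral_box[OF coordinate_subspace_UNIV coordinate_subspace_UNIV, of X Y \<tau>] pos r
      by (simp add: coord3_UNIV X_def Y_def \<tau>_def prod_const_powr E_def powr_add mult_ac)
    also have "\<dots> \<le> heis_form m V (\<lambda>_. T)"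
      unfolding T_def \<kappa>_def by (rule heis_form_test_fun_ge[OF V]) (use pos XY in auto)
    also have "\<dots> \<le> C * (\<Prod>j=1..m. Lp_norm (heis_codomain_measure m V j) (p j) T *
                    Lp_norm (heis_codomain_measure m V (j + m)) (p (j + m)) T)"
      unfolding T_def using pos closed_S by (intro bound ballI nonneg_Cc_test_fun) auto
    also have "\<dots> \<le> C * (\<Prod>j=1..m. ennreal (c j powr recip (p j) * r powr (recip (p j) * e1 j)) *
                    ennreal (c j powr recip (p (j + m)) * r powr (recip (p (j + m)) * e2 j)))"
      by (intro mult_left_mono prod_mono_ennreal mult_mono norm1 norm2) auto
    also have "\<dots> = C * ennreal (\<Prod>j=1..m. (c j powr recip (p j) * c j powr recip (p (j + m))) * r powr (recip (p j) * e1 j + recip (p (j + m)) * e2 j))"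
      by (subst prod_ennreal[symmetric]) (simp_all add: ennreal_mult[symmetric] powr_add mult_ac)
    also have "\<dots> = ennreal (K * r powr E')"
    proof -
      have "(\<Prod>j=1..m. (c j powr recip (p j) * c j powr recip (p (j + m))) * r powr (recip (p j) * e1 j + recip (p (j + m)) * e2 j))
          = (\<Prod>j=1..m. c j powr recip (p j) * c j powr recip (p (j + m))) * r powr E'"
        unfolding E'_def using r by (subst powr_sum) (auto simp: prod.distrib)
      moreover have "C = ennreal (enn2real C)" using C by (simp add: less_top)
      ultimately show ?thesis
        by (metis (no_types, lifting) K_def ennreal_mult' enn2real_nonneg mult.assoc)
    qed
    finally show "r powr E \<le> K * r powr E'"
      by (subst (asm) ennreal_le_iff) (simp_all add: K_def prod_nonneg)
  qed
  then have "E \<le> E'" by (rule powr_growth_le)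
  then show ?thesis by (simp add: E_def E'_def e1_def e2_def)
qed

theorem proposition2p2:
  fixes m :: nat
    and V :: "nat \<Rightarrow> (real ^ 'n) set"
    and p :: "nat \<Rightarrow> ennreal"
  assumes "m \<ge> 1"
    and "\<forall>j\<in>{1..2*m}. coordinate_subspace (V j)"
    and "\<forall>j\<in>{1..m}. V (j + m) = V j"
    and "is_direct_sum {1..m} (\<lambda>j. proj_kernel (V j))"
    and "\<forall>j\<in>{1..2*m}. 1 \<le> p j"
  shows
    "(\<exists>C::ennreal. C < \<infinity> \<and>
        (\<forall>f :: nat \<Rightarrow> (real ^ 'n) heis \<Rightarrow> real.
           (\<forall>j\<in>{1..2*m}. nonneg_Cc (heis_codomain m V j) (f j)) \<longrightarrow>
           heis_form m V f \<le>
             C * (\<Prod>j=1..m. Lp_norm (heis_codomain_measure m V j) (p j) (f j) *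
                    Lp_norm (heis_codomain_measure m V (j + m)) (p (j + m)) (f (j + m)))))
     \<longleftrightarrow>
     (real CARD('n) + 1 =
        (\<Sum>j=1..m. (real (dim (V j)) + 1) * recip (p j) + (real CARD('n) + 1) * recip (p (j + m))) \<and>
      real CARD('n) + 1 =
        (\<Sum>j=1..m. (real CARD('n) + 1) * recip (p j) + (real (dim (V j)) + 1) * recip (p (j + m))) \<and>
      (\<forall>W :: (real ^ 'n) set. coordinate_subspace W \<longrightarrow>
         real (dim W) + 1 \<le>
           (\<Sum>j=1..m. (real (dim (orth_proj (V j) ` W)) + 1) * recip (p j)
                       + (real (dim W) + 1) * recip (p (j + m))) \<and>
         real (dim W) + 1 \<le>
           (\<Sum>j=1..m. (real (dim W) + 1) * recip (p j)
                       + (real (dim (orth_proj (V j) ` W)) + 1) * recip (p (j + m))) \<and>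
         (\<Sum>j=1..m. (real (dim W) - real (dim (orth_proj (V j) ` W)))
                       * (recip (p j) - recip (p (j + m)))) = 0))"
    (is "?bounded \<longleftrightarrow> ?A1 \<and> ?A2 \<and> (\<forall>W. _ \<longrightarrow> ?BC W)")
proof -
  let ?I = "Basis :: (real ^ 'n) set" and ?J = "{1..m}"
  define B where "B j = ?I - V j" for j
  define n where "n = real (card ?I)"
  define \<sigma> where "\<sigma> = (\<Sum>j=1..m. recip (p j) + recip (p (j + m))) - 1"
  have n: "real CARD('n) = n" by (simp add: n_def)
  have V1: "coordinate_subspace (V j)" if "j \<in> ?J" for j using assms(2) that by auto
  note part = direct_sum_kernels_partition[OF V1 finite_atLeastAtMost assms(4), folded B_def]
  have BI: "B j \<subseteq> ?I" for j by (auto simp: B_def)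
  have card_split: "real (card (S \<inter> V j)) = real (card S) - real (card (S \<inter> B j))" if "S \<subseteq> ?I" for S j
  proof -
    have "card S = card (S \<inter> V j) + card (S \<inter> B j)"
      using that finite_subset[OF that finite_Basis]
      by (subst card_Un_disjoint[symmetric]) (auto simp: B_def intro!: arg_cong[where f=card])
    then show ?thesis by simp
  qed
  have dim_V: "real (dim (V j)) = n - real (card (B j))" if "j \<in> ?J" for j
    using card_split[of ?I j] BI[of j] by (simp add: dim_coordinate_subspace[OF V1[OF that]] n_def Int_absorb1)
  have dim_proj: "real (dim (orth_proj (V j) ` span S)) = real (card S) - real (card (S \<inter> B j))"
    if "j \<in> ?J" "S \<subseteq> ?I" for j S
    using card_split[OF that(2)]
    by (simp add: dim_orth_proj_image[OF V1[OF that(1)] coordinate_subspace_span[OF that(2)]] Basis_inter_span[OF that(2)])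
  have dim_S: "dim S = card S" if "S \<subseteq> ?I" for S
    using dim_coordinate_subspace[OF coordinate_subspace_span[OF that]] Basis_inter_span[OF that] by simp
  \<comment> \<open>Coordinate subspaces are replaced by the sets of basis vectors spanning them, so
    the dimension conditions become conditions on cardinalities.\<close>
  have all_W: "(\<forall>W. coordinate_subspace W \<longrightarrow> P W) \<longleftrightarrow> (\<forall>S\<subseteq>?I. P (span S))" for P
    using coordinate_subspace_span by (auto simp: coordinate_subspace_def)
  have exponents: "?A1 \<and> ?A2 \<and> (\<forall>W. coordinate_subspace W \<longrightarrow> ?BC W) \<longleftrightarrow>
    (\<forall>j\<in>?J. B j \<noteq> {} \<longrightarrow> recip (p j) = recip (p (j + m)) \<and> \<sigma> \<le> recip (p j)) \<and>
    (\<Sum>j\<in>?J. real (card (B j)) * recip (p j)) = (n + 1) * \<sigma>"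
    unfolding all_W n
    using exponent_conditions_iff[where a="\<lambda>j. recip (p j)" and b="\<lambda>j. recip (p (j + m))" and B=B and n=n,
        OF finite_Basis finite_atLeastAtMost BI part(1) part(2) \<sigma>_def n_def]
    by (simp add: dim_V dim_proj dim_S cong: sum.cong_simp)
  show ?thesis
    unfolding exponents
  proof
    assume ?bounded
    then obtain C where C: "C < \<infinity>" and bound: "\<And>f. (\<forall>j\<in>{1..2*m}. nonneg_Cc (heis_codomain m V j) (f j)) \<Longrightarrow>
           heis_form m V f \<le>
             C * (\<Prod>j=1..m. Lp_norm (heis_codomain_measure m V j) (p j) (f j) *
                    Lp_norm (heis_codomain_measure m V (j + m)) (p (j + m)) (f (j + m)))"
      by blast
    have IB: "?I - B j = ?I \<inter> V j" for j by (auto simp: B_def)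
    show "(\<forall>j\<in>?J. B j \<noteq> {} \<longrightarrow> recip (p j) = recip (p (j + m)) \<and> \<sigma> \<le> recip (p j)) \<and>
      (\<Sum>j\<in>?J. real (card (B j)) * recip (p j)) = (n + 1) * \<sigma>"
      by (rule exponent_conditions_necessary[OF finite_Basis finite_atLeastAtMost BI part(1) part(2) \<sigma>_def n_def])
        (auto simp only: IB intro!: necessity_boxes[OF assms(2,3,5) C bound])
  next
    assume "(\<forall>j\<in>?J. B j \<noteq> {} \<longrightarrow> recip (p j) = recip (p (j + m)) \<and> \<sigma> \<le> recip (p j)) \<and>
      (\<Sum>j\<in>?J. real (card (B j)) * recip (p j)) = (n + 1) * \<sigma>"
    then show ?bounded
      unfolding B_def n_def by (intro sufficiency[OF assms(2-5) \<sigma>_def]) auto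
  qed
qed

end
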